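(* Let $V$ be a three-Higgs-doublet potential with a CP4 symmetry, with bilinear-form quartic matrix $\Lambda$ (real symmetric $8\times8$). Let $W_4\subset\mathbb{R}^8$ be the $\Lambda$-invariant 4-dimensional subspace which, in a basis where the CP4 matrix is $X=\begin{pmatrix}0&1&0\\-1&0&0\\0&0&1\end{pmatrix}$, is the coordinate subspace $(x_4,x_5,x_6,x_7)$. Assume that $\Lambda|_{W_4}$ has two distinct eigenvalues, each of multiplicity two, with eigenspaces $E_1,E_2\subset W_4$. Consider all quadruples $(q,q',p,p')$ such that $(q,q')$ is an orthonormal basis of $E_1$, $(p,p')$ is an orthonormal basis of $E_2$, and $f_{ijk}q_jq'_k=f_{ijk}p_jp'_k$ for all $i$. Let $u$ be the vector $u_i=f_{ijk}q_jq'_k$ (which is independent of the quadruple up to sign), and let $U$ be the set of all vectors $w$ of the form $w_i=f_{ijk}q_jp_k-f_{ijk}q'_jp'_k$ obtained from such quadruples. Then: (i) if $u$ is an eigenvector of $\Lambda$, or if $U$ contains an eigenvector of $\Lambda$, then $V$ possesses, in addition to CP4, a CP2 symmetry (a $CP$ symmetry of order 2); (ii) if neither $u$ nor any element of $U$ is an eigenvector of $\Lambda$, then $V$ has no CP2 symmetry, and $V$ is a pure CP4 model: up to global phase transformations, every family symmetry and every generalized $CP$ symmetry of $V$ belongs to the group generated by CP4.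
   Context: Setting. There are three Higgs doublets $\phi_a\in\mathbb{C}^2$, $a=1,2,3$, and the (real-valued) potential is $V=Y_{ab}(\phi_a^\dagger\phi_b)+Z_{abcd}(\phi_a^\dagger\phi_b)(\phi_c^\dagger\phi_d)$ (repeated indices summed). Let $t_i=\lambda_i/2$, $i=1,\dots,8$, with $\lambda_i$ the standard Gell-Mann matrices. The tensors $f_{ijk}$ (totally antisymmetric) and $d_{ijk}$ (totally symmetric) are defined by $[t_i,t_j]=i f_{ijk}t_k$ and $\{t_i,t_j\}=\frac13\delta_{ij}\mathbf{1}_3+d_{ijk}t_k$. The bilinears are $r_0=\frac{1}{\sqrt3}\phi_a^\dagger\phi_a$ and $r_i=\phi_a^\dagger(t_i)_{ab}\phi_b$. Every potential $V$ can be written uniquely as $V = M_0 r_0 + M_i r_i + \Lambda_0 r_0^2 + L_i r_0 r_i + \Lambda_{ij} r_i r_j$ with real coefficients and $\Lambda_{ij}=\Lambda_{ji}$. Coordinates on the adjoint space $\mathbb{R}^8\ni r$ are denoted $x_1,\dots,x_8$. A basis change $\phi\mapsto U\phi$ with $U$ unitary acts on $\mathbb{R}^8$ by the adjoint representation (an orthogonal transformation). Symmetries. A family symmetry is a map $\phi_a\mapsto S_{ab}\phi_b$ and a generalized $CP$ symmetry is a map $\phi_a\mapsto X_{ab}\phi_b^*$, with $S$, $X$ unitary $3\times 3$ matrices, leaving $V$ invariant ($*$ is componentwise complex conjugation of the doublets; the space-time argument is suppressed). Applying the latter twice gives $\phi_a\mapsto (XX^* )_{ab}\phi_b$; under a basis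 change $\phi\mapsto U\phi$, $X\mapsto UXU^T$. A $CP$ symmetry has order 2 (CP2) if $XX^*=\mathbf 1$, and order 4 (CP4) if $XX^*\neq\mathbf 1$, $(XX^* )^2=\mathbf 1$; for a CP4 there is a basis in which $X=\begin{pmatrix}0&1&0\\-1&0&0\\0&0&1\end{pmatrix}$. In that basis CP4 acts on the adjoint space by $x_8\to x_8$, $(x_1,x_2,x_3)\to-(x_1,x_2,x_3)$, $x_4\to x_6\to -x_4$, $x_5\to -x_7$, $x_7\to x_5$, and CP4 invariance makes $\Lambda$ block diagonal with respect to $(x_1,x_2,x_3)\oplus(x_4,x_5,x_6,x_7)\oplus(x_8)$. *)

theory Defs
  imports
    "HOL-Analysis.Analysis"
    "HOL-Algebra.Bij"
    "HOL-Algebra.Generated_Groups"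
begin

section \<open>Complex matrices\<close>

definition cnj_mat :: "complex ^ 'n ^ 'm \<Rightarrow> complex ^ 'n ^ 'm" where
  "cnj_mat A = (\<chi> i j. cnj (A $ i $ j))"

definition dagger :: "complex ^ 'n ^ 'm \<Rightarrow> complex ^ 'm ^ 'n" where
  "dagger A = transpose (cnj_mat A)"

definition unitary :: "complex ^ 'n ^ 'n \<Rightarrow> bool" where
  "unitary A \<longleftrightarrow> dagger A ** A = mat 1 \<and> A ** dagger A = mat 1"

definition cscale :: "complex \<Rightarrow> complex ^ 'n ^ 'm \<Rightarrow> complex ^ 'n ^ 'm" where
  "cscale c A = (\<chi> i j. c * A $ i $ j)"

section \<open>Gell-Mann matrices and structure constants\<close>

text \<open>The index type \<open>8\<close> is the integers modulo 8, so its numeral \<open>8\<close> denotes \<open>0\<close>;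
  \<open>1, ..., 8\<close> still name eight distinct indices. The same applies to \<open>3\<close> and \<open>2\<close>.\<close>

definition gell_mann :: "8 \<Rightarrow> complex ^ 3 ^ 3" where
  "gell_mann i =
    (if i = 1 then vector [vector [0, 1, 0], vector [1, 0, 0], vector [0, 0, 0]]
     else if i = 2 then vector [vector [0, -\<i>, 0], vector [\<i>, 0, 0], vector [0, 0, 0]]
     else if i = 3 then vector [vector [1, 0, 0], vector [0, -1, 0], vector [0, 0, 0]]
     else if i = 4 then vector [vector [0, 0, 1], vector [0, 0, 0], vector [1, 0, 0]]
     else if i = 5 then vector [vector [0, 0, -\<i>], vector [0, 0, 0], vector [\<i>, 0, 0]]
     else if i = 6 then vector [vector [0, 0, 0], vector [0, 0, 1], vector [0, 1, 0]]
     else if i = 7 then vector [vector [0, 0, 0], vector [0, 0, -\<i>], vector [0, \<i>, 0]]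
     else (1 / sqrt 3) *\<^sub>R vector [vector [1, 0, 0], vector [0, 1, 0], vector [0, 0, -2]])"

definition tgen :: "8 \<Rightarrow> complex ^ 3 ^ 3" where
  "tgen i = (1 / 2) *\<^sub>R gell_mann i"

definition is_structure_constants :: "(8 \<Rightarrow> 8 \<Rightarrow> 8 \<Rightarrow> real) \<Rightarrow> bool" where
  "is_structure_constants f \<longleftrightarrow>
    (\<forall>i j. tgen i ** tgen j - tgen j ** tgen i
         = (\<Sum>k\<in>UNIV. cscale (\<i> * complex_of_real (f i j k)) (tgen k)))"

text \<open>Well defined by the lemma \<open>f_su3_structure_constants\<close> below.\<close>

definition f_su3 :: "8 \<Rightarrow> 8 \<Rightarrow> 8 \<Rightarrow> real" where
  "f_su3 = (THE f. is_structure_constants f)"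

definition f_product :: "real ^ 8 \<Rightarrow> real ^ 8 \<Rightarrow> real ^ 8" where
  "f_product x y = (\<chi> i. \<Sum>j\<in>UNIV. \<Sum>k\<in>UNIV. f_su3 i j k * x $ j * y $ k)"

lemma exhaust_8: "(x::8) = 1 \<or> x = 2 \<or> x = 3 \<or> x = 4 \<or> x = 5 \<or> x = 6 \<or> x = 7 \<or> x = 8"
proof (induct x)
  case (of_int z)
  then have "0 \<le> z \<and> z < 8" by simp
  then have "z = 0 \<or> z = 1 \<or> z = 2 \<or> z = 3 \<or> z = 4 \<or> z = 5 \<or> z = 6 \<or> z = 7" by arith
  then show ?case by auto
qed

lemma UNIV_8: "UNIV = {1, 2, 3, 4, 5, 6, 7, 8 :: 8}"
  using exhaust_8 by blast

lemma forall_8: "(\<forall>i::8. P i) \<longleftrightarrow> P 1 \<and> P 2 \<and> P 3 \<and> P 4 \<and> P 5 \<and> P 6 \<and> P 7 \<and> P 8"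
  by (metis exhaust_8)

lemma sum_8: "sum f (UNIV::8 set) = f 1 + f 2 + f 3 + f 4 + f 5 + f 6 + f 7 + f 8"
  unfolding UNIV_8 by (simp add: ac_simps)

lemma gell_mann_simps:
  "gell_mann 1 = vector [vector [0, 1, 0], vector [1, 0, 0], vector [0, 0, 0]]"
  "gell_mann 2 = vector [vector [0, -\<i>, 0], vector [\<i>, 0, 0], vector [0, 0, 0]]"
  "gell_mann 3 = vector [vector [1, 0, 0], vector [0, -1, 0], vector [0, 0, 0]]"
  "gell_mann 4 = vector [vector [0, 0, 1], vector [0, 0, 0], vector [1, 0, 0]]"
  "gell_mann 5 = vector [vector [0, 0, -\<i>], vector [0, 0, 0], vector [\<i>, 0, 0]]"
  "gell_mann 6 = vector [vector [0, 0, 0], vector [0, 0, 1], vector [0, 1, 0]]"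
  "gell_mann 7 = vector [vector [0, 0, 0], vector [0, 0, -\<i>], vector [0, \<i>, 0]]"
  "gell_mann 8 = (1 / sqrt 3) *\<^sub>R vector [vector [1, 0, 0], vector [0, 1, 0], vector [0, 0, -2]]"
  by (simp_all add: gell_mann_def)

lemma tgen_hermitian: "dagger (tgen i) = tgen i"
  using exhaust_8[of i]
  by (elim disjE) (simp_all add: dagger_def cnj_mat_def transpose_def tgen_def gell_mann_simps
      vec_eq_iff forall_3)

lemma trace_tgen_mult: "trace (tgen i ** tgen j) = (if i = j then 1 / 2 else 0)"
proof -
  have s3: "complex_of_real (sqrt 3) * complex_of_real (sqrt 3) = 3"
    by (simp flip: of_real_mult)
  have "\<forall>i j. trace (tgen i ** tgen j) = (if i = j then 1 / 2 else 0)"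
    unfolding forall_8
    by (simp add: tgen_def gell_mann_simps trace_def matrix_matrix_mult_def sum_3 scaleR_conv_of_real[where 'a = complex]
        field_simps s3)
  then show ?thesis by blast
qed

lemma tgen_complete:
  assumes "trace A = 0"
  shows "A = (\<Sum>k\<in>UNIV. cscale (2 * trace (A ** tgen k)) (tgen k))"
proof -
  have s3: "complex_of_real (sqrt 3) * complex_of_real (sqrt 3) = 3"
    by (simp flip: of_real_mult)
  have A33: "A $ 3 $ 3 = - A $ 1 $ 1 - A $ 2 $ 2"
    using assms by (simp add: trace_def sum_3 add_eq_0_iff algebra_simps)
  show ?thesis
    by (simp add: vec_eq_iff forall_3 sum_8 cscale_def tgen_def gell_mann_simps trace_def
        matrix_matrix_mult_def sum_3 scaleR_conv_of_real[where 'a = complex] A33 field_simps s3)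
qed

lemma structure_constants_unique:
  assumes "is_structure_constants f"
  shows "f i j k = 2 * Im (trace ((tgen i ** tgen j - tgen j ** tgen i) ** tgen k))"
proof -
  have "trace ((\<Sum>l\<in>UNIV. cscale (\<i> * complex_of_real (f i j l)) (tgen l)) ** tgen k)
      = (\<Sum>l\<in>UNIV. \<i> * complex_of_real (f i j l) * trace (tgen l ** tgen k))"
    by (simp add: trace_def matrix_matrix_mult_def cscale_def sum_3 sum_8 algebra_simps)
  also have "\<dots> = \<i> * complex_of_real (f i j k) / 2"
    by (simp add: trace_tgen_mult if_distrib cong: if_cong)
  finally have *: "trace ((tgen i ** tgen j - tgen j ** tgen i) ** tgen k)
      = \<i> * complex_of_real (f i j k) / 2"
    using assms unfolding is_structure_constants_def by metis
  show ?thesis unfolding * by simp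
qed

lemma structure_constants_exist: "\<exists>f. is_structure_constants f"
proof -
  let ?C = "\<lambda>i j. tgen i ** tgen j - tgen j ** tgen i"
  let ?f = "\<lambda>i j k. 2 * Im (trace (?C i j ** tgen k))"
  have tr0: "trace (?C i j) = 0" for i j
    by (simp add: trace_sub trace_mul_sym[of "tgen i"])
  have cnj_tr: "cnj (trace M) = trace (dagger M)" for M :: "complex ^ 3 ^ 3"
    by (simp add: trace_def dagger_def cnj_mat_def transpose_def)
  have dm: "dagger (M ** N) = dagger N ** dagger M" for M N :: "complex ^ 3 ^ 3"
    by (simp add: dagger_def cnj_mat_def transpose_def matrix_matrix_mult_def mult.commute)
  have dd: "dagger (M - N) = dagger M - dagger N" for M N :: "complex ^ 3 ^ 3"
    by (simp add: dagger_def cnj_mat_def transpose_def vec_eq_iff)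
  have im: "trace (?C i j ** tgen k) = \<i> * complex_of_real (Im (trace (?C i j ** tgen k)))"
    for i j k
  proof -
    have "cnj (trace (?C i j ** tgen k)) = trace (tgen k ** (tgen j ** tgen i - tgen i ** tgen j))"
      by (simp add: cnj_tr dm dd tgen_hermitian)
    also have "\<dots> = trace ((tgen j ** tgen i - tgen i ** tgen j) ** tgen k)"
      by (rule trace_mul_sym)
    also have "\<dots> = - trace (?C i j ** tgen k)"
      by (simp add: trace_def matrix_matrix_mult_def sum_3 algebra_simps)
    finally have "Re (trace (?C i j ** tgen k)) = 0"
      by (metis cnj.simps(1) equal_neg_zero uminus_complex.simps(1))
    then show ?thesis unfolding complex_eq_iff by simp
  qed
  have "?C i j = (\<Sum>k\<in>UNIV. cscale (\<i> * complex_of_real (?f i j k)) (tgen k))" for i j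
  proof -
    have "\<i> * complex_of_real (?f i j k) = 2 * trace (?C i j ** tgen k)" for k
      by (subst im) simp
    then show ?thesis by (simp only: tgen_complete[OF tr0, symmetric])
  qed
  then have "is_structure_constants ?f" unfolding is_structure_constants_def by blast
  then show ?thesis by (rule exI[of is_structure_constants])
qed

lemma f_su3_structure_constants: "is_structure_constants f_su3"
proof -
  obtain f where f: "is_structure_constants f"
    using structure_constants_exist by blast
  have "g = f" if g: "is_structure_constants g" for g
    by (intro ext, subst structure_constants_unique[OF g],
        subst structure_constants_unique[OF f], rule refl)
  with f show ?thesis
    unfolding f_su3_def by (rule theI)
qed

section \<open>Potentials and bilinears\<close>

text \<open>Three doublets form one \<open>3 \<times> 2\<close> matrix: \<open>\<phi> $ a\<close> is the doublet \<open>\<phi>\<^sub>a\<close>. Hence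
  \<open>S ** \<phi>\<close> is \<open>\<phi>\<^sub>a \<mapsto> S\<^sub>a\<^sub>b \<phi>\<^sub>b\<close>.\<close>

type_synonym doublets = "complex ^ 2 ^ 3"

definition doublet_prod :: "doublets \<Rightarrow> 3 \<Rightarrow> 3 \<Rightarrow> complex" where
  "doublet_prod \<phi> a b = (\<Sum>s\<in>UNIV. cnj (\<phi> $ a $ s) * \<phi> $ b $ s)"

definition is_potential :: "(doublets \<Rightarrow> real) \<Rightarrow> bool" where
  "is_potential V \<longleftrightarrow>
    (\<exists>(Y :: 3 \<Rightarrow> 3 \<Rightarrow> complex) (Z :: 3 \<Rightarrow> 3 \<Rightarrow> 3 \<Rightarrow> 3 \<Rightarrow> complex). \<forall>\<phi>.
      complex_of_real (V \<phi>) =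
        (\<Sum>a\<in>UNIV. \<Sum>b\<in>UNIV. Y a b * doublet_prod \<phi> a b)
        + (\<Sum>a\<in>UNIV. \<Sum>b\<in>UNIV. \<Sum>c\<in>UNIV. \<Sum>d\<in>UNIV. Z a b c d * doublet_prod \<phi> a b * doublet_prod \<phi> c d))"

text \<open>The bilinears are real, so taking real parts loses nothing (\<open>bilin0_complex\<close>,
  \<open>bilin_complex\<close>).\<close>

definition bilin0 :: "doublets \<Rightarrow> real" where
  "bilin0 \<phi> = 1 / sqrt 3 * Re (\<Sum>a\<in>UNIV. doublet_prod \<phi> a a)"

definition bilin :: "doublets \<Rightarrow> real ^ 8" where
  "bilin \<phi> = (\<chi> i. Re (\<Sum>a\<in>UNIV. \<Sum>b\<in>UNIV. tgen i $ a $ b * doublet_prod \<phi> a b))"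

lemma doublet_prod_cnj: "cnj (doublet_prod \<phi> a b) = doublet_prod \<phi> b a"
  by (simp add: doublet_prod_def mult.commute)

lemma bilin0_complex:
  "complex_of_real (bilin0 \<phi>) = complex_of_real (1 / sqrt 3) * (\<Sum>a\<in>UNIV. doublet_prod \<phi> a a)"
proof -
  have "cnj (\<Sum>a\<in>UNIV. doublet_prod \<phi> a a) = (\<Sum>a\<in>UNIV. doublet_prod \<phi> a a)"
    by (simp add: doublet_prod_cnj)
  then have "(\<Sum>a\<in>UNIV. doublet_prod \<phi> a a) \<in> \<real>"
    by (simp only: Reals_cnj_iff)
  then show ?thesis
    unfolding bilin0_def of_real_mult by (simp only: of_real_Re)
qed

lemma bilin_complex:
  "complex_of_real (bilin \<phi> $ i) = (\<Sum>a\<in>UNIV. \<Sum>b\<in>UNIV. tgen i $ a $ b * doublet_prod \<phi> a b)"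
proof -
  have h: "cnj (tgen i $ a $ b) = tgen i $ b $ a" for a b
    using tgen_hermitian[of i] by (simp add: dagger_def cnj_mat_def transpose_def vec_eq_iff)
  have "cnj (\<Sum>a\<in>UNIV. \<Sum>b\<in>UNIV. tgen i $ a $ b * doublet_prod \<phi> a b)
      = (\<Sum>a\<in>UNIV. \<Sum>b\<in>UNIV. tgen i $ b $ a * doublet_prod \<phi> b a)"
    by (simp add: doublet_prod_cnj h)
  also have "\<dots> = (\<Sum>a\<in>UNIV. \<Sum>b\<in>UNIV. tgen i $ a $ b * doublet_prod \<phi> a b)"
    by (rule sum.swap)
  finally have "(\<Sum>a\<in>UNIV. \<Sum>b\<in>UNIV. tgen i $ a $ b * doublet_prod \<phi> a b) \<in> \<real>"
    by (simp only: Reals_cnj_iff)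
  then show ?thesis unfolding bilin_def vec_lambda_beta by (simp only: of_real_Re)
qed

definition is_bilinear_form ::
  "(doublets \<Rightarrow> real) \<Rightarrow> real \<Rightarrow> real ^ 8 \<Rightarrow> real \<Rightarrow> real ^ 8 \<Rightarrow> real ^ 8 ^ 8 \<Rightarrow> bool" where
  "is_bilinear_form V M0 M Lam0 L Lam \<longleftrightarrow>
    transpose Lam = Lam \<and>
    (\<forall>\<phi>. V \<phi> = M0 * bilin0 \<phi> + (\<Sum>i\<in>UNIV. M $ i * bilin \<phi> $ i)
      + Lam0 * (bilin0 \<phi>)\<^sup>2 + (\<Sum>i\<in>UNIV. L $ i * bilin0 \<phi> * bilin \<phi> $ i)
      + (\<Sum>i\<in>UNIV. \<Sum>j\<in>UNIV. Lam $ i $ j * bilin \<phi> $ i * bilin \<phi> $ j))"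

section \<open>Symmetries\<close>

definition family_map :: "complex ^ 3 ^ 3 \<Rightarrow> doublets \<Rightarrow> doublets" where
  "family_map S \<phi> = S ** \<phi>"

definition cp_map :: "complex ^ 3 ^ 3 \<Rightarrow> doublets \<Rightarrow> doublets" where
  "cp_map X \<phi> = X ** cnj_mat \<phi>"

definition family_symmetry :: "(doublets \<Rightarrow> real) \<Rightarrow> complex ^ 3 ^ 3 \<Rightarrow> bool" where
  "family_symmetry V S \<longleftrightarrow> unitary S \<and> (\<forall>\<phi>. V (family_map S \<phi>) = V \<phi>)"

definition cp_symmetry :: "(doublets \<Rightarrow> real) \<Rightarrow> complex ^ 3 ^ 3 \<Rightarrow> bool" where
  "cp_symmetry V X \<longleftrightarrow> unitary X \<and> (\<forall>\<phi>. V (cp_map X \<phi>) = V \<phi>)"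

definition cp2_symmetry :: "(doublets \<Rightarrow> real) \<Rightarrow> complex ^ 3 ^ 3 \<Rightarrow> bool" where
  "cp2_symmetry V X \<longleftrightarrow> cp_symmetry V X \<and> X ** cnj_mat X = mat 1"

definition cp4_symmetry :: "(doublets \<Rightarrow> real) \<Rightarrow> complex ^ 3 ^ 3 \<Rightarrow> bool" where
  "cp4_symmetry V X \<longleftrightarrow> cp_symmetry V X \<and> X ** cnj_mat X \<noteq> mat 1
     \<and> (X ** cnj_mat X) ** (X ** cnj_mat X) = mat 1"

text \<open>The group generated by the transformation \<open>\<phi> \<mapsto> X \<phi>\<^sup>*\<close> inside the group of all
  bijections of the space of doublet triples.\<close>

definition cp_group :: "complex ^ 3 ^ 3 \<Rightarrow> (doublets \<Rightarrow> doublets) set" where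
  "cp_group X = generate (BijGroup UNIV) {cp_map X}"

definition in_up_to_phase :: "(doublets \<Rightarrow> doublets) \<Rightarrow> (doublets \<Rightarrow> doublets) set \<Rightarrow> bool" where
  "in_up_to_phase h G \<longleftrightarrow> (\<exists>g\<in>G. \<exists>c. cmod c = 1 \<and> (\<forall>\<phi>. h \<phi> = cscale c (g \<phi>)))"

definition pure_cp4_model :: "(doublets \<Rightarrow> real) \<Rightarrow> complex ^ 3 ^ 3 \<Rightarrow> bool" where
  "pure_cp4_model V X \<longleftrightarrow>
    (\<forall>S. family_symmetry V S \<longrightarrow> in_up_to_phase (family_map S) (cp_group X)) \<and>
    (\<forall>X'. cp_symmetry V X' \<longrightarrow> in_up_to_phase (cp_map X') (cp_group X))"

section \<open>The subspace \<open>W\<^sub>4\<close> and its eigenspaces\<close>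

definition X_cp4 :: "complex ^ 3 ^ 3" where
  "X_cp4 = vector [vector [0, 1, 0], vector [-1, 0, 0], vector [0, 0, 1]]"

text \<open>A basis change \<open>\<phi> \<mapsto> B \<phi>\<close> carries the adjoint vector \<open>x\<close> to the vector \<open>y\<close> with
  \<open>y\<^sub>i t\<^sub>i = B (x\<^sub>j t\<^sub>j) B\<^sup>\<dagger>\<close>. It brings a CP matrix \<open>X\<close> to \<open>B X B\<^sup>T\<close>.\<close>

definition adjoint_matrix_of :: "real ^ 8 \<Rightarrow> complex ^ 3 ^ 3" where
  "adjoint_matrix_of x = (\<Sum>i\<in>UNIV. x $ i *\<^sub>R tgen i)"

definition canonical_cp4_basis :: "complex ^ 3 ^ 3 \<Rightarrow> complex ^ 3 ^ 3 \<Rightarrow> bool" where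
  "canonical_cp4_basis X B \<longleftrightarrow> unitary B \<and> B ** X ** transpose B = X_cp4"

text \<open>The vectors, in original coordinates, whose coordinates after the basis change \<open>B\<close> lie in
  the \<open>(x\<^sub>4, x\<^sub>5, x\<^sub>6, x\<^sub>7)\<close> subspace.\<close>

definition W4 :: "complex ^ 3 ^ 3 \<Rightarrow> (real ^ 8) set" where
  "W4 B = {x. \<exists>y. adjoint_matrix_of y = B ** adjoint_matrix_of x ** dagger B \<and>
                  (\<forall>i. i \<notin> {4, 5, 6, 7} \<longrightarrow> y $ i = 0)}"

definition eigenspace_in :: "(real ^ 8) set \<Rightarrow> real ^ 8 ^ 8 \<Rightarrow> real \<Rightarrow> (real ^ 8) set" where
  "eigenspace_in W A \<mu> = {x \<in> W. A *v x = \<mu> *\<^sub>R x}"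

definition is_eigenvector :: "real ^ 8 ^ 8 \<Rightarrow> real ^ 8 \<Rightarrow> bool" where
  "is_eigenvector A x \<longleftrightarrow> x \<noteq> 0 \<and> (\<exists>\<mu>. A *v x = \<mu> *\<^sub>R x)"

definition orthonormal_basis2 :: "(real ^ 8) set \<Rightarrow> real ^ 8 \<Rightarrow> real ^ 8 \<Rightarrow> bool" where
  "orthonormal_basis2 E x y \<longleftrightarrow> norm x = 1 \<and> norm y = 1 \<and> inner x y = 0 \<and> span {x, y} = E"

definition is_quadruple ::
  "(real ^ 8) set \<Rightarrow> (real ^ 8) set \<Rightarrow> real ^ 8 \<Rightarrow> real ^ 8 \<Rightarrow> real ^ 8 \<Rightarrow> real ^ 8 \<Rightarrow> bool" where
  "is_quadruple E1 E2 q q' p p' \<longleftrightarrow> orthonormal_basis2 E1 q q' \<and> orthonormal_basis2 E2 p p'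
     \<and> f_product q q' = f_product p p'"

definition u_vectors :: "(real ^ 8) set \<Rightarrow> (real ^ 8) set \<Rightarrow> (real ^ 8) set" where
  "u_vectors E1 E2 = {f_product q q' | q q' p p'. is_quadruple E1 E2 q q' p p'}"

definition U_vectors :: "(real ^ 8) set \<Rightarrow> (real ^ 8) set \<Rightarrow> (real ^ 8) set" where
  "U_vectors E1 E2 = {f_product q p - f_product q' p' | q q' p p'.
     is_quadruple E1 E2 q q' p p'}"

end

(*
  The basis changes that fix the canonical CP4 matrix contain SU(2) acting on the first two
  doublets, which is transitive on the unit sphere of W_4. So one can choose the canonical basis such that E_1 is the (x_4, x_6)-plane; CP4 invariance and orthogonality
  make E_2 the (x_5, x_7)-plane. Then u is +-(1/2) x_2 and U is the unit circle of the
  (x_1, x_3)-plane, and the hypothesis speaks about the eigenvectors of the 3 x 3 block A only.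

  If x_2 is an eigenvector of A, complex conjugation is a CP2 symmetry. If a unit vector n of the
  (x_1, x_3)-plane is one, a real reflection composed with complex conjugation acts on the first three
  coordinates as the reflection in the plane orthogonal to n and is a CP2 symmetry.

  Otherwise, a family symmetry S commutes with the matrices sum_j t_j (Lam^n t_j). These are of the
  form diag(a, a, b), and a = b exactly if tr A^n = mu_1^n + mu_2^n + l^n, where l is the eigenvalue of
  x_8. So S is block diagonal unless this holds for n = 1, 2, 3; then the spectrum of A is
  {mu_1, mu_2, l}, and the eigenspaces of l and mu_1 still force S to fix x_8. A block diagonal S that
  preserves E_1 is, up to a phase, a real orthogonal 2 x 2 block; a nontrivial rotation would make x_2
  an eigenvector of A, and a reflection would give an eigenvector in the (x_1, x_3)-plane. The
  composition of a CP symmetry with CP4 is a family symmetry, which settles the CP symmetries too.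
*)

theory Submission
  imports Defs
begin

section \<open>The adjoint action\<close>

text \<open>A symmetry of \<open>V\<close> becomes commutation with \<open>Lam\<close> because the
  bilinears, although they fill only part of the space, determine all coefficients: configurations
  with a single nonzero column give the matrices v v^dagger, and these span the Hermitian matrices.
  \<open>M\<close> and \<open>L\<close> never obstruct a CP2, since CP4 invariance leaves them only
  an x_8 component and the CP2 candidates fix x_8. The matrices sum_j t_j (Lam^n t_j) commute with
  family symmetries because they are contractions over an orthonormal basis, which may be rotated at
  will. The obstacle is that all three of them can be scalar. Newton's identities then turn the
  trace equalities into the spectrum of \<open>A\<close>, and the absence of eigenvectors in the
  (x_1, x_3)-plane makes this spectrum simple, because a two-dimensional eigenspace would meet that
  plane. Thus \<open>l\<close> differs from both other eigenvalues, and eigenspaces can take over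
  the task of the Casimir matrices. The conditions on \<open>u\<close> and \<open>U\<close> enter
  through \<open>generic_block\<close>, which is a statement about \<open>A\<close> alone.\<close>

lemma dagger_mult: "dagger (A ** B) = dagger B ** dagger A"
  by (simp add: dagger_def cnj_mat_def transpose_def matrix_matrix_mult_def mult.commute)

lemma dagger_dagger [simp]: "dagger (dagger A) = A"
  by (simp add: dagger_def cnj_mat_def transpose_def vec_eq_iff)

lemma dagger_mat_1 [simp]: "dagger (mat 1) = mat 1"
  by (simp add: dagger_def cnj_mat_def transpose_def mat_def vec_eq_iff)

lemma cnj_mat_mult: "cnj_mat (A ** B) = cnj_mat A ** cnj_mat B"
  by (simp add: cnj_mat_def matrix_matrix_mult_def vec_eq_iff)

lemma cnj_mat_cnj_mat [simp]: "cnj_mat (cnj_mat A) = A"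
  by (simp add: cnj_mat_def vec_eq_iff)

lemma cnj_mat_mat_1 [simp]: "cnj_mat (mat 1) = mat 1"
  by (simp add: cnj_mat_def mat_def vec_eq_iff)

lemma dagger_cnj_mat: "dagger (cnj_mat A) = cnj_mat (dagger A)"
  by (simp add: dagger_def cnj_mat_def transpose_def vec_eq_iff)

lemma transpose_conv: "transpose A = cnj_mat (dagger A)" for A :: "complex ^ 'n ^ 'm"
  by (simp add: dagger_def cnj_mat_def transpose_def vec_eq_iff)

lemma unitary_dagger: "unitary A \<Longrightarrow> unitary (dagger A)"
  by (simp add: unitary_def)

lemma unitary_mult: "unitary A \<Longrightarrow> unitary B \<Longrightarrow> unitary (A ** B)"
  unfolding unitary_def dagger_mult
  by (metis matrix_mul_assoc matrix_mul_lid)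

lemma unitary_cnj_mat: "unitary A \<Longrightarrow> unitary (cnj_mat A)"
  unfolding unitary_def dagger_cnj_mat cnj_mat_mult[symmetric] by simp

lemma adjoint_matrix_of_explicit:
  "adjoint_matrix_of x = vector
    [vector [(complex_of_real (x $ 3) + complex_of_real (x $ 8 / sqrt 3)) / 2, (complex_of_real (x $ 1) - \<i> * complex_of_real (x $ 2)) / 2,
             (complex_of_real (x $ 4) - \<i> * complex_of_real (x $ 5)) / 2],
     vector [(complex_of_real (x $ 1) + \<i> * complex_of_real (x $ 2)) / 2, (- complex_of_real (x $ 3) + complex_of_real (x $ 8 / sqrt 3)) / 2,
             (complex_of_real (x $ 6) - \<i> * complex_of_real (x $ 7)) / 2],
     vector [(complex_of_real (x $ 4) + \<i> * complex_of_real (x $ 5)) / 2, (complex_of_real (x $ 6) + \<i> * complex_of_real (x $ 7)) / 2,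
             - complex_of_real (x $ 8 / sqrt 3)]]"
  unfolding adjoint_matrix_of_def vec_eq_iff forall_3 sum_8
  by (simp add: tgen_def gell_mann_simps scaleR_conv_of_real[where 'a = complex] field_simps)

text \<open>Inverse of \<open>adjoint_matrix_of\<close> on traceless Hermitian matrices, because tr
  (t_i t_k) is 1/2 for i = k and 0 otherwise. On other Hermitian matrices it drops the multiple of
  the identity.\<close>

definition coords :: "complex ^ 3 ^ 3 \<Rightarrow> real ^ 8" where
  "coords H = (\<chi> k. 2 * Re (trace (H ** tgen k)))"

lemma trace_tgen_adjoint:
  "trace (adjoint_matrix_of x ** tgen k) = complex_of_real (x $ k) / 2"
proof -
  have "trace (adjoint_matrix_of x ** tgen k) = (\<Sum>i\<in>UNIV. complex_of_real (x $ i) * trace (tgen i ** tgen k))"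
    unfolding adjoint_matrix_of_def
    by (simp add: trace_def matrix_matrix_mult_def sum_3 sum_8 scaleR_conv_of_real[where 'a = complex] algebra_simps)
  then show ?thesis
    by (simp add: trace_tgen_mult if_distrib cong: if_cong)
qed

lemma coords_adjoint_matrix_of [simp]: "coords (adjoint_matrix_of x) = x"
  by (simp add: coords_def trace_tgen_adjoint vec_eq_iff)

lemma adjoint_matrix_of_inject: "adjoint_matrix_of x = adjoint_matrix_of y \<longleftrightarrow> x = y"
  by (metis coords_adjoint_matrix_of)

lemma trace_adjoint_matrix_of: "trace (adjoint_matrix_of x) = 0"
  by (simp add: adjoint_matrix_of_explicit trace_def sum_3 field_simps)

lemma dagger_adjoint_matrix_of: "dagger (adjoint_matrix_of x) = adjoint_matrix_of x"
  unfolding vec_eq_iff forall_3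
  by (simp add: adjoint_matrix_of_explicit dagger_def cnj_mat_def transpose_def)

lemma adjoint_matrix_of_add: "adjoint_matrix_of (x + y) = adjoint_matrix_of x + adjoint_matrix_of y"
  by (simp add: adjoint_matrix_of_def scaleR_left_distrib sum.distrib)

lemma adjoint_matrix_of_scaleR: "adjoint_matrix_of (c *\<^sub>R x) = c *\<^sub>R adjoint_matrix_of x"
  by (simp add: adjoint_matrix_of_def scaleR_sum_right)

lemma linear_coords: "linear coords"
  by (rule linearI)
    (simp_all add: coords_def vec_eq_iff trace_def matrix_matrix_mult_def sum_3 algebra_simps
      scaleR_conv_of_real[where 'a = complex])

lemma coords_cscale_mat_1: "coords (cscale c (mat 1)) = 0"
proof -
  have "trace (cscale c (mat 1) ** tgen k) = c * trace (tgen k)" for k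
    by (simp add: trace_def matrix_matrix_mult_def cscale_def mat_def sum_3 algebra_simps)
  moreover have "trace (tgen k) = 0" for k
    using exhaust_8[of k]
    by (elim disjE) (simp_all add: trace_def tgen_def gell_mann_simps sum_3)
  ultimately show ?thesis by (simp add: coords_def vec_eq_iff)
qed

lemma trace_hermitian_mult_real:
  assumes "dagger H = H"
  shows "trace (H ** tgen k) = complex_of_real (Re (trace (H ** tgen k)))"
proof -
  have cnj_tr: "cnj (trace M) = trace (dagger M)" for M :: "complex ^ 3 ^ 3"
    by (simp add: trace_def dagger_def cnj_mat_def transpose_def)
  have "cnj (trace (H ** tgen k)) = trace (H ** tgen k)"
    by (simp add: cnj_tr dagger_mult assms tgen_hermitian trace_mul_sym[of "tgen k"])
  then show ?thesis by (simp add: complex_eq_iff)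
qed

lemma adjoint_matrix_of_coords_traceless:
  assumes "dagger H = H" "trace H = 0"
  shows "adjoint_matrix_of (coords H) = H"
proof -
  have "adjoint_matrix_of (coords H) = (\<Sum>k\<in>UNIV. cscale (2 * trace (H ** tgen k)) (tgen k))"
    unfolding adjoint_matrix_of_def coords_def
    by (subst trace_hermitian_mult_real[OF assms(1)])
       (simp add: cscale_def vec_eq_iff scaleR_conv_of_real[where 'a = complex])
  then show ?thesis using tgen_complete[OF assms(2)] by simp
qed

lemma adjoint_matrix_of_coords:
  assumes "dagger H = H"
  shows "adjoint_matrix_of (coords H) = H - cscale (trace H / 3) (mat 1)"
proof -
  let ?H = "H - cscale (trace H / 3) (mat 1)"
  have h: "cnj (H $ j $ i) = H $ i $ j" for i j
    using assms by (simp add: dagger_def cnj_mat_def transpose_def vec_eq_iff)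
  have "coords H = coords ?H"
    by (simp add: linear_diff[OF linear_coords] coords_cscale_mat_1)
  moreover have "dagger ?H = ?H"
    using h
    by (simp add: dagger_def cnj_mat_def transpose_def vec_eq_iff cscale_def mat_def trace_def sum_3)
  moreover have "trace ?H = 0"
    by (simp add: trace_def cscale_def mat_def sum_3 field_simps)
  ultimately show ?thesis using adjoint_matrix_of_coords_traceless by metis
qed

definition Ad :: "complex ^ 3 ^ 3 \<Rightarrow> real ^ 8 \<Rightarrow> real ^ 8" where
  "Ad S x = coords (S ** adjoint_matrix_of x ** dagger S)"

text \<open>Effect of complex conjugation of the doublets on adjoint vectors, so that the CP map of
  \<open>X\<close> acts by \<open>Ad X\<close> after \<open>conj_adj\<close>.\<close>

definition conj_adj :: "real ^ 8 \<Rightarrow> real ^ 8" where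
  "conj_adj x = coords (cnj_mat (adjoint_matrix_of x))"

lemma adjoint_matrix_of_Ad:
  assumes "unitary S"
  shows "adjoint_matrix_of (Ad S x) = S ** adjoint_matrix_of x ** dagger S"
  unfolding Ad_def
proof (rule adjoint_matrix_of_coords_traceless)
  show "dagger (S ** adjoint_matrix_of x ** dagger S) = S ** adjoint_matrix_of x ** dagger S"
    by (simp add: dagger_mult dagger_adjoint_matrix_of matrix_mul_assoc)
  have "trace (S ** adjoint_matrix_of x ** dagger S) = trace (dagger S ** S ** adjoint_matrix_of x)"
    by (metis trace_mul_sym matrix_mul_assoc)
  then show "trace (S ** adjoint_matrix_of x ** dagger S) = 0"
    using assms by (simp add: unitary_def trace_adjoint_matrix_of)
qed

lemma adjoint_matrix_of_conj_adj:
  "adjoint_matrix_of (conj_adj x) = cnj_mat (adjoint_matrix_of x)"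
  unfolding conj_adj_def
proof (rule adjoint_matrix_of_coords_traceless)
  show "dagger (cnj_mat (adjoint_matrix_of x)) = cnj_mat (adjoint_matrix_of x)"
    by (simp add: dagger_cnj_mat dagger_adjoint_matrix_of)
  have "trace (cnj_mat (adjoint_matrix_of x)) = cnj (trace (adjoint_matrix_of x))"
    by (simp add: trace_def cnj_mat_def)
  then show "trace (cnj_mat (adjoint_matrix_of x)) = 0"
    by (simp add: trace_adjoint_matrix_of)
qed

lemma Ad_mult:
  assumes "unitary S" "unitary T"
  shows "Ad (S ** T) x = Ad S (Ad T x)"
  unfolding adjoint_matrix_of_inject[symmetric]
  using assms by (simp add: adjoint_matrix_of_Ad unitary_mult dagger_mult matrix_mul_assoc)

lemma Ad_mat_1 [simp]: "Ad (mat 1) x = x"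
  by (simp add: Ad_def)

lemma Ad_dagger_Ad: "unitary S \<Longrightarrow> Ad (dagger S) (Ad S x) = x"
  using Ad_mult[of "dagger S" S x] by (simp add: unitary_dagger unitary_def)

lemma Ad_Ad_dagger: "unitary S \<Longrightarrow> Ad S (Ad (dagger S) x) = x"
  using Ad_mult[of S "dagger S" x] by (simp add: unitary_dagger unitary_def)

lemma conj_adj_conj_adj [simp]: "conj_adj (conj_adj x) = x"
  unfolding adjoint_matrix_of_inject[symmetric] by (simp add: adjoint_matrix_of_conj_adj)

lemma conj_adj_Ad: "unitary S \<Longrightarrow> conj_adj (Ad S x) = Ad (cnj_mat S) (conj_adj x)"
  unfolding adjoint_matrix_of_inject[symmetric]
  by (simp add: adjoint_matrix_of_conj_adj adjoint_matrix_of_Ad unitary_cnj_mat cnj_mat_mult dagger_cnj_mat)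

lemma linear_adjoint_matrix_of: "linear adjoint_matrix_of"
  by (simp add: linearI adjoint_matrix_of_add adjoint_matrix_of_scaleR)

lemma matrix_add_rdistrib: "(A + B) ** C = A ** C + B ** C" for A B :: "'a :: semiring_1 ^ 'n ^ 'm"
  by (simp add: matrix_matrix_mult_def vec_eq_iff sum.distrib distrib_right)

lemma matrix_scaleR_mult:
  fixes A :: "complex ^ 'n ^ 'm"
  shows "A ** (c *\<^sub>R B) = c *\<^sub>R (A ** B)" "(c *\<^sub>R A) ** B = c *\<^sub>R (A ** B)"
  by (simp_all add: matrix_matrix_mult_def vec_eq_iff scaleR_sum_right)

lemma linear_matrix_mult_left: "linear (\<lambda>A. A ** B)" for B :: "complex ^ 'n ^ 'm"
  by (rule linearI) (simp_all add: matrix_add_rdistrib matrix_scaleR_mult)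

lemma linear_matrix_mult_right: "linear (\<lambda>B. A ** B)" for A :: "complex ^ 'n ^ 'm"
  by (rule linearI) (simp_all add: matrix_add_ldistrib matrix_scaleR_mult)

lemma linear_Ad: "linear (Ad S)"
  unfolding Ad_def
  by (rule linearI)
    (simp_all add: adjoint_matrix_of_add adjoint_matrix_of_scaleR matrix_add_ldistrib
      matrix_add_rdistrib matrix_scaleR_mult linear_add[OF linear_coords] linear_scale[OF linear_coords])

lemma linear_conj_adj: "linear conj_adj"
proof (rule linearI)
  have 1: "cnj_mat (A + B) = cnj_mat A + cnj_mat B" for A B :: "complex ^ 3 ^ 3"
    by (simp add: cnj_mat_def vec_eq_iff)
  have 2: "cnj_mat (c *\<^sub>R A) = c *\<^sub>R cnj_mat A" for c and A :: "complex ^ 3 ^ 3"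
    by (simp add: cnj_mat_def vec_eq_iff)
  show "conj_adj (x + y) = conj_adj x + conj_adj y" for x y
    by (simp add: conj_adj_def adjoint_matrix_of_add 1 linear_add[OF linear_coords])
  show "conj_adj (c *\<^sub>R x) = c *\<^sub>R conj_adj x" for c x
    by (simp add: conj_adj_def adjoint_matrix_of_scaleR 2 linear_scale[OF linear_coords])
qed

lemma trace_adjoint_mult:
  "trace (adjoint_matrix_of x ** adjoint_matrix_of y) = complex_of_real (x \<bullet> y) / 2"
proof -
  have "trace (adjoint_matrix_of x ** adjoint_matrix_of y)
    = (\<Sum>k\<in>UNIV. complex_of_real (y $ k) * trace (adjoint_matrix_of x ** tgen k))"
    unfolding adjoint_matrix_of_def[of y]
    by (simp add: trace_def matrix_matrix_mult_def sum_3 sum_8 scaleR_conv_of_real[where 'a = complex] algebra_simps)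
  then show ?thesis
    by (simp add: trace_tgen_adjoint inner_vec_def sum_divide_distrib mult.commute)
qed

text \<open>Unitary conjugation preserves the trace form, which is half the inner product.\<close>

lemma Ad_inner:
  assumes "unitary S"
  shows "Ad S x \<bullet> Ad S y = x \<bullet> y"
proof -
  let ?x = "adjoint_matrix_of x" and ?y = "adjoint_matrix_of y"
  have "trace (S ** ?x ** dagger S ** (S ** ?y ** dagger S)) = trace (S ** (?x ** ?y ** dagger S))"
    using assms unfolding unitary_def by (metis matrix_mul_assoc matrix_mul_lid)
  also have "\<dots> = trace (?x ** ?y ** dagger S ** S)"
    by (rule trace_mul_sym)
  also have "\<dots> = trace (?x ** ?y)"
    using assms unfolding unitary_def by (metis matrix_mul_assoc matrix_mul_rid)
  finally show ?thesis
    using assms by (simp add: adjoint_matrix_of_Ad[symmetric] trace_adjoint_mult)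
qed

lemma conj_adj_inner: "conj_adj x \<bullet> conj_adj y = x \<bullet> y"
proof -
  have "trace (cnj_mat (adjoint_matrix_of x) ** cnj_mat (adjoint_matrix_of y))
      = cnj (trace (adjoint_matrix_of x ** adjoint_matrix_of y))"
    unfolding cnj_mat_mult[symmetric] by (simp add: trace_def cnj_mat_def)
  then show ?thesis
    by (simp add: adjoint_matrix_of_conj_adj[symmetric] trace_adjoint_mult)
qed

lemma Ad_inner_left: "unitary S \<Longrightarrow> Ad S x \<bullet> y = x \<bullet> Ad (dagger S) y"
  by (metis Ad_inner Ad_Ad_dagger)

section \<open>The f-product\<close>

text \<open>Cyclicity of the trace. It is needed because \<open>f_product\<close> leaves the first
  index free, while the trace formula for the structure constants singles out the last one.\<close>

lemma f_su3_cyclic: "f_su3 i j k = f_su3 j k i"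
proof -
  have "trace ((A ** B - B ** A) ** C) = trace ((B ** C - C ** B) ** A)" for A B C :: "complex ^ 3 ^ 3"
    by (simp add: trace_def matrix_matrix_mult_def sum_3 algebra_simps)
  then show ?thesis
    unfolding structure_constants_unique[OF f_su3_structure_constants] by metis
qed

text \<open>Basis-free form of the product, from which its equivariance under unitary conjugation
  follows at once. The factor -i makes the antihermitian commutator Hermitian.\<close>

lemma adjoint_matrix_of_f_product:
  "adjoint_matrix_of (f_product x y)
    = cscale (- \<i>) (adjoint_matrix_of x ** adjoint_matrix_of y - adjoint_matrix_of y ** adjoint_matrix_of x)"
  (is "_ = cscale _ ?C")
proof -
  have "f_product x y = coords (cscale (- \<i>) ?C)"
  proof -
    have "f_product x y $ i = coords (cscale (- \<i>) ?C) $ i" for i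
    proof -
      have "trace (?C ** tgen i) = (\<Sum>j\<in>UNIV. \<Sum>k\<in>UNIV. complex_of_real (x $ j * y $ k) *
          trace ((tgen j ** tgen k - tgen k ** tgen j) ** tgen i))"
      proof -
        have bil: "adjoint_matrix_of x ** adjoint_matrix_of y
            = (\<Sum>j\<in>UNIV. \<Sum>k\<in>UNIV. (x $ j * y $ k) *\<^sub>R (tgen j ** tgen k))" for x y
          unfolding adjoint_matrix_of_def
          by (simp add: linear_sum[OF linear_matrix_mult_left] linear_sum[OF linear_matrix_mult_right]
              matrix_scaleR_mult scaleR_sum_right) (subst sum.swap, simp add: mult.commute)
        have bil2: "adjoint_matrix_of y ** adjoint_matrix_of x
            = (\<Sum>j\<in>UNIV. \<Sum>k\<in>UNIV. (x $ j * y $ k) *\<^sub>R (tgen k ** tgen j))"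
          unfolding bil by (subst sum.swap) (simp add: mult.commute)
        have lin: "linear (\<lambda>C. trace (C ** tgen i))"
          by (rule linearI) (simp_all add: matrix_add_rdistrib trace_add matrix_scaleR_mult trace_def
              scaleR_sum_right sum.distrib)
        have "?C = (\<Sum>j\<in>UNIV. \<Sum>k\<in>UNIV. (x $ j * y $ k) *\<^sub>R (tgen j ** tgen k - tgen k ** tgen j))"
          unfolding bil[of x y] bil2 by (simp add: sum_subtractf scaleR_right_diff_distrib)
        then show ?thesis
          by (simp add: linear_sum[OF lin] linear_scale[OF lin] scaleR_conv_of_real[where 'a = complex])
      qed
      moreover have "trace (cscale (- \<i>) ?C ** tgen i) = - \<i> * trace (?C ** tgen i)"
        by (simp add: trace_def matrix_matrix_mult_def cscale_def sum_3 algebra_simps)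
      moreover have "f_su3 i j k = 2 * Im (trace ((tgen j ** tgen k - tgen k ** tgen j) ** tgen i))" for j k
        unfolding f_su3_cyclic[of i] by (rule structure_constants_unique[OF f_su3_structure_constants])
      ultimately show ?thesis
        by (simp add: f_product_def coords_def sum_distrib_left mult_ac)
    qed
    then show ?thesis by (simp add: vec_eq_iff)
  qed
  moreover have "dagger (cscale (- \<i>) ?C) = cscale (- \<i>) ?C"
  proof -
    have "dagger (cscale (- \<i>) A) = cscale \<i> (dagger A)" for A :: "complex ^ 3 ^ 3"
      by (simp add: dagger_def cnj_mat_def transpose_def cscale_def vec_eq_iff)
    moreover have "dagger (A - B) = dagger A - dagger B" for A B :: "complex ^ 3 ^ 3"
      by (simp add: dagger_def cnj_mat_def transpose_def vec_eq_iff)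
    ultimately show ?thesis
      by (simp add: dagger_mult dagger_adjoint_matrix_of) (simp add: cscale_def vec_eq_iff algebra_simps)
  qed
  moreover have "trace (cscale (- \<i>) ?C) = 0"
    by (simp add: trace_def cscale_def matrix_matrix_mult_def sum_3 algebra_simps)
  ultimately show ?thesis
    by (simp add: adjoint_matrix_of_coords_traceless)
qed

lemma f_product_Ad:
  assumes "unitary S"
  shows "f_product (Ad S x) (Ad S y) = Ad S (f_product x y)"
proof -
  have cs: "S ** cscale c A ** dagger S = cscale c (S ** A ** dagger S)" for c A
    by (simp add: cscale_def vec_eq_iff matrix_matrix_mult_def sum_3 algebra_simps)
  have df: "S ** (A - B) ** dagger S = S ** A ** dagger S - S ** B ** dagger S" for A B
    by (simp add: vec_eq_iff matrix_matrix_mult_def sum_3 algebra_simps)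
  have m: "S ** A ** dagger S ** (S ** B ** dagger S) = S ** (A ** B) ** dagger S" for A B
    using assms unfolding unitary_def by (metis matrix_mul_assoc matrix_mul_lid)
  show ?thesis
    unfolding adjoint_matrix_of_inject[symmetric]
    using assms by (simp add: adjoint_matrix_of_f_product adjoint_matrix_of_Ad cs df m)
qed

section \<open>Invariance of the potential in terms of bilinears\<close>

text \<open>The matrix phi phi^dagger is the transpose of the Gram matrix
  \<open>doublet_prod\<close>. Since it transforms by conjugation, all transformation laws of the
  bilinears can be read off from it.\<close>

lemma bilin_eq_coords: "bilin \<phi> = (1 / 2) *\<^sub>R coords (\<phi> ** dagger \<phi>)"
proof -
  have "(\<Sum>a\<in>UNIV. \<Sum>b\<in>UNIV. tgen i $ a $ b * doublet_prod \<phi> a b) = trace (\<phi> ** dagger \<phi> ** tgen i)" for i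
    by (simp add: trace_def matrix_matrix_mult_def doublet_prod_def dagger_def transpose_def cnj_mat_def
        sum_3 sum_2 algebra_simps)
  then show ?thesis
    by (simp add: bilin_def coords_def vec_eq_iff)
qed

lemma bilin0_eq_trace: "bilin0 \<phi> = 1 / sqrt 3 * Re (trace (\<phi> ** dagger \<phi>))"
  by (simp add: trace_def matrix_matrix_mult_def doublet_prod_def dagger_def transpose_def cnj_mat_def
        sum_3 sum_2 bilin0_def algebra_simps)

lemma adjoint_matrix_of_bilin:
  "adjoint_matrix_of (bilin \<phi>)
    = (1 / 2) *\<^sub>R (\<phi> ** dagger \<phi> - cscale (trace (\<phi> ** dagger \<phi>) / 3) (mat 1))"
  unfolding bilin_eq_coords adjoint_matrix_of_scaleR
  by (subst adjoint_matrix_of_coords) (simp_all add: dagger_mult)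

lemma cscale_conj:
  "S ** cscale c A ** T = cscale c (S ** A ** T)" for S T :: "complex ^ 3 ^ 3"
  by (simp add: cscale_def vec_eq_iff matrix_matrix_mult_def sum_3 algebra_simps)

lemma matrix_diff_conj:
  "S ** (A - B) ** T = S ** A ** T - S ** B ** T" for S :: "complex ^ 3 ^ 3"
  by (simp add: linear_diff[OF linear_matrix_mult_left] linear_diff[OF linear_matrix_mult_right])

lemma trace_unitary_conj:
  assumes "unitary S"
  shows "trace (S ** A ** dagger S) = trace A"
  using assms unfolding unitary_def by (metis trace_mul_sym matrix_mul_assoc matrix_mul_lid)

lemma family_map_square:
  "family_map S \<phi> ** dagger (family_map S \<phi>) = S ** (\<phi> ** dagger \<phi>) ** dagger S"
  by (simp add: family_map_def dagger_mult matrix_mul_assoc)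

lemma cp_map_square:
  "cp_map X \<phi> ** dagger (cp_map X \<phi>) = X ** cnj_mat (\<phi> ** dagger \<phi>) ** dagger X"
  by (simp add: cp_map_def dagger_mult cnj_mat_mult dagger_cnj_mat matrix_mul_assoc)

lemma bilin_family_map: "unitary S \<Longrightarrow> bilin (family_map S \<phi>) = Ad S (bilin \<phi>)"
  unfolding adjoint_matrix_of_inject[symmetric]
  by (simp add: adjoint_matrix_of_bilin adjoint_matrix_of_Ad family_map_square trace_unitary_conj
      matrix_scaleR_mult matrix_diff_conj cscale_conj unitary_def)

lemma bilin0_family_map: "unitary S \<Longrightarrow> bilin0 (family_map S \<phi>) = bilin0 \<phi>"
  by (simp add: bilin0_eq_trace family_map_square trace_unitary_conj)

lemma bilin_cp_map: "unitary X \<Longrightarrow> bilin (cp_map X \<phi>) = Ad X (conj_adj (bilin \<phi>))"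
proof -
  have 1: "cnj_mat (c *\<^sub>R A) = c *\<^sub>R cnj_mat A" for c and A :: "complex ^ 3 ^ 3"
    by (simp add: cnj_mat_def vec_eq_iff)
  have 2: "cnj_mat (A - B) = cnj_mat A - cnj_mat B" for A B :: "complex ^ 3 ^ 3"
    by (simp add: cnj_mat_def vec_eq_iff)
  have 3: "cnj_mat (cscale c A) = cscale (cnj c) (cnj_mat A)" for c and A :: "complex ^ 3 ^ 3"
    by (simp add: cnj_mat_def cscale_def vec_eq_iff)
  have 4: "trace (cnj_mat A) = cnj (trace A)" for A :: "complex ^ 3 ^ 3"
    by (simp add: trace_def cnj_mat_def)
  assume "unitary X"
  then show ?thesis
    unfolding adjoint_matrix_of_inject[symmetric]
    by (simp add: adjoint_matrix_of_bilin adjoint_matrix_of_Ad adjoint_matrix_of_conj_adj cp_map_square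
        trace_unitary_conj matrix_scaleR_mult matrix_diff_conj cscale_conj unitary_def 1 2 3 4)
qed

lemma bilin0_cp_map: "unitary X \<Longrightarrow> bilin0 (cp_map X \<phi>) = bilin0 \<phi>"
  by (simp add: bilin0_eq_trace cp_map_square trace_unitary_conj) (simp add: trace_def cnj_mat_def)

section \<open>Uniqueness of the bilinear form\<close>

text \<open>Configurations with one nonzero column, for which phi phi^dagger is the matrix v
  v^dagger of rank at most one.\<close>

definition fst_doublets :: "complex ^ 3 \<Rightarrow> doublets" where
  "fst_doublets v = (\<chi> a s. if s = 1 then v $ a else 0)"

definition two_doublets :: "complex ^ 3 \<Rightarrow> complex ^ 3 \<Rightarrow> doublets" where
  "two_doublets v w = (\<chi> a s. if s = 1 then v $ a else w $ a)"

text \<open>The two columns contribute separately to phi phi^dagger; this additivity is what later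
  polarizes the quartic part of the potential.\<close>

lemma bilin_two_doublets:
  "bilin (two_doublets v w) = bilin (fst_doublets v) + bilin (fst_doublets w)"
  by (simp add: bilin_def vec_eq_iff doublet_prod_def sum_2 fst_doublets_def two_doublets_def
      sum_3 algebra_simps)

lemma bilin0_two_doublets:
  "bilin0 (two_doublets v w) = bilin0 (fst_doublets v) + bilin0 (fst_doublets w)"
  by (simp add: bilin0_def doublet_prod_def sum_2 fst_doublets_def two_doublets_def sum_3 algebra_simps)

lemma doublet_prod_scaleR: "doublet_prod (t *\<^sub>R \<phi>) a b = of_real (t\<^sup>2) * doublet_prod \<phi> a b"
  by (simp add: doublet_prod_def sum_2 scaleR_conv_of_real[where 'a = complex] power2_eq_square algebra_simps)

lemma bilin_scaleR: "bilin (t *\<^sub>R \<phi>) = t\<^sup>2 *\<^sub>R bilin \<phi>"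
proof -
  have "(t *\<^sub>R \<phi>) ** dagger (t *\<^sub>R \<phi>) = t\<^sup>2 *\<^sub>R (\<phi> ** dagger \<phi>)"
    by (simp add: vec_eq_iff matrix_matrix_mult_def dagger_def transpose_def cnj_mat_def
        scaleR_sum_right power2_eq_square)
  then show ?thesis
    by (simp add: bilin_eq_coords linear_scale[OF linear_coords])
qed

lemma bilin0_scaleR: "bilin0 (t *\<^sub>R \<phi>) = t\<^sup>2 * bilin0 \<phi>"
  by (simp add: bilin0_def doublet_prod_scaleR sum_3 algebra_simps)

text \<open>The matrices v v^dagger span the nine-dimensional space of Hermitian 3 x 3 matrices. The
  test vectors are e_a for the diagonal, and e_a + e_b, e_a + i e_b for the real and imaginary
  off-diagonal parts.\<close>

lemma rank_one_bilinears_separate: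
  fixes c :: real and m :: "real ^ 8"
  assumes "\<And>v. c * bilin0 (fst_doublets v) + m \<bullet> bilin (fst_doublets v) = 0"
  shows "c = 0" "m = 0"
proof -
  note E = bilin0_def bilin_def doublet_prod_def sum_2 fst_doublets_def sum_3 inner_vec_def sum_8
    tgen_def gell_mann_simps
  have s3: "sqrt 3 \<noteq> 0" "x / sqrt 3 = sqrt 3 * x / 3" for x
    by (simp_all add: field_simps)
  have e1: "c / sqrt 3 + m $ 3 / 2 + m $ 8 / (2 * sqrt 3) = 0"
    using assms[of "vector [1, 0, 0]"] by (simp add: E)
  have e2: "c / sqrt 3 - m $ 3 / 2 + m $ 8 / (2 * sqrt 3) = 0"
    using assms[of "vector [0, 1, 0]"] by (simp add: E)
  have e3: "c / sqrt 3 - m $ 8 / sqrt 3 = 0"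
    using assms[of "vector [0, 0, 1]"] by (simp add: E)
  have m3: "m $ 3 = 0" using e1 e2 by linarith
  have "c = m $ 8" using e3 s3 by simp
  then have m8: "m $ 8 = 0" using e1 m3 by (simp add: field_simps)
  have c: "c = 0" using m8 \<open>c = m $ 8\<close> by simp
  have "m $ 1 = 0" using assms[of "vector [1, 1, 0]"] by (simp add: E m3 m8 c)
  moreover have "m $ 2 = 0" using assms[of "vector [1, \<i>, 0]"] by (simp add: E m3 m8 c)
  moreover have "m $ 4 = 0" using assms[of "vector [1, 0, 1]"] by (simp add: E m3 m8 c)
  moreover have "m $ 5 = 0" using assms[of "vector [1, 0, \<i>]"] by (simp add: E m3 m8 c)
  moreover have "m $ 6 = 0" using assms[of "vector [0, 1, 1]"] by (simp add: E m3 m8 c)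
  moreover have "m $ 7 = 0" using assms[of "vector [0, 1, \<i>]"] by (simp add: E m3 m8 c)
  ultimately have "m = 0" using m3 m8 by (simp add: vec_eq_iff forall_8)
  with c show "c = 0" "m = 0" by auto
qed

text \<open>Uniqueness of the coefficients, in the form that compares \<open>V\<close> with its
  transform: there the terms in r_0 and r_0^2 have already cancelled.\<close>

lemma bilinear_form_zero:
  fixes m l :: "real ^ 8" and K :: "real ^ 8 \<Rightarrow> real ^ 8"
  assumes lin: "linear K" and sym: "\<And>x y. x \<bullet> K y = K x \<bullet> y"
    and zero: "\<And>\<phi>. m \<bullet> bilin \<phi> + bilin0 \<phi> * (l \<bullet> bilin \<phi>) + bilin \<phi> \<bullet> K (bilin \<phi>) = 0"
  shows "m = 0" "l = 0" "K x = 0"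
proof -
  define Q where "Q \<phi> = bilin0 \<phi> * (l \<bullet> bilin \<phi>) + bilin \<phi> \<bullet> K (bilin \<phi>)" for \<phi>
  have 1: "m \<bullet> bilin \<phi> + Q \<phi> = 0" for \<phi> using zero[of \<phi>] by (simp add: Q_def)
  \<comment> \<open>Doubling phi multiplies the quadratic part by 4 and the quartic part by 16,
    which separates the two.\<close>
  have 2: "4 * (m \<bullet> bilin \<phi>) + 16 * Q \<phi> = 0" for \<phi>
    using 1[of "2 *\<^sub>R \<phi>"]
    by (simp add: Q_def bilin_scaleR bilin0_scaleR linear_scale[OF lin] algebra_simps)
  have mb: "m \<bullet> bilin \<phi> = 0" and Q: "Q \<phi> = 0" for \<phi>
    using 1[of \<phi>] 2[of \<phi>] by linarith+
  show "m = 0" using rank_one_bilinears_separate(2)[of 0 m] mb by simp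
  let ?r = "\<lambda>v. bilin (fst_doublets v)" and ?s = "\<lambda>v. bilin0 (fst_doublets v)"
  \<comment> \<open>Cross term between two columns. For fixed \<open>v\<close> it is linear in the
    bilinears of \<open>w\<close>, so the rank one configurations annihilate its
    coefficients.\<close>
  have pol: "(l \<bullet> ?r v) * ?s w + (?s v *\<^sub>R l + 2 *\<^sub>R K (?r v)) \<bullet> ?r w = 0" for v w
  proof -
    have "Q (two_doublets v w) - Q (fst_doublets v) - Q (fst_doublets w) = 0" by (simp add: Q)
    then show ?thesis
      unfolding Q_def bilin_two_doublets bilin0_two_doublets linear_add[OF lin]
      using sym[of "?r v" "?r w"] inner_commute[of "?r w" "K (?r v)"]
      by (simp add: algebra_simps)
  qed
  have l0: "l \<bullet> ?r v = 0" and k0: "?s v *\<^sub>R l + 2 *\<^sub>R K (?r v) = 0" for v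
    by (rule rank_one_bilinears_separate[OF pol])+
  show l: "l = 0" using rank_one_bilinears_separate(2)[of 0 l] l0 by simp
  have "K x \<bullet> ?r v = 0" for v
    using k0[of v] l by (simp flip: sym)
  then show "K x = 0" using rank_one_bilinears_separate(2)[of 0 "K x"] by simp
qed

lemma is_bilinear_form_inner:
  assumes "is_bilinear_form V M0 M Lam0 L Lam"
  shows "V \<phi> = M0 * bilin0 \<phi> + M \<bullet> bilin \<phi> + Lam0 * (bilin0 \<phi>)\<^sup>2 + bilin0 \<phi> * (L \<bullet> bilin \<phi>)
    + bilin \<phi> \<bullet> (Lam *v bilin \<phi>)"
  using assms unfolding is_bilinear_form_def
  by (simp add: inner_vec_def matrix_vector_mult_def sum_distrib_left mult_ac)

lemma is_bilinear_form_self_adjoint: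
  assumes "is_bilinear_form V M0 M Lam0 L Lam"
  shows "x \<bullet> (Lam *v y) = (Lam *v x) \<bullet> y"
  using assms unfolding is_bilinear_form_def by (metis dot_lmul_matrix vector_transpose_matrix)

text \<open>Common core of the family and the CP case. \<open>R'\<close> is both inverse and adjoint
  of \<open>R\<close>, so the difference of the two potentials is again a form to which uniqueness
  of the coefficients applies.\<close>

lemma invariant_iff:
  fixes R R' :: "real ^ 8 \<Rightarrow> real ^ 8"
  assumes bf: "is_bilinear_form V M0 M Lam0 L Lam"
    and lin: "linear R" "linear R'" and adj: "\<And>x y. x \<bullet> R y = R' x \<bullet> y" and inv: "\<And>x. R (R' x) = x" "\<And>x. R' (R x) = x"
    and T: "\<And>\<phi>. bilin (T \<phi>) = R (bilin \<phi>)" "\<And>\<phi>. bilin0 (T \<phi>) = bilin0 \<phi>"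
  shows "(\<forall>\<phi>. V (T \<phi>) = V \<phi>) \<longleftrightarrow> R M = M \<and> R L = L \<and> (\<forall>x. Lam *v R x = R (Lam *v x))"
proof -
  note sa = is_bilinear_form_self_adjoint[OF bf]
  define K where "K x = R' (Lam *v R x) - Lam *v x" for x
  have linK: "linear K"
    unfolding K_def
    using linear_compose_sub[OF linear_compose[OF linear_compose[OF lin(1) matrix_vector_mul_linear[of Lam]] lin(2)]
        matrix_vector_mul_linear[of Lam]]
    by (simp add: o_def)
  have a: "R x \<bullet> y = x \<bullet> R' y" for x y
    using adj[of y x] by (simp add: inner_commute)
  have symK: "x \<bullet> K y = K x \<bullet> y" for x y
    unfolding K_def by (simp add: inner_diff_left inner_diff_right sa adj flip: a)
  have diff: "V (T \<phi>) - V \<phi> = (R' M - M) \<bullet> bilin \<phi> + bilin0 \<phi> * ((R' L - L) \<bullet> bilin \<phi>)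
      + bilin \<phi> \<bullet> K (bilin \<phi>)" for \<phi>
    unfolding is_bilinear_form_inner[OF bf] T K_def
    by (simp add: adj a[of "bilin \<phi>" "Lam *v R (bilin \<phi>)"] inner_diff_left inner_diff_right algebra_simps)
  show ?thesis
  proof
    assume "\<forall>\<phi>. V (T \<phi>) = V \<phi>"
    then have z: "(R' M - M) \<bullet> bilin \<phi> + bilin0 \<phi> * ((R' L - L) \<bullet> bilin \<phi>) + bilin \<phi> \<bullet> K (bilin \<phi>) = 0" for \<phi>
      using diff[of \<phi>] by simp
    have m: "R' M - M = 0" "R' L - L = 0" "\<And>x. K x = 0"
      using bilinear_form_zero[OF linK symK z] by auto
    then show "R M = M \<and> R L = L \<and> (\<forall>x. Lam *v R x = R (Lam *v x))"
      unfolding K_def by (metis inv(1) eq_iff_diff_eq_0)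
  next
    assume *: "R M = M \<and> R L = L \<and> (\<forall>x. Lam *v R x = R (Lam *v x))"
    then have "R' M = M" "R' L = L" "K x = 0" for x
      unfolding K_def by (metis inv(2), metis inv(2), metis inv(2) diff_self)
    then show "\<forall>\<phi>. V (T \<phi>) = V \<phi>"
      using diff by auto
  qed
qed

lemma family_symmetry_iff:
  assumes "is_bilinear_form V M0 M Lam0 L Lam" "unitary S"
  shows "family_symmetry V S \<longleftrightarrow> Ad S M = M \<and> Ad S L = L \<and> (\<forall>x. Lam *v Ad S x = Ad S (Lam *v x))"
proof -
  have "(\<forall>\<phi>. V (family_map S \<phi>) = V \<phi>) \<longleftrightarrow> Ad S M = M \<and> Ad S L = L \<and> (\<forall>x. Lam *v Ad S x = Ad S (Lam *v x))"
    using assms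
    by (intro invariant_iff[where R' = "Ad (dagger S)", OF assms(1) linear_Ad linear_Ad])
      (auto simp: Ad_inner_left unitary_dagger Ad_Ad_dagger Ad_dagger_Ad bilin_family_map bilin0_family_map)
  then show ?thesis using assms(2) by (simp add: family_symmetry_def)
qed

lemma cp_symmetry_iff:
  assumes "is_bilinear_form V M0 M Lam0 L Lam" "unitary X"
  shows "cp_symmetry V X \<longleftrightarrow> Ad X (conj_adj M) = M \<and> Ad X (conj_adj L) = L
    \<and> (\<forall>x. Lam *v Ad X (conj_adj x) = Ad X (conj_adj (Lam *v x)))"
proof -
  have adj: "x \<bullet> Ad X (conj_adj y) = conj_adj (Ad (dagger X) x) \<bullet> y" for x y
    by (metis Ad_inner_left assms(2) conj_adj_conj_adj conj_adj_inner inner_commute)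
  have "(\<forall>\<phi>. V (cp_map X \<phi>) = V \<phi>) \<longleftrightarrow> Ad X (conj_adj M) = M \<and> Ad X (conj_adj L) = L
    \<and> (\<forall>x. Lam *v Ad X (conj_adj x) = Ad X (conj_adj (Lam *v x)))"
    using assms adj
    by (intro invariant_iff[where R' = "\<lambda>x. conj_adj (Ad (dagger X) x)", OF assms(1)
        linear_compose[OF linear_conj_adj linear_Ad, unfolded o_def]
        linear_compose[OF linear_Ad linear_conj_adj, unfolded o_def]])
      (auto simp: Ad_Ad_dagger Ad_dagger_Ad bilin_cp_map bilin0_cp_map)
  then show ?thesis using assms(2) by (simp add: cp_symmetry_def)
qed

section \<open>Unitaries commuting with a block matrix\<close>

lemma Ad_eq_iff:
  assumes "unitary S"
  shows "Ad S x = y \<longleftrightarrow> S ** adjoint_matrix_of x = adjoint_matrix_of y ** S"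
proof -
  have "S ** adjoint_matrix_of x ** dagger S = adjoint_matrix_of y \<longleftrightarrow>
      S ** adjoint_matrix_of x = adjoint_matrix_of y ** S"
    using assms unfolding unitary_def by (metis matrix_mul_assoc matrix_mul_rid)
  then show ?thesis
    using assms by (metis adjoint_matrix_of_Ad adjoint_matrix_of_inject)
qed

lemma unitary_conj_mult:
  assumes "unitary S"
  shows "S ** (A ** B) ** dagger S = (S ** A ** dagger S) ** (S ** B ** dagger S)"
proof -
  have "(S ** A ** dagger S) ** (S ** B ** dagger S) = S ** A ** (dagger S ** S) ** B ** dagger S"
    by (simp only: matrix_mul_assoc)
  also have "\<dots> = S ** A ** B ** dagger S"
    using assms by (simp add: unitary_def)
  finally show ?thesis by (simp only: matrix_mul_assoc)
qed

text \<open>Shape of \<open>Lam\<close> in an adapted basis, where coordinates 4 and 6 span one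
  eigenspace and 5 and 7 the other. As a map on vectors it composes with other block forms entry by
  entry, so its powers keep this shape.\<close>

definition block_form :: "real ^ 3 ^ 3 \<Rightarrow> real \<Rightarrow> real \<Rightarrow> real \<Rightarrow> real ^ 8 \<Rightarrow> real ^ 8" where
  "block_form A m1 m2 l x = (\<chi> i.
    if i = 1 then A $ 1 $ 1 * x $ 1 + A $ 1 $ 2 * x $ 2 + A $ 1 $ 3 * x $ 3
    else if i = 2 then A $ 2 $ 1 * x $ 1 + A $ 2 $ 2 * x $ 2 + A $ 2 $ 3 * x $ 3
    else if i = 3 then A $ 3 $ 1 * x $ 1 + A $ 3 $ 2 * x $ 2 + A $ 3 $ 3 * x $ 3
    else if i = 4 then m1 * x $ 4
    else if i = 5 then m2 * x $ 5
    else if i = 6 then m1 * x $ 6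
    else if i = 7 then m2 * x $ 7
    else l * x $ 8)"

lemma block_form_nth:
  "block_form A m1 m2 l x $ 1 = A $ 1 $ 1 * x $ 1 + A $ 1 $ 2 * x $ 2 + A $ 1 $ 3 * x $ 3"
  "block_form A m1 m2 l x $ 2 = A $ 2 $ 1 * x $ 1 + A $ 2 $ 2 * x $ 2 + A $ 2 $ 3 * x $ 3"
  "block_form A m1 m2 l x $ 3 = A $ 3 $ 1 * x $ 1 + A $ 3 $ 2 * x $ 2 + A $ 3 $ 3 * x $ 3"
  "block_form A m1 m2 l x $ 4 = m1 * x $ 4"
  "block_form A m1 m2 l x $ 5 = m2 * x $ 5"
  "block_form A m1 m2 l x $ 6 = m1 * x $ 6"
  "block_form A m1 m2 l x $ 7 = m2 * x $ 7"
  "block_form A m1 m2 l x $ 8 = l * x $ 8"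
  by (simp_all add: block_form_def)

lemma block_form_block_form:
  "block_form A m1 m2 l (block_form A' m1' m2' l' x) = block_form (A ** A') (m1 * m1') (m2 * m2') (l * l') x"
  by (simp add: vec_eq_iff forall_8 block_form_nth matrix_matrix_mult_def sum_3 algebra_simps)

lemma linear_block_form: "linear (block_form A m1 m2 l)"
  by (rule linearI) (simp_all add: vec_eq_iff forall_8 block_form_nth algebra_simps)

text \<open>For the identity map this is the quadratic Casimir element of su(3) in the fundamental
  representation, a scalar matrix. For general \<open>K\<close> its deviation from a scalar
  restricts the unitaries whose adjoint action commutes with \<open>K\<close>.\<close>

definition quadratic_casimir :: "(real ^ 8 \<Rightarrow> real ^ 8) \<Rightarrow> complex ^ 3 ^ 3" where
  "quadratic_casimir K = (\<Sum>j\<in>UNIV. tgen j ** adjoint_matrix_of (K (axis j 1)))"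

lemma adjoint_matrix_of_axis: "adjoint_matrix_of (axis j 1) = tgen j"
  by (simp add: adjoint_matrix_of_def axis_def if_distrib[of "\<lambda>x. x *\<^sub>R _"] cong: if_cong)

text \<open>Conjugation by \<open>S\<close> replaces the orthonormal basis t_j by its image under
  \<open>Ad S\<close> and, by commutation, leaves \<open>K\<close> alone. A contraction over an
  orthonormal basis does not depend on the basis.\<close>

lemma quadratic_casimir_commute:
  assumes S: "unitary S" and lin: "linear K" and comm: "\<And>x. K (Ad S x) = Ad S (K x)"
  shows "S ** quadratic_casimir K = quadratic_casimir K ** S"
proof -
  let ?r = "\<lambda>j. Ad S (axis j 1)"
  let ?b = "\<lambda>x y. adjoint_matrix_of x ** adjoint_matrix_of (K y)"
  have lb1: "linear (\<lambda>x. ?b x y)" for y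
    using linear_compose[OF linear_adjoint_matrix_of linear_matrix_mult_left] by (simp add: o_def)
  have lb2: "linear (\<lambda>y. ?b x y)" for x
    using linear_compose[OF linear_compose[OF lin linear_adjoint_matrix_of] linear_matrix_mult_right]
    by (simp add: o_def)
  have expand: "?r j = (\<Sum>k\<in>UNIV. ?r j $ k *\<^sub>R axis k 1)" for j
    by (simp add: vec_eq_iff axis_def if_distrib cong: if_cong)
  \<comment> \<open>Row orthogonality of the matrix of \<open>Ad S\<close>: its rows are the images
    of the axes under the inverse.\<close>
  have orth: "(\<Sum>j\<in>UNIV. ?r j $ k * ?r j $ l) = (if k = l then 1 else 0)" for k l
  proof -
    have nth: "?r j $ k = Ad (dagger S) (axis k 1) $ j" for j k
      by (metis Ad_inner_left S inner_commute cart_eq_inner_axis)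
    have "(\<Sum>j\<in>UNIV. ?r j $ k * ?r j $ l) = Ad (dagger S) (axis k 1) \<bullet> Ad (dagger S) (axis l 1)"
      by (simp add: nth inner_vec_def)
    also have "\<dots> = axis k 1 \<bullet> axis l (1::real)"
      using S by (simp add: Ad_inner unitary_dagger)
    finally show ?thesis by (simp add: inner_axis_axis)
  qed
  have "S ** quadratic_casimir K ** dagger S = (\<Sum>j\<in>UNIV. ?b (?r j) (?r j))"
  proof -
    have "S ** (tgen j ** adjoint_matrix_of (K (axis j 1))) ** dagger S = ?b (?r j) (?r j)" for j
      by (simp only: comm adjoint_matrix_of_Ad[OF S] adjoint_matrix_of_axis unitary_conj_mult[OF S])
    then show ?thesis
      by (simp add: quadratic_casimir_def linear_sum[OF linear_matrix_mult_left] linear_sum[OF linear_matrix_mult_right])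
  qed
  also have "\<dots> = (\<Sum>j\<in>UNIV. \<Sum>k\<in>UNIV. \<Sum>l\<in>UNIV. (?r j $ k * ?r j $ l) *\<^sub>R ?b (axis k 1) (axis l 1))"
  proof -
    have "?b (?r j) (?r j) = (\<Sum>k\<in>UNIV. \<Sum>l\<in>UNIV. (?r j $ k * ?r j $ l) *\<^sub>R ?b (axis k 1) (axis l 1))" for j
    proof -
      have "?b (?r j) y = (\<Sum>k\<in>UNIV. ?r j $ k *\<^sub>R ?b (axis k 1) y)" for y
        by (subst expand) (simp only: linear_sum[OF lb1] linear_scale[OF lb1])
      moreover have "?b x (?r j) = (\<Sum>l\<in>UNIV. ?r j $ l *\<^sub>R ?b x (axis l 1))" for x
        by (subst expand) (simp only: linear_sum[OF lb2] linear_scale[OF lb2])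
      ultimately show ?thesis by (simp add: scaleR_sum_right) (subst sum.swap, simp add: mult.commute)
    qed
    then show ?thesis by simp
  qed
  also have "\<dots> = (\<Sum>k\<in>UNIV. \<Sum>l\<in>UNIV. (\<Sum>j\<in>UNIV. ?r j $ k * ?r j $ l) *\<^sub>R ?b (axis k 1) (axis l 1))"
    by (subst sum.swap, rule sum.cong[OF refl], subst sum.swap) (simp add: scaleR_sum_left)
  also have "\<dots> = quadratic_casimir K"
    by (simp add: orth quadratic_casimir_def adjoint_matrix_of_axis if_distrib[of "\<lambda>x. x *\<^sub>R _"] cong: if_cong)
  finally have "quadratic_casimir K ** S = S ** quadratic_casimir K ** (dagger S ** S)"
    by (simp only: matrix_mul_assoc)
  then show ?thesis using S by (simp add: unitary_def)
qed

text \<open>Symmetry of \<open>A\<close> leaves only anticommutators of the Pauli block, which are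
  scalar there; the pairing of 4 with 6 and of 5 with 7 keeps the upper block scalar. The two
  diagonal values differ by (tr A - m1 - m2 - l) / 4, the origin of the trace condition
  below.\<close>

lemma quadratic_casimir_block_form:
  fixes A :: "real ^ 3 ^ 3" and m1 m2 l :: real
  assumes "transpose A = A"
  defines "C \<equiv> quadratic_casimir (block_form A m1 m2 l)"
  shows "C $ i $ j = (if i \<noteq> j then 0 else if i = 3 then of_real ((m1 + m2) / 2 + l / 3)
      else of_real ((A $ 1 $ 1 + A $ 2 $ 2 + A $ 3 $ 3 + m1 + m2 + l / 3) / 4))"
proof -
  have sym: "A $ 2 $ 1 = A $ 1 $ 2" "A $ 3 $ 1 = A $ 1 $ 3" "A $ 3 $ 2 = A $ 2 $ 3"
    using assms(1) by (simp_all add: transpose_def vec_eq_iff)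
  have s3: "complex_of_real (sqrt 3) * complex_of_real (sqrt 3) = 3"
    by (simp flip: of_real_mult)
  have "\<forall>i j. C $ i $ j = (if i \<noteq> j then 0 else if i = 3 then of_real ((m1 + m2) / 2 + l / 3)
      else of_real ((A $ 1 $ 1 + A $ 2 $ 2 + A $ 3 $ 3 + m1 + m2 + l / 3) / 4))"
    unfolding C_def quadratic_casimir_def sum_8 forall_3
    by (simp add: adjoint_matrix_of_explicit block_form_nth axis_def tgen_def gell_mann_simps
        matrix_matrix_mult_def sum_3 scaleR_conv_of_real[where 'a = complex] sym field_simps s3)
  then show ?thesis by blast
qed

lemma block_diagonal_of_trace:
  assumes "unitary S" "transpose A = A" "\<And>x. block_form A m1 m2 l (Ad S x) = Ad S (block_form A m1 m2 l x)"
    and "trace A \<noteq> m1 + m2 + l"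
  shows "S $ 1 $ 3 = 0" "S $ 2 $ 3 = 0" "S $ 3 $ 1 = 0" "S $ 3 $ 2 = 0"
proof -
  define C where "C = quadratic_casimir (block_form A m1 m2 l)"
  let ?a = "(A $ 1 $ 1 + A $ 2 $ 2 + A $ 3 $ 3 + m1 + m2 + l / 3) / 4" and ?b = "(m1 + m2) / 2 + l / 3"
  have c: "(S ** C) $ i $ j = (C ** S) $ i $ j" for i j
    using quadratic_casimir_commute[OF assms(1) linear_block_form assms(3)] by (simp add: C_def)
  have ne: "complex_of_real ?a \<noteq> of_real ?b"
    using assms(4) by (simp add: trace_def sum_3 field_simps del: of_real_add of_real_divide)
  note C = quadratic_casimir_block_form[OF assms(2), of m1 m2 l, folded C_def]
  have "S $ i $ 3 * of_real ?b = of_real ?a * S $ i $ 3" "S $ 3 $ i * of_real ?a = of_real ?b * S $ 3 $ i"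
    if "i = 1 \<or> i = 2" for i
    using that c[of i 3] c[of 3 i]
    by (auto simp: matrix_matrix_mult_def sum_3 C simp del: of_real_add of_real_divide)
  then show "S $ 1 $ 3 = 0" "S $ 2 $ 3 = 0" "S $ 3 $ 1 = 0" "S $ 3 $ 2 = 0"
    using ne by (metis mult.commute mult_cancel_left)+
qed

text \<open>In an adapted basis \<open>u\<close> lies on the second axis, and \<open>U\<close> is the unit circle orthogonal to it
  in the span of the first three axes.\<close>

definition generic_block :: "real ^ 3 ^ 3 \<Rightarrow> bool" where
  "generic_block A \<longleftrightarrow>
    (\<forall>y c. y \<noteq> 0 \<longrightarrow> A *v y = c *\<^sub>R y \<longrightarrow> y $ 2 \<noteq> 0 \<and> (y $ 1 \<noteq> 0 \<or> y $ 3 \<noteq> 0))"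

section \<open>Spectrum of the 3 x 3 block from its power traces\<close>

lemma sym3:
  fixes A :: "real ^ 3 ^ 3"
  assumes "transpose A = A"
  shows "A $ 2 $ 1 = A $ 1 $ 2" "A $ 3 $ 1 = A $ 1 $ 3" "A $ 3 $ 2 = A $ 2 $ 3"
  using assms by (simp_all add: transpose_def vec_eq_iff)

lemma mult_vec_3:
  fixes A :: "real ^ 3 ^ 3"
  shows "A *v y = c *\<^sub>R y \<longleftrightarrow>
    A $ 1 $ 1 * y $ 1 + A $ 1 $ 2 * y $ 2 + A $ 1 $ 3 * y $ 3 = c * y $ 1 \<and>
    A $ 2 $ 1 * y $ 1 + A $ 2 $ 2 * y $ 2 + A $ 2 $ 3 * y $ 3 = c * y $ 2 \<and>
    A $ 3 $ 1 * y $ 1 + A $ 3 $ 2 * y $ 2 + A $ 3 $ 3 * y $ 3 = c * y $ 3"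
  by (simp add: vec_eq_iff forall_3 matrix_vector_mult_def sum_3)

text \<open>The cofactors of a singular symmetric matrix form a matrix of rank at most one; if its
  trace vanishes, so do all cofactors.\<close>

lemma singular_double_kernel:
  fixes a b c d e f :: real
  assumes det: "a * (d * f - e\<^sup>2) - b * (b * f - c * e) + c * (b * e - c * d) = 0"
    and min: "(a * d - b\<^sup>2) + (a * f - c\<^sup>2) + (d * f - e\<^sup>2) = 0"
  shows "\<exists>x z. (x \<noteq> 0 \<or> z \<noteq> 0) \<and> a * x + c * z = 0 \<and> b * x + e * z = 0 \<and> c * x + f * z = 0"
proof -
  let ?p = "d * f - e\<^sup>2" and ?q = "a * f - c\<^sup>2" and ?r = "a * d - b\<^sup>2"
  have 1: "?p * ?q = (b * f - c * e)\<^sup>2" and 2: "?p * ?r = (b * e - c * d)\<^sup>2" and 3: "?q * ?r = (a * e - b * c)\<^sup>2"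
    using det by algebra+
  have "?p * ?q \<ge> 0" "?p * ?r \<ge> 0" "?q * ?r \<ge> 0"
    unfolding 1 2 3 by simp_all
  moreover have "(?p + ?q + ?r)\<^sup>2 = ?p\<^sup>2 + ?q\<^sup>2 + ?r\<^sup>2 + 2 * (?p * ?q) + 2 * (?p * ?r) + 2 * (?q * ?r)"
    by algebra
  moreover have "(?p + ?q + ?r)\<^sup>2 = 0" using min by (simp add: algebra_simps)
  ultimately have "?p\<^sup>2 = 0" "?q\<^sup>2 = 0" "?r\<^sup>2 = 0"
    using zero_le_power2[of ?p] zero_le_power2[of ?q] zero_le_power2[of ?r] by linarith+
  then have z: "?p = 0" "?q = 0" "?r = 0" by simp_all
  then have m: "b * f = c * e" "a * e = b * c" "a * f = c * c"
    using 1 3 by (simp_all add: power2_eq_square)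
  \<comment> \<open>The rows (a, c), (b, e), (c, f) of the outer two columns are pairwise
    proportional by \<open>m\<close>. A vector orthogonal to a nonzero one among them is therefore
    orthogonal to all three.\<close>
  consider "a \<noteq> 0 \<or> c \<noteq> 0" | "b \<noteq> 0 \<or> e \<noteq> 0" "a = 0" "c = 0"
    | "c \<noteq> 0 \<or> f \<noteq> 0" "a = 0" "c = 0" "b = 0" "e = 0" | "a = 0" "b = 0" "c = 0" "e = 0" "f = 0" by blast
  then show ?thesis
  proof cases
    case 1
    then show ?thesis using m by (intro exI[of _ c] exI[of _ "- a"]) (auto simp: algebra_simps)
  next
    case 2
    then show ?thesis using m by (intro exI[of _ e] exI[of _ "- b"]) (auto simp: algebra_simps)
  next
    case 3
    then show ?thesis by (intro exI[of _ f] exI[of _ "- c"]) auto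
  next
    case 4
    then show ?thesis by (intro exI[of _ 1] exI[of _ 0]) auto
  qed
qed

text \<open>Newton's identities: three power sums determine the characteristic polynomial. It is
  written for A - x, with eigenvalues 0, y - x and z - x, so that the determinant vanishes and the
  second symmetric function is a single product.\<close>

lemma power_traces_shift:
  fixes A :: "real ^ 3 ^ 3"
  assumes sym: "transpose A = A"
    and t1: "trace A = x + y + z" and t2: "trace (A ** A) = x * x + y * y + z * z"
    and t3: "trace (A ** (A ** A)) = x * (x * x) + y * (y * y) + z * (z * z)"
  defines "a \<equiv> A $ 1 $ 1 - x" and "d \<equiv> A $ 2 $ 2 - x" and "f \<equiv> A $ 3 $ 3 - x"
    and "b \<equiv> A $ 1 $ 2" and "c \<equiv> A $ 1 $ 3" and "e \<equiv> A $ 2 $ 3"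
  shows "a * (d * f - e\<^sup>2) - b * (b * f - c * e) + c * (b * e - c * d) = 0"
    and "(a * d - b\<^sup>2) + (a * f - c\<^sup>2) + (d * f - e\<^sup>2) = (y - x) * (z - x)"
proof -
  note S = sym3[OF sym]
  have A: "A $ 1 $ 1 = a + x" "A $ 2 $ 2 = d + x" "A $ 3 $ 3 = f + x"
    by (simp_all add: a_def d_def f_def)
  define s t where "s = y - x" and "t = z - x"
  have yz: "y = s + x" "z = t + x" by (simp_all add: s_def t_def)
  have T1: "a + d + f = s + t"
    using t1 by (simp add: trace_def sum_3 A yz)
  have "(a + x)\<^sup>2 + (d + x)\<^sup>2 + (f + x)\<^sup>2 + 2 * (b\<^sup>2 + c\<^sup>2 + e\<^sup>2) = x\<^sup>2 + (s + x)\<^sup>2 + (t + x)\<^sup>2"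
    using t2 by (simp add: trace_def matrix_matrix_mult_def sum_3 A S flip: b_def c_def e_def yz)
      (simp add: power2_eq_square algebra_simps)
  then have T2: "a\<^sup>2 + d\<^sup>2 + f\<^sup>2 + 2 * (b\<^sup>2 + c\<^sup>2 + e\<^sup>2) = s\<^sup>2 + t\<^sup>2"
    using T1 by algebra
  show m: "(a * d - b\<^sup>2) + (a * f - c\<^sup>2) + (d * f - e\<^sup>2) = (y - x) * (z - x)"
    unfolding s_def[symmetric] t_def[symmetric] using T1 T2 by algebra
  have "(a + x) ^ 3 + (d + x) ^ 3 + (f + x) ^ 3 + 3 * (a + x) * (b\<^sup>2 + c\<^sup>2) + 3 * (d + x) * (b\<^sup>2 + e\<^sup>2)
      + 3 * (f + x) * (c\<^sup>2 + e\<^sup>2) + 6 * b * c * e = x ^ 3 + (s + x) ^ 3 + (t + x) ^ 3"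
    using t3 by (simp add: trace_def matrix_matrix_mult_def sum_3 A S flip: b_def c_def e_def yz)
      (simp add: power2_eq_square power3_eq_cube algebra_simps)
  then have T3: "a ^ 3 + d ^ 3 + f ^ 3 + 3 * a * (b\<^sup>2 + c\<^sup>2) + 3 * d * (b\<^sup>2 + e\<^sup>2)
      + 3 * f * (c\<^sup>2 + e\<^sup>2) + 6 * b * c * e = s ^ 3 + t ^ 3"
    using T1 T2 by algebra
  show "a * (d * f - e\<^sup>2) - b * (b * f - c * e) + c * (b * e - c * d) = 0"
    using T1 T2 T3 by algebra
qed

lemma eigenvector_of_power_traces:
  fixes A :: "real ^ 3 ^ 3"
  assumes sym: "transpose A = A"
    and t: "trace A = x + y + z" "trace (A ** A) = x * x + y * y + z * z"
      "trace (A ** (A ** A)) = x * (x * x) + y * (y * y) + z * (z * z)"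
  shows "\<exists>v. v \<noteq> 0 \<and> A *v v = x *\<^sub>R v"
proof -
  have "det (A - mat x) = 0"
    using power_traces_shift(1)[OF sym t]
    by (simp add: det_3 mat_def sym3[OF sym] power2_eq_square algebra_simps)
  then obtain v where "v \<noteq> 0" "(A - mat x) *v v = 0"
    using det_eq_0_rank[of "A - mat x"] matrix_nonfull_linear_equations_eq[of "A - mat x"] by auto
  then have "v \<noteq> 0 \<and> A *v v = x *\<^sub>R v"
    unfolding mult_vec_3
    by (simp add: vec_eq_iff forall_3 matrix_vector_mult_def mat_def sum_3 algebra_simps)
  then show ?thesis ..
qed

text \<open>A repeated eigenvalue of a symmetric matrix has an eigenspace of dimension at least two.
  In three dimensions this meets the plane where the second coordinate vanishes, which genericity
  forbids.\<close>

lemma generic_block_distinct: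
  fixes A :: "real ^ 3 ^ 3"
  assumes sym: "transpose A = A" and gen: "generic_block A"
    and t: "trace A = x + y + z" "trace (A ** A) = x * x + y * y + z * z"
      "trace (A ** (A ** A)) = x * (x * x) + y * (y * y) + z * (z * z)"
  shows "y \<noteq> x"
proof
  assume "y = x"
  then have "\<exists>p q. (p \<noteq> 0 \<or> q \<noteq> 0) \<and> (A $ 1 $ 1 - x) * p + A $ 1 $ 3 * q = 0 \<and>
      A $ 1 $ 2 * p + A $ 2 $ 3 * q = 0 \<and> A $ 1 $ 3 * p + (A $ 3 $ 3 - x) * q = 0"
    using power_traces_shift[OF sym t] by (intro singular_double_kernel) auto
  then obtain p q where pq: "p \<noteq> 0 \<or> q \<noteq> 0" "(A $ 1 $ 1 - x) * p + A $ 1 $ 3 * q = 0"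
      "A $ 1 $ 2 * p + A $ 2 $ 3 * q = 0" "A $ 1 $ 3 * p + (A $ 3 $ 3 - x) * q = 0" by blast
  let ?v = "vector [p, 0, q] :: real ^ 3"
  have "A *v ?v = x *\<^sub>R ?v"
    using pq unfolding mult_vec_3 by (simp add: sym3[OF sym] algebra_simps)
  moreover have "?v \<noteq> 0"
    using pq(1) by (auto simp: vec_eq_iff forall_3)
  ultimately have "?v $ 2 \<noteq> 0" using gen unfolding generic_block_def by blast
  then show False by simp
qed

definition embed_block :: "real ^ 3 \<Rightarrow> real ^ 8" where
  "embed_block v = (\<chi> i. if i = 1 then v $ 1 else if i = 2 then v $ 2 else if i = 3 then v $ 3 else 0)"

lemma embed_block_nth [simp]:
  "embed_block v $ 1 = v $ 1" "embed_block v $ 2 = v $ 2" "embed_block v $ 3 = v $ 3"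
  "embed_block v $ 4 = 0" "embed_block v $ 5 = 0" "embed_block v $ 6 = 0" "embed_block v $ 7 = 0"
  "embed_block v $ 8 = 0"
  by (simp_all add: embed_block_def)

definition block_part :: "real ^ 8 \<Rightarrow> real ^ 3" where
  "block_part x = vector [x $ 1, x $ 2, x $ 3]"

lemma block_part_nth [simp]:
  "block_part x $ 1 = x $ 1" "block_part x $ 2 = x $ 2" "block_part x $ 3 = x $ 3"
  by (simp_all add: block_part_def)

lemma block_form_embed: "block_form A m1 m2 l (embed_block v) = embed_block (A *v v)"
  by (simp add: vec_eq_iff forall_8 block_form_nth matrix_vector_mult_def sum_3)

lemma block_part_eigen:
  assumes "block_form A m1 m2 l x = c *\<^sub>R x"
  shows "A *v block_part x = c *\<^sub>R block_part x"
  using assms unfolding mult_vec_3 by (simp add: vec_eq_iff forall_8 block_form_nth)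

text \<open>The eigenspace of \<open>l\<close> is a Cartan subalgebra \<open>span {y, x\<^sub>8}\<close>; a unitary moving \<open>x\<^sub>8\<close> moves it
  to another element with spectrum proportional to \<open>(1, 1, -2)\<close>. The image of an eigenvector for
  \<open>m1\<close> must commute with that element, which forces it to be parallel to \<open>y\<close>.\<close>

lemma axis_8_fixed_of_power_traces:
  fixes A :: "real ^ 3 ^ 3"
  assumes S: "unitary S" and sym: "transpose A = A" and gen: "generic_block A"
    and comm: "\<And>x. block_form A m1 m2 l (Ad S x) = Ad S (block_form A m1 m2 l x)" and m: "m1 \<noteq> m2"
    and t: "trace A = m1 + m2 + l" "trace (A ** A) = m1 * m1 + m2 * m2 + l * l"
      "trace (A ** (A ** A)) = m1 * (m1 * m1) + m2 * (m2 * m2) + l * (l * l)"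
  shows "Ad S (axis 8 1) = axis 8 1"
proof (rule ccontr)
  assume moved: "Ad S (axis 8 1) \<noteq> axis 8 1"
  \<comment> \<open>By the trace equalities m1, m2 and l are the eigenvalues of \<open>A\<close>, so
    genericity separates \<open>l\<close> from the other two.\<close>
  have lm1: "m1 \<noteq> l" by (rule generic_block_distinct[OF sym gen, of l m1 m2]) (use t in simp_all)
  have lm2: "m2 \<noteq> l" by (rule generic_block_distinct[OF sym gen, of l m2 m1]) (use t in simp_all)
  define y where "y = Ad S (axis 8 1)"
  have "block_form A m1 m2 l (axis 8 1) = l *\<^sub>R axis 8 1"
    by (simp add: vec_eq_iff forall_8 block_form_nth axis_def)
  then have Ky: "block_form A m1 m2 l y = l *\<^sub>R y"
    unfolding y_def comm by (simp add: linear_scale[OF linear_Ad])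
  then have y0: "y $ 4 = 0" "y $ 5 = 0" "y $ 6 = 0" "y $ 7 = 0"
    using lm1 lm2 by (auto simp: vec_eq_iff forall_8 block_form_nth)
  have s3: "complex_of_real (sqrt 3) * complex_of_real (sqrt 3) = 3"
    by (simp flip: of_real_mult)
  let ?T = "adjoint_matrix_of y" and ?t = "tgen 8"
  \<comment> \<open>t_8 is diag(s, s, -2s), so it satisfies t^2 + s t = 2 s^2, and every unitary
    conjugate inherits this equation.\<close>
  define s where "s = 1 / (2 * sqrt 3)"
  have T: "?T = S ** ?t ** dagger S"
    unfolding y_def adjoint_matrix_of_Ad[OF S] adjoint_matrix_of_axis ..
  have "?t ** ?t + s *\<^sub>R ?t = mat (complex_of_real (2 * s\<^sup>2))"
    by (simp add: vec_eq_iff forall_3 tgen_def gell_mann_simps matrix_matrix_mult_def sum_3 mat_def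
        s_def scaleR_conv_of_real[where 'a = complex] field_simps power2_eq_square s3)
  moreover have "S ** (?t ** ?t + s *\<^sub>R ?t) ** dagger S = ?T ** ?T + s *\<^sub>R ?T"
  proof -
    have "?T ** ?T = S ** (?t ** ?t) ** dagger S"
      unfolding T unitary_conj_mult[OF S] ..
    then show ?thesis
      by (simp add: T matrix_add_rdistrib matrix_add_ldistrib matrix_scaleR_mult)
  qed
  moreover have "S ** mat (complex_of_real (2 * s\<^sup>2)) ** dagger S = mat (complex_of_real (2 * s\<^sup>2))"
  proof -
    have c: "mat (complex_of_real (2 * s\<^sup>2)) = cscale (complex_of_real (2 * s\<^sup>2)) (mat 1)"
      by (simp add: vec_eq_iff mat_def cscale_def)
    show ?thesis unfolding c cscale_conj matrix_mul_rid using S by (simp only: unitary_def)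
  qed
  ultimately have quad: "(?T ** ?T + s *\<^sub>R ?T) $ i $ j = mat (complex_of_real (2 * s\<^sup>2)) $ i $ j" for i j
    by simp
  have y8: "y $ 8 / sqrt 3 = 2 * s * y $ 8" by (simp add: s_def)
  have spos: "s > 0" by (simp add: s_def)
  \<comment> \<open>With y_4, ..., y_7 zero, the lower right entry -2 s y_8 is itself a root of the
    quadratic, that is s or -2s. Hence y_8 is -1/2 or 1.\<close>
  have q33: "(2 * s * y $ 8)\<^sup>2 - s * (2 * s * y $ 8) = 2 * s\<^sup>2"
  proof -
    have "complex_of_real ((2 * s * y $ 8)\<^sup>2 - s * (2 * s * y $ 8)) = complex_of_real (2 * s\<^sup>2)"
      using quad[of 3 3]
      by (simp add: adjoint_matrix_of_explicit y0 y8 matrix_matrix_mult_def sum_3 mat_def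
          scaleR_conv_of_real[where 'a = complex] power2_eq_square del: of_real_divide)
    then show ?thesis by (simp only: of_real_eq_iff)
  qed
  have "s\<^sup>2 * ((y $ 8 - 1) * (2 * y $ 8 + 1)) = 0" using q33 by algebra
  then have y8': "y $ 8 = 1 \<or> y $ 8 = - 1 / 2" using spos by auto
  have "y \<bullet> y = 1"
    unfolding y_def Ad_inner[OF S] by (simp add: inner_axis_axis)
  then have nrm: "(y $ 1)\<^sup>2 + (y $ 2)\<^sup>2 + (y $ 3)\<^sup>2 + (y $ 8)\<^sup>2 = 1"
    by (simp add: inner_vec_def sum_8 y0 power2_eq_square)
  have "y $ 8 \<noteq> 1"
  proof
    assume "y $ 8 = 1"
    then have "y $ 1 = 0" "y $ 2 = 0" "y $ 3 = 0"
      using nrm zero_le_power2[of "y $ 1"] zero_le_power2[of "y $ 2"] zero_le_power2[of "y $ 3"]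
      by (auto simp: add_nonneg_eq_0_iff)
    then have "y = axis 8 1"
      using y0 \<open>y $ 8 = 1\<close> by (simp add: vec_eq_iff forall_8 axis_def)
    then show False using moved by (simp add: y_def)
  qed
  then have "block_part y \<noteq> 0"
    using y8' nrm by (auto simp: vec_eq_iff forall_3 power2_eq_square)
  then have y2: "y $ 2 \<noteq> 0"
    using gen block_part_eigen[OF Ky] unfolding generic_block_def by (metis block_part_nth(2))
  \<comment> \<open>\<open>m1\<close> is an eigenvalue of \<open>A\<close> as well. Its eigenvector
    lives on the first three axes and so commutes with t_8; conjugation by \<open>S\<close>
    preserves this commutation.\<close>
  obtain v where v: "v \<noteq> 0" "A *v v = m1 *\<^sub>R v"
    using eigenvector_of_power_traces[OF sym t] by blast
  define z where "z = Ad S (embed_block v)"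
  have "block_form A m1 m2 l (embed_block v) = m1 *\<^sub>R embed_block v"
    unfolding block_form_embed v by (simp add: vec_eq_iff forall_8)
  then have Kz: "block_form A m1 m2 l z = m1 *\<^sub>R z"
    unfolding z_def comm by (simp add: linear_scale[OF linear_Ad])
  then have z0: "z $ 5 = 0" "z $ 7 = 0" "z $ 8 = 0"
    using m lm1 by (auto simp: vec_eq_iff forall_8 block_form_nth)
  have "?t ** adjoint_matrix_of (embed_block v) = adjoint_matrix_of (embed_block v) ** ?t"
    by (simp add: vec_eq_iff forall_3 adjoint_matrix_of_explicit matrix_matrix_mult_def sum_3
        tgen_def gell_mann_simps scaleR_conv_of_real[where 'a = complex])
  then have "?T ** adjoint_matrix_of z = adjoint_matrix_of z ** ?T"
    unfolding T z_def adjoint_matrix_of_Ad[OF S] unitary_conj_mult[OF S, symmetric] by simp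
  then have cm: "(?T ** adjoint_matrix_of z) $ i $ j = (adjoint_matrix_of z ** ?T) $ i $ j" for i j
    by simp
  \<comment> \<open>With z_5 = z_7 = 0 the only imaginary contribution to this entry of the
    commutator is the product of y_2 and z_6.\<close>
  have c13: "y $ 2 * z $ 6 = 0"
    using arg_cong[OF cm[of 1 3], of Im]
    by (simp add: adjoint_matrix_of_explicit y0 z0 matrix_matrix_mult_def sum_3)
  have c23: "y $ 2 * z $ 4 = 0"
    using arg_cong[OF cm[of 2 3], of Im]
    by (simp add: adjoint_matrix_of_explicit y0 z0 matrix_matrix_mult_def sum_3)
  have c46: "z $ 4 = 0" "z $ 6 = 0" using c13 c23 y2 by auto
  have c11: "y $ 1 * z $ 2 = y $ 2 * z $ 1"
    using arg_cong[OF cm[of 1 1], of Im]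
    by (simp add: adjoint_matrix_of_explicit y0 z0 c46 matrix_matrix_mult_def sum_3 field_simps)
  have c12: "y $ 2 * z $ 3 = y $ 3 * z $ 2"
    using arg_cong[OF cm[of 1 2], of Im]
    by (simp add: adjoint_matrix_of_explicit y0 z0 c46 matrix_matrix_mult_def sum_3 field_simps)
  define c where "c = z $ 2 / y $ 2"
  have zc: "block_part z = c *\<^sub>R block_part y"
    using y2 c11 c12 by (simp add: c_def vec_eq_iff forall_3 field_simps)
  have "m1 *\<^sub>R block_part z = l *\<^sub>R block_part z"
    using block_part_eigen[OF Kz] block_part_eigen[OF Ky] unfolding zc
    by (auto simp: matrix_vector_mult_scaleR)
  then have "block_part z = 0" using lm1 by simp
  then have "z = 0" using z0 c46 by (simp add: vec_eq_iff forall_8 forall_3)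
  then have "embed_block v = 0"
    using Ad_dagger_Ad[OF S, of "embed_block v"] by (simp add: z_def[symmetric] linear_0[OF linear_Ad])
  then show False using v(1) by (simp add: vec_eq_iff forall_8 forall_3)
qed

section \<open>Global phases and real 2 x 2 blocks\<close>

lemma cscale_cscale: "cscale c (cscale d A) = cscale (c * d) A"
  by (simp add: cscale_def vec_eq_iff mult.assoc)

lemma cscale_1 [simp]: "cscale 1 A = A"
  by (simp add: cscale_def vec_eq_iff)

lemma cscale_mult_left: "cscale c A ** B = cscale c (A ** B)"
  by (simp add: cscale_def vec_eq_iff matrix_matrix_mult_def sum_distrib_left mult.assoc)

lemma cscale_mult_right: "A ** cscale c B = cscale c (A ** B)"
  by (simp add: cscale_def vec_eq_iff matrix_matrix_mult_def sum_distrib_left mult.left_commute)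

lemma dagger_cscale: "dagger (cscale c A) = cscale (cnj c) (dagger A)"
  by (simp add: cscale_def vec_eq_iff dagger_def cnj_mat_def transpose_def)

lemma cmod_1_mult_cnj:
  assumes "cmod z = 1"
  shows "z * cnj z = 1" "cnj z * z = 1"
  using assms by (simp_all add: complex_norm_square[symmetric] mult.commute[of "cnj z"])

lemma unitary_cscale:
  fixes S :: "complex ^ 3 ^ 3"
  assumes "cmod z = 1"
  shows "unitary (cscale z S) \<longleftrightarrow> unitary S"
  by (simp add: unitary_def dagger_cscale cscale_mult_left cscale_mult_right cscale_cscale
      cmod_1_mult_cnj[OF assms])

lemma Ad_cscale:
  assumes "cmod z = 1"
  shows "Ad (cscale z S) x = Ad S x"
  by (simp add: Ad_def dagger_cscale cscale_mult_left cscale_mult_right cscale_cscale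
      cmod_1_mult_cnj[OF assms])

text \<open>The freedom of a global phase is spent on making the lower right entry 1. The canonical
  CP4 matrix, its square and the real reflections all have this shape.\<close>

definition real_block :: "real \<Rightarrow> real \<Rightarrow> real \<Rightarrow> real \<Rightarrow> complex ^ 3 ^ 3" where
  "real_block a b c d = vector [vector [of_real a, of_real b, 0], vector [of_real c, of_real d, 0], vector [0, 0, 1]]"

lemma real_block_nth [simp]:
  "real_block a b c d $ 1 $ 1 = of_real a" "real_block a b c d $ 1 $ 2 = of_real b" "real_block a b c d $ 1 $ 3 = 0"
  "real_block a b c d $ 2 $ 1 = of_real c" "real_block a b c d $ 2 $ 2 = of_real d" "real_block a b c d $ 2 $ 3 = 0"
  "real_block a b c d $ 3 $ 1 = 0" "real_block a b c d $ 3 $ 2 = 0" "real_block a b c d $ 3 $ 3 = 1"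
  by (simp_all add: real_block_def)

lemma real_block_eq_iff:
  "real_block a b c d = real_block a' b' c' d' \<longleftrightarrow> a = a' \<and> b = b' \<and> c = c' \<and> d = d'"
  by (auto simp: vec_eq_iff forall_3)

lemma mat_1_eq_real_block: "mat 1 = real_block 1 0 0 1"
  by (simp add: vec_eq_iff forall_3 mat_def)

lemma real_block_mult:
  "real_block a b c d ** real_block a' b' c' d'
    = real_block (a * a' + b * c') (a * b' + b * d') (c * a' + d * c') (c * b' + d * d')"
  by (simp add: vec_eq_iff forall_3 matrix_matrix_mult_def sum_3)

lemma dagger_real_block: "dagger (real_block a b c d) = real_block a c b d"
  by (simp add: vec_eq_iff forall_3 dagger_def cnj_mat_def transpose_def)

lemma cnj_mat_real_block: "cnj_mat (real_block a b c d) = real_block a b c d"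
  by (simp add: vec_eq_iff forall_3 cnj_mat_def)

lemma X_cp4_eq_real_block: "X_cp4 = real_block 0 1 (- 1) 0"
  by (simp add: vec_eq_iff forall_3 X_cp4_def)

lemma unitary_real_block:
  "unitary (real_block a b c d) \<longleftrightarrow> a * a + c * c = 1 \<and> a * b + c * d = 0 \<and> b * b + d * d = 1
    \<and> a * a + b * b = 1 \<and> a * c + b * d = 0 \<and> c * c + d * d = 1"
  unfolding unitary_def dagger_real_block real_block_mult mat_1_eq_real_block real_block_eq_iff
  by (auto simp: mult.commute)

lemma block_diagonal_of_commute:
  fixes A :: "real ^ 3 ^ 3"
  assumes S: "unitary S" and sym: "transpose A = A" and gen: "generic_block A"
    and comm: "\<And>x. block_form A m1 m2 l (Ad S x) = Ad S (block_form A m1 m2 l x)" and m: "m1 \<noteq> m2"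
  shows "S $ 1 $ 3 = 0 \<and> S $ 2 $ 3 = 0 \<and> S $ 3 $ 1 = 0 \<and> S $ 3 $ 2 = 0"
proof -
  have comm2: "block_form (A ** A) (m1 * m1) (m2 * m2) (l * l) (Ad S x)
      = Ad S (block_form (A ** A) (m1 * m1) (m2 * m2) (l * l) x)" for x
    unfolding block_form_block_form[symmetric] comm ..
  have comm3: "block_form (A ** (A ** A)) (m1 * (m1 * m1)) (m2 * (m2 * m2)) (l * (l * l)) (Ad S x)
      = Ad S (block_form (A ** (A ** A)) (m1 * (m1 * m1)) (m2 * (m2 * m2)) (l * (l * l)) x)" for x
    unfolding block_form_block_form[symmetric] comm ..
  have sym2: "transpose (A ** A) = A ** A" "transpose (A ** (A ** A)) = A ** (A ** A)"
    by (simp_all add: matrix_transpose_mul sym matrix_mul_assoc)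
  \<comment> \<open>Three power sums suffice because \<open>A\<close> is 3 x 3: if all three agree,
    they fix its spectrum.\<close>
  consider "trace A \<noteq> m1 + m2 + l" | "trace (A ** A) \<noteq> m1 * m1 + m2 * m2 + l * l"
    | "trace (A ** (A ** A)) \<noteq> m1 * (m1 * m1) + m2 * (m2 * m2) + l * (l * l)"
    | "trace A = m1 + m2 + l" "trace (A ** A) = m1 * m1 + m2 * m2 + l * l"
      "trace (A ** (A ** A)) = m1 * (m1 * m1) + m2 * (m2 * m2) + l * (l * l)" by blast
  then show ?thesis
  proof cases
    case 1
    then show ?thesis using block_diagonal_of_trace[OF S sym comm] by blast
  next
    case 2
    then show ?thesis using block_diagonal_of_trace[OF S sym2(1) comm2] by blast
  next
    case 3
    then show ?thesis using block_diagonal_of_trace[OF S sym2(2) comm3] by blast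
  next
    case 4
    then have "Ad S (axis 8 1) = axis 8 1"
      using axis_8_fixed_of_power_traces[OF S sym gen comm m] by blast
    then have "S ** tgen 8 = tgen 8 ** S"
      unfolding Ad_eq_iff[OF S] adjoint_matrix_of_axis .
    then have c: "(S ** tgen 8) $ i $ j = (tgen 8 ** S) $ i $ j" for i j by simp
    show ?thesis
      using c[of 1 3] c[of 2 3] c[of 3 1] c[of 3 2]
      by (simp add: tgen_def gell_mann_simps matrix_matrix_mult_def sum_3
          scaleR_conv_of_real[where 'a = complex] field_simps)
  qed
qed

text \<open>For block diagonal \<open>S\<close> the third column of S t_k S^dagger, with k = 4 or 6,
  is up to a factor 1/2 a column of \<open>S\<close> times the conjugate of its lower right entry.
  Its imaginary parts are x_5 and x_7, which vanish on eigenvectors for \<open>m1\<close>.\<close>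

lemma real_block_of_block_diagonal:
  fixes A :: "real ^ 3 ^ 3"
  assumes S: "unitary S" and m: "m1 \<noteq> m2"
    and comm: "\<And>x. block_form A m1 m2 l (Ad S x) = Ad S (block_form A m1 m2 l x)"
    and S0: "S $ 1 $ 3 = 0 \<and> S $ 2 $ 3 = 0 \<and> S $ 3 $ 1 = 0 \<and> S $ 3 $ 2 = 0"
  obtains z a b c d where "cmod z = 1" "S = cscale z (real_block a b c d)"
proof -
  define z where "z = S $ 3 $ 3"
  have zz: "z * cnj z = 1"
    using S S0 by (simp add: z_def unitary_def vec_eq_iff forall_3 matrix_matrix_mult_def dagger_def
        cnj_mat_def transpose_def sum_3 mat_def)
  have nz: "cmod z = 1"
  proof -
    have "(cmod z)\<^sup>2 = 1"
      using zz by (metis complex_norm_square of_real_eq_1_iff)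
    then show ?thesis by (simp add: power2_eq_1_iff) (smt (verit) norm_ge_zero)
  qed
  have col: "S $ 1 $ i = z * of_real (Ad S (axis k 1) $ 4) \<and> S $ 2 $ i = z * of_real (Ad S (axis k 1) $ 6)"
    if k: "k = 4 \<and> i = 1 \<or> k = 6 \<and> i = 2" for i k
  proof -
    let ?y = "Ad S (axis k 1)"
    have "block_form A m1 m2 l (axis k 1) = m1 *\<^sub>R axis k 1"
      using k by (auto simp: vec_eq_iff forall_8 block_form_nth axis_def)
    then have "block_form A m1 m2 l ?y = m1 *\<^sub>R ?y"
      unfolding comm by (simp add: linear_scale[OF linear_Ad])
    then have y0: "?y $ 5 = 0" "?y $ 7 = 0"
      using m by (auto simp: vec_eq_iff forall_8 block_form_nth)
    have e: "adjoint_matrix_of ?y $ r $ 3 = (S ** tgen k ** dagger S) $ r $ 3" for r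
      unfolding adjoint_matrix_of_Ad[OF S] adjoint_matrix_of_axis ..
    have "of_real (?y $ 4) = S $ 1 $ i * cnj z" "of_real (?y $ 6) = S $ 2 $ i * cnj z"
      using e[of 1] e[of 2] k
      by (auto simp: adjoint_matrix_of_explicit y0 matrix_matrix_mult_def sum_3 dagger_def cnj_mat_def
          transpose_def tgen_def gell_mann_simps S0 z_def scaleR_conv_of_real[where 'a = complex])
    then show ?thesis using zz by (simp add: mult_ac)
  qed
  have "S = cscale z (real_block (Ad S (axis 4 1) $ 4) (Ad S (axis 6 1) $ 4) (Ad S (axis 4 1) $ 6) (Ad S (axis 6 1) $ 6))"
    using S0 col[of 4 1] col[of 6 2]
    by (simp add: vec_eq_iff forall_3 cscale_def real_block_def z_def)
  with nz that show ?thesis by blast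
qed

text \<open>On the first three coordinates a real rotation by theta acts as the rotation by 2 theta
  about the second axis, and a reflection as the half-turn about (b, 0, a). A map commuting with
  such a rotation preserves its axis, unless the rotation is trivial.\<close>

lemma real_block_trivial:
  fixes A :: "real ^ 3 ^ 3"
  assumes S: "unitary (real_block a b c d)" and sym: "transpose A = A" and gen: "generic_block A"
    and comm: "\<And>x. block_form A m1 m2 l (Ad (real_block a b c d) x) = Ad (real_block a b c d) (block_form A m1 m2 l x)"
  shows "b = 0 \<and> c = 0 \<and> a = d \<and> (a = 1 \<or> a = - 1)"
proof -
  let ?S = "real_block a b c d"
  have o: "a\<^sup>2 + c\<^sup>2 = 1" "b\<^sup>2 + d\<^sup>2 = 1" "a * b + c * d = 0"
    using S unfolding unitary_real_block by (simp_all add: power2_eq_square)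
  have "(a * d - b * c)\<^sup>2 = 1" using o by algebra
  then consider "a * d - b * c = 1" | "a * d - b * c = - 1" by (auto simp: power2_eq_1_iff)
  then show ?thesis
  proof cases
    case 1
    have da: "d = a" "c = - b" using o 1 by algebra+
    \<comment> \<open>t_2 generates the real rotations of the first two doublets and is therefore
      fixed; by commutation its image under the block form is fixed as well.\<close>
    let ?e = "axis 2 1 :: real ^ 8"
    let ?y = "block_form A m1 m2 l ?e"
    have "Ad ?S ?e = ?e"
      unfolding Ad_eq_iff[OF S] adjoint_matrix_of_axis
      by (simp add: vec_eq_iff forall_3 real_block_def da matrix_matrix_mult_def sum_3 tgen_def
          gell_mann_simps scaleR_conv_of_real[where 'a = complex])
    then have "Ad ?S ?y = ?y" by (metis comm)
    then have "?S ** adjoint_matrix_of ?y = adjoint_matrix_of ?y ** ?S"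
      unfolding Ad_eq_iff[OF S] .
    then have e: "(?S ** adjoint_matrix_of ?y) $ i $ j = (adjoint_matrix_of ?y ** ?S) $ i $ j" for i j by simp
    have y: "?y $ 1 = A $ 1 $ 2" "?y $ 2 = A $ 2 $ 2" "?y $ 3 = A $ 2 $ 3" "?y $ 8 = 0"
      by (simp_all add: block_form_nth axis_def sym3[OF sym])
    have "b * A $ 1 $ 2 = 0"
      using arg_cong[OF e[of 1 1], of Re]
      by (simp add: adjoint_matrix_of_explicit y matrix_matrix_mult_def sum_3 real_block_def da field_simps)
    moreover have "b * A $ 2 $ 3 = 0"
      using arg_cong[OF e[of 1 2], of Re]
      by (simp add: adjoint_matrix_of_explicit y matrix_matrix_mult_def sum_3 real_block_def da field_simps)
    moreover have "A $ 1 $ 2 \<noteq> 0 \<or> A $ 2 $ 3 \<noteq> 0"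
    proof (rule ccontr)
      assume "\<not> ?thesis"
      then have "A *v axis 2 1 = (A $ 2 $ 2) *\<^sub>R axis 2 1"
        unfolding mult_vec_3 by (simp add: axis_def sym3[OF sym])
      moreover have "axis 2 1 \<noteq> (0 :: real ^ 3)" by (simp add: axis_eq_0_iff)
      ultimately have "(axis 2 1 :: real ^ 3) $ 1 \<noteq> 0 \<or> (axis 2 1 :: real ^ 3) $ 3 \<noteq> 0"
        using gen unfolding generic_block_def by blast
      then show False by (simp add: axis_def)
    qed
    ultimately have "b = 0" by auto
    then show ?thesis using o da by (simp add: power2_eq_1_iff)
  next
    case 2
    have da: "d = - a" "c = b" using o 2 by algebra+
    \<comment> \<open>Half the upper block of the reflection, read as an adjoint vector; it is fixed
      because the reflection commutes with itself.\<close>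
    define v :: "real ^ 3" where "v = vector [b, 0, a]"
    let ?w = "A *v v"
    have "Ad ?S (embed_block v) = embed_block v"
      unfolding Ad_eq_iff[OF S]
      by (simp add: vec_eq_iff forall_3 real_block_def da matrix_matrix_mult_def sum_3 v_def
          adjoint_matrix_of_explicit)
    then have "Ad ?S (embed_block ?w) = embed_block ?w"
      by (metis comm block_form_embed)
    then have "?S ** adjoint_matrix_of (embed_block ?w) = adjoint_matrix_of (embed_block ?w) ** ?S"
      unfolding Ad_eq_iff[OF S] .
    then have e: "(?S ** adjoint_matrix_of (embed_block ?w)) $ i $ j
        = (adjoint_matrix_of (embed_block ?w) ** ?S) $ i $ j" for i j by simp
    have b2: "b * ?w $ 2 = 0"
      using arg_cong[OF e[of 1 1], of Im]
      by (simp add: adjoint_matrix_of_explicit matrix_matrix_mult_def sum_3 real_block_def da field_simps)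
    have a2: "a * ?w $ 2 = 0"
      using arg_cong[OF e[of 1 2], of Im]
      by (simp add: adjoint_matrix_of_explicit matrix_matrix_mult_def sum_3 real_block_def da field_simps)
    have p: "a * ?w $ 1 = b * ?w $ 3"
      using arg_cong[OF e[of 1 2], of Re]
      by (simp add: adjoint_matrix_of_explicit matrix_matrix_mult_def sum_3 real_block_def da field_simps)
    have ab: "a\<^sup>2 + b\<^sup>2 = 1" using o da by simp
    have w2: "?w $ 2 = 0" using a2 b2 ab by algebra
    \<comment> \<open>The inner product of \<open>?w\<close> with the unit vector
      \<open>v\<close>.\<close>
    let ?k = "?w $ 1 * b + ?w $ 3 * a"
    have "?w = ?k *\<^sub>R v"
    proof -
      have "?w $ 1 = ?k * b" "?w $ 3 = ?k * a" using p ab by algebra+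
      then show ?thesis using w2 by (simp add: vec_eq_iff forall_3 v_def)
    qed
    moreover have "v \<noteq> 0" using ab by (auto simp: v_def vec_eq_iff forall_3)
    ultimately have "v $ 2 \<noteq> 0" using gen unfolding generic_block_def by blast
    then show ?thesis by (simp add: v_def)
  qed
qed

lemma commuting_unitary_trivial:
  fixes A :: "real ^ 3 ^ 3"
  assumes S: "unitary S" and sym: "transpose A = A" and gen: "generic_block A" and m: "m1 \<noteq> m2"
    and comm: "\<And>x. block_form A m1 m2 l (Ad S x) = Ad S (block_form A m1 m2 l x)"
  shows "\<exists>z. cmod z = 1 \<and> (S = cscale z (mat 1) \<or> S = cscale z (X_cp4 ** cnj_mat X_cp4))"
proof -
  obtain z a b c d where z: "cmod z = 1" and Sz: "S = cscale z (real_block a b c d)"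
    using real_block_of_block_diagonal[OF S m comm block_diagonal_of_commute[OF S sym gen comm m]] .
  let ?R = "real_block a b c d"
  have AdR: "Ad S x = Ad ?R x" for x unfolding Sz by (rule Ad_cscale[OF z])
  have R: "unitary ?R" using S unfolding Sz unitary_cscale[OF z] .
  have "b = 0 \<and> c = 0 \<and> a = d \<and> (a = 1 \<or> a = - 1)"
    using real_block_trivial[OF R sym gen] comm unfolding AdR by blast
  \<comment> \<open>The case a = -1 is diag(-1, -1, 1), the square of CP4.\<close>
  then have "?R = mat 1 \<or> ?R = X_cp4 ** cnj_mat X_cp4"
    by (auto simp: mat_1_eq_real_block X_cp4_eq_real_block cnj_mat_real_block real_block_mult real_block_eq_iff)
  then show ?thesis using z Sz by auto
qed

section \<open>Complex conjugation in coordinates and construction of a CP2 symmetry\<close>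

lemma conj_adj_explicit:
  "conj_adj x = (\<chi> i. if i = 2 \<or> i = 5 \<or> i = 7 then - x $ i else x $ i)"
  unfolding adjoint_matrix_of_inject[symmetric] adjoint_matrix_of_conj_adj
  by (simp add: vec_eq_iff forall_3 adjoint_matrix_of_explicit cnj_mat_def)

lemma conj_adj_nth:
  "conj_adj x $ 1 = x $ 1" "conj_adj x $ 2 = - x $ 2" "conj_adj x $ 3 = x $ 3" "conj_adj x $ 4 = x $ 4"
  "conj_adj x $ 5 = - x $ 5" "conj_adj x $ 6 = x $ 6" "conj_adj x $ 7 = - x $ 7" "conj_adj x $ 8 = x $ 8"
  by (simp_all add: conj_adj_explicit)

text \<open>The half-turn about (b, 0, a) combined with the sign change of x_2 is the reflection in
  the plane orthogonal to (a, 0, -b). The planes (x_4, x_6) and (x_5, x_7) are preserved, so both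
  eigenspaces in W_4 survive.\<close>

lemma Ad_real_reflection:
  assumes "a\<^sup>2 + b\<^sup>2 = 1"
  defines "y \<equiv> \<lambda>x. \<chi> i. if i = 1 then x $ 1 - 2 * a * (a * x $ 1 - b * x $ 3)
      else if i = 3 then x $ 3 + 2 * b * (a * x $ 1 - b * x $ 3)
      else if i = 4 then a * x $ 4 + b * x $ 6 else if i = 6 then b * x $ 4 - a * x $ 6
      else if i = 5 then - a * x $ 5 - b * x $ 7 else if i = 7 then a * x $ 7 - b * x $ 5
      else x $ i"
  shows "Ad (real_block a b b (- a)) (conj_adj x) = y x"
proof -
  have u: "unitary (real_block a b b (- a))"
    using assms(1) by (simp add: unitary_real_block power2_eq_square add.commute)
  \<comment> \<open>Oriented as an elimination of b^2, which brings both sides to one normal form;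
    the complex copy below serves the matrix entries.\<close>
  have b2: "b * (b * t) = t - a * (a * t)" for t
    using assms(1) by algebra
  have b2': "complex_of_real b * (complex_of_real b * t) = t - complex_of_real a * (complex_of_real a * t)" for t
  proof -
    have "(complex_of_real a)\<^sup>2 + (complex_of_real b)\<^sup>2 = 1"
      using assms(1) by (metis of_real_1 of_real_add of_real_power)
    then show ?thesis by algebra
  qed
  show ?thesis
    unfolding Ad_eq_iff[OF u]
    by (simp add: vec_eq_iff forall_3 adjoint_matrix_of_explicit conj_adj_nth real_block_def y_def
        matrix_matrix_mult_def sum_3 field_simps b2 b2')
qed

text \<open>The CP2 is chosen to act on the first three coordinates as the reflection along the
  given eigenvector, which commutes with \<open>A\<close> by symmetry. That it fixes the eighth axis
  will make \<open>M\<close> and \<open>L\<close> invariant.\<close>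

lemma exists_cp2_of_not_generic:
  fixes A :: "real ^ 3 ^ 3"
  assumes sym: "transpose A = A" and ngen: "\<not> generic_block A"
  obtains Y where "unitary Y" "Y ** cnj_mat Y = mat 1"
    "\<And>x. block_form A m1 m2 l (Ad Y (conj_adj x)) = Ad Y (conj_adj (block_form A m1 m2 l x))"
    "Ad Y (conj_adj (axis 8 1)) = axis 8 1"
proof -
  obtain y c where y: "y \<noteq> 0" "A *v y = c *\<^sub>R y" and cases: "y $ 2 = 0 \<or> y $ 1 = 0 \<and> y $ 3 = 0"
    using ngen unfolding generic_block_def by blast
  note e = y(2)[unfolded mult_vec_3]
  show ?thesis
  proof (cases "y $ 2 = 0")
    case False
    then have "y $ 1 = 0" "y $ 3 = 0" using cases by auto
    then have "A $ 1 $ 2 = 0" "A $ 2 $ 3 = 0" using e False by (auto simp: sym3[OF sym])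
    then have "block_form A m1 m2 l (conj_adj x) = conj_adj (block_form A m1 m2 l x)" for x
      by (simp add: vec_eq_iff forall_8 block_form_nth conj_adj_nth sym3[OF sym])
    moreover have "conj_adj (axis 8 1) = axis 8 1"
      by (simp add: vec_eq_iff forall_8 conj_adj_nth axis_def)
    ultimately show ?thesis
      by (intro that[of "mat 1"]) (simp_all add: unitary_def)
  next
    case True
    define r where "r = sqrt ((y $ 1)\<^sup>2 + (y $ 3)\<^sup>2)"
    have "y $ 1 \<noteq> 0 \<or> y $ 3 \<noteq> 0" using y(1) True by (auto simp: vec_eq_iff forall_3)
    then have r2: "r\<^sup>2 = (y $ 1)\<^sup>2 + (y $ 3)\<^sup>2" and r0: "r \<noteq> 0"
      unfolding r_def by (auto simp: sum_power2_eq_zero_iff)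
    \<comment> \<open>The sign of \<open>b\<close> makes (a, 0, -b), the normal of the reflecting
      plane, equal to the normalized eigenvector.\<close>
    define a b where "a = y $ 1 / r" and "b = - y $ 3 / r"
    have "a\<^sup>2 + b\<^sup>2 = ((y $ 1)\<^sup>2 + (y $ 3)\<^sup>2) / r\<^sup>2"
      by (simp add: a_def b_def power_divide add_divide_distrib)
    then have ab: "a\<^sup>2 + b\<^sup>2 = 1" using r0 by (simp add: r2[symmetric])
    have ev: "A $ 1 $ 1 * a - A $ 1 $ 3 * b = c * a" "A $ 1 $ 2 * a = A $ 2 $ 3 * b"
        "A $ 1 $ 3 * a - A $ 3 $ 3 * b = - c * b"
      using e True r0 by (simp_all add: sym3[OF sym] a_def b_def field_simps)
    let ?Y = "real_block a b b (- a)"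
    note refl = Ad_real_reflection[OF ab]
    have "block_form A m1 m2 l (Ad ?Y (conj_adj x)) = Ad ?Y (conj_adj (block_form A m1 m2 l x))" for x
    proof -
      define p q where "p = x $ 1" and "q = x $ 3"
      \<comment> \<open>Component of \<open>x\<close> along the normal; \<open>A\<close> multiplies
        it by \<open>c\<close>, since the normal is an eigenvector of a symmetric matrix.\<close>
      define n where "n = a * p - b * q"
      have n: "a * (A $ 1 $ 1 * p + A $ 1 $ 2 * x $ 2 + A $ 1 $ 3 * q)
          - b * (A $ 1 $ 3 * p + A $ 2 $ 3 * x $ 2 + A $ 3 $ 3 * q) = c * n"
        using ev unfolding n_def by algebra
      have "A $ 1 $ 1 * (p - 2 * a * n) + A $ 1 $ 2 * x $ 2 + A $ 1 $ 3 * (q + 2 * b * n)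
          = A $ 1 $ 1 * p + A $ 1 $ 2 * x $ 2 + A $ 1 $ 3 * q - 2 * a * (c * n)"
        using ev by algebra
      moreover have "A $ 1 $ 2 * (p - 2 * a * n) + A $ 2 $ 2 * x $ 2 + A $ 2 $ 3 * (q + 2 * b * n)
          = A $ 1 $ 2 * p + A $ 2 $ 2 * x $ 2 + A $ 2 $ 3 * q"
        using ev by algebra
      moreover have "A $ 1 $ 3 * (p - 2 * a * n) + A $ 2 $ 3 * x $ 2 + A $ 3 $ 3 * (q + 2 * b * n)
          = A $ 1 $ 3 * p + A $ 2 $ 3 * x $ 2 + A $ 3 $ 3 * q + 2 * b * (c * n)"
        using ev by algebra
      ultimately show ?thesis
        unfolding refl
        by (simp add: vec_eq_iff forall_8 block_form_nth sym3[OF sym] p_def[symmetric] q_def[symmetric] n_def[symmetric] n)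
          (simp add: algebra_simps)
    qed
    moreover have "Ad ?Y (conj_adj (axis 8 1)) = axis 8 1"
      unfolding refl by (simp add: vec_eq_iff forall_8 axis_def)
    moreover have "unitary ?Y" "?Y ** cnj_mat ?Y = mat 1"
      using ab by (simp_all add: unitary_real_block cnj_mat_real_block real_block_mult
          mat_1_eq_real_block real_block_eq_iff power2_eq_square add.commute)
    ultimately show ?thesis using that by blast
  qed
qed

section \<open>Quadruples in coordinate planes\<close>

definition coord_plane :: "8 \<Rightarrow> 8 \<Rightarrow> (real ^ 8) set" where
  "coord_plane j k = {x. \<forall>i. i \<noteq> j \<longrightarrow> i \<noteq> k \<longrightarrow> x $ i = 0}"

lemma coord_plane_expand:
  assumes "x \<in> coord_plane j k" "j \<noteq> k"
  shows "x = (x $ j) *\<^sub>R axis j 1 + (x $ k) *\<^sub>R axis k 1"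
  using assms by (auto simp: coord_plane_def vec_eq_iff axis_def)

lemma subspace_coord_plane: "subspace (coord_plane j k)"
  by (auto simp: coord_plane_def subspace_def)

lemma coord_plane_eq_span: "j \<noteq> k \<Longrightarrow> coord_plane j k = span {axis j 1, axis k 1}"
proof
  assume "j \<noteq> k"
  show "coord_plane j k \<subseteq> span {axis j 1, axis k 1}"
  proof
    fix x assume "x \<in> coord_plane j k"
    then show "x \<in> span {axis j 1, axis k 1}"
      by (subst coord_plane_expand[OF _ \<open>j \<noteq> k\<close>])
        (auto intro: span_add span_scale span_base)
  qed
  show "span {axis j 1, axis k 1} \<subseteq> coord_plane j k"
    by (rule span_minimal[OF _ subspace_coord_plane]) (auto simp: coord_plane_def axis_def)
qed

lemma dim_coord_plane:
  assumes "j \<noteq> k"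
  shows "dim (coord_plane j k) = 2"
proof -
  have "independent {axis j 1, axis k 1 :: real ^ 8}"
    by (rule independent_mono[OF independent_Basis]) (auto simp: axis_in_Basis_iff)
  moreover have "axis j 1 \<noteq> (axis k 1 :: real ^ 8)"
    using assms by (simp add: axis_eq_axis)
  ultimately show ?thesis
    unfolding coord_plane_eq_span[OF assms] by (simp add: dim_eq_card_independent)
qed

text \<open>An orthonormal pair in a plane amounts to an angle and an orientation; \<open>e\<close>
  is the determinant of the pair.\<close>

lemma orthonormal_coord_planeE:
  assumes on: "orthonormal_basis2 (coord_plane j k) x y" and "j \<noteq> k"
  obtains a b e where "a\<^sup>2 + b\<^sup>2 = 1" "e = 1 \<or> e = - 1"
    "x = a *\<^sub>R axis j 1 + b *\<^sub>R axis k 1" "y = e *\<^sub>R (a *\<^sub>R axis k 1 - b *\<^sub>R axis j 1)"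
proof -
  have mem: "x \<in> coord_plane j k" "y \<in> coord_plane j k"
    using on unfolding orthonormal_basis2_def by (auto intro: span_base)
  define a b c d where "a = x $ j" and "b = x $ k" and "c = y $ j" and "d = y $ k"
  have x: "x = a *\<^sub>R axis j 1 + b *\<^sub>R axis k 1" and y: "y = c *\<^sub>R axis j 1 + d *\<^sub>R axis k 1"
    using mem coord_plane_expand \<open>j \<noteq> k\<close> unfolding a_def b_def c_def d_def by blast+
  have ax: "axis j 1 \<bullet> axis k (1::real) = 0" "axis k 1 \<bullet> axis j (1::real) = 0"
    "axis j 1 \<bullet> axis j (1::real) = 1" "axis k 1 \<bullet> axis k (1::real) = 1"
    using \<open>j \<noteq> k\<close> by (simp_all add: inner_axis_axis)
  have "x \<bullet> x = 1" "y \<bullet> y = 1" "x \<bullet> y = 0"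
    using on by (simp_all add: orthonormal_basis2_def norm_eq_1)
  then have o: "a\<^sup>2 + b\<^sup>2 = 1" "c\<^sup>2 + d\<^sup>2 = 1" "a * c + b * d = 0"
    unfolding x y by (simp_all add: inner_add_left inner_add_right ax power2_eq_square mult.commute)
  define e where "e = a * d - b * c"
  have "e\<^sup>2 = 1" using o unfolding e_def by algebra
  moreover have "c = - e * b" "d = e * a" using o unfolding e_def by algebra+
  ultimately show ?thesis
    using that[of a b e] o x y by (auto simp: power2_eq_1_iff algebra_simps)
qed

lemma orthonormal_coord_planeI:
  assumes "j \<noteq> k" and ab: "a\<^sup>2 + b\<^sup>2 = 1" and e: "e = 1 \<or> e = - 1"
  shows "orthonormal_basis2 (coord_plane j k) (a *\<^sub>R axis j 1 + b *\<^sub>R axis k 1)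
    (e *\<^sub>R (a *\<^sub>R axis k 1 - b *\<^sub>R axis j 1))"
    (is "orthonormal_basis2 ?P ?x ?y")
proof -
  have ax: "axis j 1 \<bullet> axis k (1::real) = 0" "axis k 1 \<bullet> axis j (1::real) = 0"
    "axis j 1 \<bullet> axis j (1::real) = 1" "axis k 1 \<bullet> axis k (1::real) = 1"
    using \<open>j \<noteq> k\<close> by (simp_all add: inner_axis_axis)
  have ee: "e * e = 1" using e by auto
  have "axis j 1 = a *\<^sub>R ?x - (e * b) *\<^sub>R ?y" "axis k 1 = b *\<^sub>R ?x + (e * a) *\<^sub>R ?y"
  proof -
    have "a *\<^sub>R ?x - (e * b) *\<^sub>R ?y = (a\<^sup>2 + e * e * b\<^sup>2) *\<^sub>R axis j 1 + (a * b - e * e * (a * b)) *\<^sub>R axis k 1"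
      by (simp add: algebra_simps power2_eq_square)
    moreover have "b *\<^sub>R ?x + (e * a) *\<^sub>R ?y = (a * b - e * e * (a * b)) *\<^sub>R axis j 1 + (b\<^sup>2 + e * e * a\<^sup>2) *\<^sub>R axis k 1"
      by (simp add: algebra_simps power2_eq_square)
    ultimately show "axis j 1 = a *\<^sub>R ?x - (e * b) *\<^sub>R ?y" "axis k 1 = b *\<^sub>R ?x + (e * a) *\<^sub>R ?y"
      using ab by (simp_all add: ee add.commute)
  qed
  then have "axis j 1 \<in> span {?x, ?y}" "axis k 1 \<in> span {?x, ?y}"
    by (metis insertCI span_base span_diff span_scale, metis insertCI span_base span_add span_scale)
  then have "?P \<subseteq> span {?x, ?y}"
    unfolding coord_plane_eq_span[OF \<open>j \<noteq> k\<close>] by (intro span_minimal) auto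
  moreover have "span {?x, ?y} \<subseteq> ?P"
    by (rule span_minimal[OF _ subspace_coord_plane]) (auto simp: coord_plane_def axis_def)
  moreover have "?x \<bullet> ?x = 1" "?x \<bullet> ?y = 0"
    using ab by (simp_all add: inner_add_left inner_add_right inner_diff_right ax power2_eq_square)
  moreover have "?y \<bullet> ?y = (e * e) * (a\<^sup>2 + b\<^sup>2)"
    by (simp add: inner_diff_left inner_diff_right ax power2_eq_square algebra_simps)
  then have "?y \<bullet> ?y = 1" using ab ee by simp
  ultimately show ?thesis
    unfolding orthonormal_basis2_def norm_eq_1 by blast
qed

text \<open>W_4 is the complement of u(2) in the Cartan decomposition of su(3), so commutators of
  its elements lie in u(2), the span of axes 1, 2, 3 and 8.\<close>

lemma f_product_W4:
  assumes "x $ 1 = 0" "x $ 2 = 0" "x $ 3 = 0" "x $ 8 = 0" "y $ 1 = 0" "y $ 2 = 0" "y $ 3 = 0" "y $ 8 = 0"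
  shows "f_product x y = (\<chi> i.
    if i = 1 then (x $ 4 * y $ 7 - x $ 7 * y $ 4 - x $ 5 * y $ 6 + x $ 6 * y $ 5) / 2
    else if i = 2 then (x $ 4 * y $ 6 - x $ 6 * y $ 4 + x $ 5 * y $ 7 - x $ 7 * y $ 5) / 2
    else if i = 3 then (x $ 4 * y $ 5 - x $ 5 * y $ 4 - x $ 6 * y $ 7 + x $ 7 * y $ 6) / 2
    else if i = 8 then sqrt 3 * (x $ 4 * y $ 5 - x $ 5 * y $ 4 + x $ 6 * y $ 7 - x $ 7 * y $ 6) / 2
    else 0)"
  unfolding adjoint_matrix_of_inject[symmetric] adjoint_matrix_of_f_product
  by (simp add: vec_eq_iff forall_3 adjoint_matrix_of_explicit cscale_def matrix_matrix_mult_def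
      sum_3 assms field_simps)

text \<open>The condition on the two products forces equal orientations, and this is what cancels
  the x_8 component of w. The rest of w is the addition formula for the angles of q and p, hence a
  unit vector.\<close>

lemma quadruple_coord_planes:
  assumes "is_quadruple (coord_plane 4 6) (coord_plane 5 7) q q' p p'"
  obtains a b e where "a\<^sup>2 + b\<^sup>2 = 1" "e = 1 \<or> e = - 1" "f_product q q' = (e / 2) *\<^sub>R axis 2 1"
    "f_product q p - f_product q' p' = a *\<^sub>R axis 1 1 + b *\<^sub>R axis 3 1"
proof -
  obtain a b e where ab: "a\<^sup>2 + b\<^sup>2 = 1" and e: "e = 1 \<or> e = - 1"
    and q: "q = a *\<^sub>R axis 4 1 + b *\<^sub>R axis 6 1" "q' = e *\<^sub>R (a *\<^sub>R axis 6 1 - b *\<^sub>R axis 4 1)"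
    using assms unfolding is_quadruple_def by (auto elim!: orthonormal_coord_planeE)
  obtain c d e' where cd: "c\<^sup>2 + d\<^sup>2 = 1" and e': "e' = 1 \<or> e' = - 1"
    and p: "p = c *\<^sub>R axis 5 1 + d *\<^sub>R axis 7 1" "p' = e' *\<^sub>R (c *\<^sub>R axis 7 1 - d *\<^sub>R axis 5 1)"
    using assms unfolding is_quadruple_def by (auto elim!: orthonormal_coord_planeE)
  have k: "x * (x * t) + y * (y * t) = t" if "x\<^sup>2 + y\<^sup>2 = 1" for x y t :: real
    using that by algebra
  have u: "f_product q q' = (e / 2) *\<^sub>R axis 2 1"
    by (subst f_product_W4) (simp_all add: q axis_def vec_eq_iff forall_8 algebra_simps k[OF ab])
  have u': "f_product p p' = (e' / 2) *\<^sub>R axis 2 1"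
    by (subst f_product_W4) (simp_all add: p axis_def vec_eq_iff forall_8 algebra_simps k[OF cd])
  have "f_product q q' $ 2 = f_product p p' $ 2"
    using assms by (simp add: is_quadruple_def)
  then have "e' = e" unfolding u u' by (simp add: axis_def)
  then have ee: "e' * e = 1" using e by auto
  have "f_product q p - f_product q' p' = (a * d + b * c) *\<^sub>R axis 1 1 + (a * c - b * d) *\<^sub>R axis 3 1"
    using e e' \<open>e' = e\<close>
    by (subst f_product_W4, simp_all add: p q axis_def, subst f_product_W4)
      (auto simp: p q axis_def vec_eq_iff forall_8 field_simps)
  moreover have "(a * d + b * c)\<^sup>2 + (a * c - b * d)\<^sup>2 = 1" using ab cd by algebra
  ultimately show ?thesis using that e u by blast
qed

lemma quadruple_coord_planesI:
  assumes ab: "a\<^sup>2 + b\<^sup>2 = 1" and e: "e = 1 \<or> e = - 1"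
  obtains q q' p p' where "is_quadruple (coord_plane 4 6) (coord_plane 5 7) q q' p p'"
    "f_product q q' = (e / 2) *\<^sub>R axis 2 1"
    "f_product q p - f_product q' p' = a *\<^sub>R axis 1 1 + b *\<^sub>R axis 3 1"
proof -
  \<comment> \<open>Angle zero for q leaves the whole angle to p: the addition formula then gives
    (x_1, x_3) = (a, b) for this p. The factors 1 and 0 keep the shape of
    \<open>orthonormal_coord_planeI\<close>.\<close>
  let ?q = "1 *\<^sub>R axis 4 1 + 0 *\<^sub>R axis 6 1 :: real ^ 8" and ?q' = "e *\<^sub>R (1 *\<^sub>R axis 6 1 - 0 *\<^sub>R axis 4 1) :: real ^ 8"
  let ?p = "b *\<^sub>R axis 5 1 + a *\<^sub>R axis 7 1 :: real ^ 8" and ?p' = "e *\<^sub>R (b *\<^sub>R axis 7 1 - a *\<^sub>R axis 5 1) :: real ^ 8"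
  have ba: "b\<^sup>2 + a\<^sup>2 = 1" using ab by simp
  have on: "orthonormal_basis2 (coord_plane 4 6) ?q ?q'" "orthonormal_basis2 (coord_plane 5 7) ?p ?p'"
    by (rule orthonormal_coord_planeI[OF _ _ e]; simp add: ba)+
  have k: "a * (a * t) + b * (b * t) = t" for t
    using ab by algebra
  have u: "f_product ?q ?q' = (e / 2) *\<^sub>R axis 2 1"
    by (subst f_product_W4) (simp_all add: axis_def vec_eq_iff forall_8)
  have u': "f_product ?p ?p' = (e / 2) *\<^sub>R axis 2 1"
    by (subst f_product_W4) (simp_all add: axis_def vec_eq_iff forall_8 algebra_simps k)
  have "f_product ?q ?p - f_product ?q' ?p' = a *\<^sub>R axis 1 1 + b *\<^sub>R axis 3 1"
    using e
    by (subst f_product_W4, simp_all add: axis_def, subst f_product_W4)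
      (auto simp: axis_def vec_eq_iff forall_8 field_simps)
  with on u u' show ?thesis by (intro that[of ?q ?q' ?p ?p']) (simp_all add: is_quadruple_def)
qed

lemma u_vectors_coord_planes:
  "u_vectors (coord_plane 4 6) (coord_plane 5 7) = {(1 / 2) *\<^sub>R axis 2 1, - ((1 / 2) *\<^sub>R axis 2 1)}"
proof -
  have "\<exists>q q' p p'. is_quadruple (coord_plane 4 6) (coord_plane 5 7) q q' p p'
      \<and> f_product q q' = (e / 2) *\<^sub>R axis 2 1" if "e = 1 \<or> e = - 1" for e
    using quadruple_coord_planesI[of 1 0 e] that by (metis one_power2 power_zero_numeral add.right_neutral)
  from this[of 1] this[of "- 1"]
  have "{(1 / 2) *\<^sub>R axis 2 1, - ((1 / 2) *\<^sub>R axis 2 1)} \<subseteq> u_vectors (coord_plane 4 6) (coord_plane 5 7)"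
    unfolding u_vectors_def mem_Collect_eq insert_subset by (simp, metis)
  moreover have "u_vectors (coord_plane 4 6) (coord_plane 5 7) \<subseteq> {(1 / 2) *\<^sub>R axis 2 1, - ((1 / 2) *\<^sub>R axis 2 1)}"
    unfolding u_vectors_def by (auto elim!: quadruple_coord_planes)
  ultimately show ?thesis by blast
qed

lemma U_vectors_coord_planes:
  "U_vectors (coord_plane 4 6) (coord_plane 5 7) = {a *\<^sub>R axis 1 1 + b *\<^sub>R axis 3 1 | a b. a\<^sup>2 + b\<^sup>2 = 1}"
proof
  show "U_vectors (coord_plane 4 6) (coord_plane 5 7) \<subseteq> {a *\<^sub>R axis 1 1 + b *\<^sub>R axis 3 1 | a b. a\<^sup>2 + b\<^sup>2 = 1}"
    unfolding U_vectors_def by (auto elim!: quadruple_coord_planes)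
  show "{a *\<^sub>R axis 1 1 + b *\<^sub>R axis 3 1 | a b. a\<^sup>2 + b\<^sup>2 = 1} \<subseteq> U_vectors (coord_plane 4 6) (coord_plane 5 7)"
  proof clarify
    fix a b :: real assume ab: "a\<^sup>2 + b\<^sup>2 = 1"
    obtain q q' p p' where "is_quadruple (coord_plane 4 6) (coord_plane 5 7) q q' p p'"
      "f_product q p - f_product q' p' = a *\<^sub>R axis 1 1 + b *\<^sub>R axis 3 1"
      using quadruple_coord_planesI[OF ab, of 1] by blast
    then show "a *\<^sub>R axis 1 1 + b *\<^sub>R axis 3 1 \<in> U_vectors (coord_plane 4 6) (coord_plane 5 7)"
      unfolding U_vectors_def mem_Collect_eq by metis
  qed
qed

section \<open>Transport of quadruples under basis changes\<close>

lemma inj_Ad: "unitary S \<Longrightarrow> inj (Ad S)"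
  by (metis Ad_dagger_Ad injI)

lemma orthonormal_basis2_Ad:
  assumes "unitary S"
  shows "orthonormal_basis2 (Ad S ` E) (Ad S x) (Ad S y) \<longleftrightarrow> orthonormal_basis2 E x y"
proof -
  have "span {Ad S x, Ad S y} = Ad S ` span {x, y}"
    using linear_span_image[OF linear_Ad, of S "{x, y}"] by simp
  then show ?thesis
    using assms by (simp add: orthonormal_basis2_def norm_eq_1 Ad_inner inj_image_eq_iff[OF inj_Ad])
qed

lemma is_quadruple_Ad:
  assumes "unitary S"
  shows "is_quadruple (Ad S ` E1) (Ad S ` E2) (Ad S q) (Ad S q') (Ad S p) (Ad S p')
    \<longleftrightarrow> is_quadruple E1 E2 q q' p p'"
  using assms
  by (simp add: is_quadruple_def orthonormal_basis2_Ad f_product_Ad inj_eq[OF inj_Ad])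

lemma u_vectors_Ad:
  assumes "unitary S"
  shows "u_vectors (Ad S ` E1) (Ad S ` E2) = Ad S ` u_vectors E1 E2"
proof (rule Set.set_eqI, rule iffI)
  fix v assume "v \<in> u_vectors (Ad S ` E1) (Ad S ` E2)"
  then obtain q q' p p' where v: "v = f_product q q'" and "is_quadruple (Ad S ` E1) (Ad S ` E2) q q' p p'"
    unfolding u_vectors_def by blast
  then have "is_quadruple E1 E2 (Ad (dagger S) q) (Ad (dagger S) q') (Ad (dagger S) p) (Ad (dagger S) p')"
    using is_quadruple_Ad[OF assms, of E1 E2 "Ad (dagger S) q" "Ad (dagger S) q'" "Ad (dagger S) p" "Ad (dagger S) p'"]
    by (simp add: Ad_Ad_dagger[OF assms])
  moreover have "v = Ad S (f_product (Ad (dagger S) q) (Ad (dagger S) q'))"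
    by (simp add: v f_product_Ad[OF assms, symmetric] Ad_Ad_dagger[OF assms])
  ultimately show "v \<in> Ad S ` u_vectors E1 E2" unfolding u_vectors_def by blast
next
  fix v assume "v \<in> Ad S ` u_vectors E1 E2"
  then show "v \<in> u_vectors (Ad S ` E1) (Ad S ` E2)"
    unfolding u_vectors_def using is_quadruple_Ad[OF assms] f_product_Ad[OF assms, symmetric] by blast
qed

lemma U_vectors_Ad:
  assumes "unitary S"
  shows "U_vectors (Ad S ` E1) (Ad S ` E2) = Ad S ` U_vectors E1 E2"
proof -
  have f: "f_product (Ad S q) (Ad S p) - f_product (Ad S q') (Ad S p') = Ad S (f_product q p - f_product q' p')" for q p q' p'
    by (simp add: f_product_Ad[OF assms] linear_diff[OF linear_Ad])
  show ?thesis
  proof (rule Set.set_eqI, rule iffI)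
    fix v assume "v \<in> U_vectors (Ad S ` E1) (Ad S ` E2)"
    then obtain q q' p p' where v: "v = f_product q p - f_product q' p'"
      and "is_quadruple (Ad S ` E1) (Ad S ` E2) q q' p p'"
      unfolding U_vectors_def by blast
    then have "is_quadruple E1 E2 (Ad (dagger S) q) (Ad (dagger S) q') (Ad (dagger S) p) (Ad (dagger S) p')"
      using is_quadruple_Ad[OF assms, of E1 E2 "Ad (dagger S) q" "Ad (dagger S) q'" "Ad (dagger S) p" "Ad (dagger S) p'"]
      by (simp add: Ad_Ad_dagger[OF assms])
    moreover have "v = Ad S (f_product (Ad (dagger S) q) (Ad (dagger S) p) - f_product (Ad (dagger S) q') (Ad (dagger S) p'))"
      by (simp add: v f[symmetric] Ad_Ad_dagger[OF assms])
    ultimately show "v \<in> Ad S ` U_vectors E1 E2" unfolding U_vectors_def by blast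
  next
    fix v assume "v \<in> Ad S ` U_vectors E1 E2"
    then show "v \<in> U_vectors (Ad S ` E1) (Ad S ` E2)"
      unfolding U_vectors_def using is_quadruple_Ad[OF assms] f[symmetric] by blast
  qed
qed

section \<open>Adapted bases\<close>

lemma transpose_eq_inverse_cnj:
  assumes "unitary B"
  shows "transpose B ** cnj_mat B = mat 1" "cnj_mat B ** transpose B = mat 1"
  using assms unfolding transpose_conv cnj_mat_mult[symmetric] unitary_def by simp_all

lemma canonical_cp4_basis_conj:
  assumes "canonical_cp4_basis X B"
  shows "X = dagger B ** X_cp4 ** cnj_mat B" "B ** X = X_cp4 ** cnj_mat B"
proof -
  have B: "unitary B" and e: "B ** X ** transpose B = X_cp4"
    using assms by (simp_all add: canonical_cp4_basis_def)
  have "X_cp4 ** cnj_mat B = B ** X ** (transpose B ** cnj_mat B)"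
    unfolding e[symmetric] by (simp only: matrix_mul_assoc)
  then show 1: "B ** X = X_cp4 ** cnj_mat B"
    by (simp add: transpose_eq_inverse_cnj[OF B])
  have "dagger B ** X_cp4 ** cnj_mat B = dagger B ** B ** X"
    by (simp only: matrix_mul_assoc[symmetric] 1)
  then show "X = dagger B ** X_cp4 ** cnj_mat B" using B by (simp add: unitary_def)
qed

lemma unitary_X_cp4: "unitary X_cp4"
  by (simp add: X_cp4_eq_real_block unitary_real_block)

text \<open>Conjugation turns \<open>B\<close> into its complex conjugate, so B X = X_cp4 B^*
  intertwines the two CP actions.\<close>

lemma Ad_canonical_cp4:
  assumes "canonical_cp4_basis X B" "unitary X"
  shows "Ad B (Ad X (conj_adj x)) = Ad X_cp4 (conj_adj (Ad B x))"
proof -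
  have B: "unitary B" using assms by (simp add: canonical_cp4_basis_def)
  show ?thesis
    using canonical_cp4_basis_conj(2)[OF assms(1)]
    by (simp add: conj_adj_Ad[OF B] Ad_mult[symmetric] B assms(2) unitary_X_cp4 unitary_cnj_mat)
qed

lemma Ad_X_cp4:
  "Ad X_cp4 (conj_adj x) = (\<chi> i. if i = 4 then x $ 6 else if i = 5 then - x $ 7 else if i = 6 then - x $ 4
    else if i = 7 then x $ 5 else if i = 8 then x $ 8 else - x $ i)"
  unfolding Ad_eq_iff[OF unitary_X_cp4]
  by (simp add: vec_eq_iff forall_3 adjoint_matrix_of_explicit conj_adj_nth X_cp4_eq_real_block
      matrix_matrix_mult_def sum_3 field_simps)

lemma W4_iff:
  assumes "unitary B"
  shows "x \<in> W4 B \<longleftrightarrow> Ad B x $ 1 = 0 \<and> Ad B x $ 2 = 0 \<and> Ad B x $ 3 = 0 \<and> Ad B x $ 8 = 0"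
proof -
  have "x \<in> W4 B \<longleftrightarrow> (\<forall>i. i \<notin> {4, 5, 6, 7} \<longrightarrow> Ad B x $ i = 0)"
    unfolding W4_def adjoint_matrix_of_Ad[OF assms, symmetric] adjoint_matrix_of_inject by simp
  then show ?thesis by (simp add: forall_8)
qed

text \<open>For a unit vector (alpha, beta) this is the element of SU(2) that carries it to (1, 0),
  extended by 1 on the third doublet.\<close>

definition su2_block :: "complex \<Rightarrow> complex \<Rightarrow> complex ^ 3 ^ 3" where
  "su2_block \<alpha> \<beta> = vector [vector [cnj \<alpha>, cnj \<beta>, 0], vector [- \<beta>, \<alpha>, 0], vector [0, 0, 1]]"

lemma su2_block_nth [simp]:
  "su2_block \<alpha> \<beta> $ 1 $ 1 = cnj \<alpha>" "su2_block \<alpha> \<beta> $ 1 $ 2 = cnj \<beta>" "su2_block \<alpha> \<beta> $ 1 $ 3 = 0"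
  "su2_block \<alpha> \<beta> $ 2 $ 1 = - \<beta>" "su2_block \<alpha> \<beta> $ 2 $ 2 = \<alpha>" "su2_block \<alpha> \<beta> $ 2 $ 3 = 0"
  "su2_block \<alpha> \<beta> $ 3 $ 1 = 0" "su2_block \<alpha> \<beta> $ 3 $ 2 = 0" "su2_block \<alpha> \<beta> $ 3 $ 3 = 1"
  by (simp_all add: su2_block_def)

lemma unitary_su2_block:
  assumes "\<alpha> * cnj \<alpha> + \<beta> * cnj \<beta> = 1"
  shows "unitary (su2_block \<alpha> \<beta>)"
  using assms
  by (simp add: unitary_def vec_eq_iff forall_3 matrix_matrix_mult_def dagger_def cnj_mat_def
      transpose_def sum_3 mat_def algebra_simps)

text \<open>The upper block of the canonical matrix is the antisymmetric form epsilon, and G epsilon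
  G^T = det G epsilon with det G = 1.\<close>

lemma su2_block_X_cp4:
  assumes "\<alpha> * cnj \<alpha> + \<beta> * cnj \<beta> = 1"
  shows "su2_block \<alpha> \<beta> ** X_cp4 ** transpose (su2_block \<alpha> \<beta>) = X_cp4"
  using assms
  by (simp add: X_cp4_eq_real_block vec_eq_iff forall_3 matrix_matrix_mult_def transpose_def sum_3 algebra_simps)

lemma Ad_su2_block_W4:
  assumes ab: "\<alpha> * cnj \<alpha> + \<beta> * cnj \<beta> = 1"
    and y: "y $ 1 = 0" "y $ 2 = 0" "y $ 3 = 0" "y $ 8 = 0"
  defines "z \<equiv> Ad (su2_block \<alpha> \<beta>) y"
  shows "z $ 1 = 0" "z $ 2 = 0" "z $ 3 = 0" "z $ 8 = 0"
proof -
  let ?G = "su2_block \<alpha> \<beta>"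
  have "adjoint_matrix_of z = ?G ** adjoint_matrix_of y ** dagger ?G"
    unfolding z_def by (rule adjoint_matrix_of_Ad[OF unitary_su2_block[OF ab]])
  then have e: "adjoint_matrix_of z $ i $ j = (?G ** adjoint_matrix_of y ** dagger ?G) $ i $ j" for i j by simp
  show z8: "z $ 8 = 0"
    using e[of 3 3] by (simp add: adjoint_matrix_of_explicit y matrix_matrix_mult_def dagger_def
        cnj_mat_def transpose_def sum_3)
  have "complex_of_real (z $ 3) = 0"
    using e[of 1 1] by (simp add: adjoint_matrix_of_explicit y z8 matrix_matrix_mult_def dagger_def
        cnj_mat_def transpose_def sum_3)
  then show "z $ 3 = 0" by simp
  have "complex_of_real (z $ 1) - \<i> * complex_of_real (z $ 2) = 0"
    using e[of 1 2] by (simp add: adjoint_matrix_of_explicit y matrix_matrix_mult_def dagger_def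
        cnj_mat_def transpose_def sum_3)
  then show "z $ 1 = 0" "z $ 2 = 0" by (auto simp: complex_eq_iff)
qed

text \<open>Via the upper right entries of the adjoint matrix, W_4 is C^2 with coordinates y_4 - i
  y_5 and y_6 - i y_7, on which the block acts by plain matrix multiplication. So (alpha, beta) is
  the normalized vector itself.\<close>

lemma rotate_to_axis_4:
  assumes y: "y $ 1 = 0" "y $ 2 = 0" "y $ 3 = 0" "y $ 8 = 0" and "y \<noteq> 0"
  obtains \<alpha> \<beta> where "\<alpha> * cnj \<alpha> + \<beta> * cnj \<beta> = 1" "Ad (su2_block \<alpha> \<beta>) y = norm y *\<^sub>R axis 4 1"
proof -
  define r where "r = norm y"
  have r0: "r \<noteq> 0" using assms(5) by (simp add: r_def)
  have "r\<^sup>2 = y \<bullet> y" by (simp add: r_def power2_norm_eq_inner)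
  then have r2: "r\<^sup>2 = (y $ 4)\<^sup>2 + (y $ 5)\<^sup>2 + (y $ 6)\<^sup>2 + (y $ 7)\<^sup>2"
    by (simp add: inner_vec_def sum_8 y power2_eq_square)
  define \<alpha> \<beta> where "\<alpha> = Complex (y $ 4 / r) (- y $ 5 / r)" and "\<beta> = Complex (y $ 6 / r) (- y $ 7 / r)"
  have ab: "\<alpha> * cnj \<alpha> + \<beta> * cnj \<beta> = 1"
  proof -
    have "(y $ 4 / r)\<^sup>2 + (y $ 5 / r)\<^sup>2 + (y $ 6 / r)\<^sup>2 + (y $ 7 / r)\<^sup>2 = 1"
      using r0 by (simp add: power_divide add_divide_distrib[symmetric] r2[symmetric])
    then show ?thesis
      by (simp add: \<alpha>_def \<beta>_def complex_eq_iff power2_eq_square)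
  qed
  have v: "complex_of_real (y $ 4) - \<i> * complex_of_real (y $ 5) = of_real r * \<alpha>"
    "complex_of_real (y $ 6) - \<i> * complex_of_real (y $ 7) = of_real r * \<beta>"
    "complex_of_real (y $ 4) + \<i> * complex_of_real (y $ 5) = of_real r * cnj \<alpha>"
    "complex_of_real (y $ 6) + \<i> * complex_of_real (y $ 7) = of_real r * cnj \<beta>"
    using r0 by (simp_all add: \<alpha>_def \<beta>_def complex_eq_iff)
  have ab': "complex_of_real r * (\<alpha> * cnj \<alpha>) + of_real r * (\<beta> * cnj \<beta>) = of_real r"
    using ab by (simp flip: distrib_left)
  have "Ad (su2_block \<alpha> \<beta>) y = r *\<^sub>R axis 4 1"
    unfolding Ad_eq_iff[OF unitary_su2_block[OF ab]]
    using ab' by (simp add: vec_eq_iff forall_3 adjoint_matrix_of_explicit y v matrix_matrix_mult_def sum_3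
        axis_def) (simp add: algebra_simps)
  then show ?thesis using ab that by (simp add: r_def)
qed

section \<open>Potentials with a CP4 symmetry in adapted coordinates\<close>

locale cp4_potential =
  fixes V :: "doublets \<Rightarrow> real"
    and M0 Lam0 :: real and M L :: "real ^ 8" and Lam :: "real ^ 8 ^ 8"
    and X :: "complex ^ 3 ^ 3"
  assumes form: "is_bilinear_form V M0 M Lam0 L Lam" and cp4: "cp4_symmetry V X"
begin

lemma unitary_X: "unitary X"
  using cp4 by (simp add: cp4_symmetry_def cp_symmetry_def)

lemma X_invariant:
  "Ad X (conj_adj M) = M" "Ad X (conj_adj L) = L" "Lam *v Ad X (conj_adj x) = Ad X (conj_adj (Lam *v x))"
  using cp4 cp_symmetry_iff[OF form unitary_X] by (auto simp: cp4_symmetry_def)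

lemma Lam_self_adjoint: "x \<bullet> (Lam *v y) = (Lam *v x) \<bullet> y"
  by (rule is_bilinear_form_self_adjoint[OF form])

lemma subspace_eigenspace:
  assumes "unitary B"
  shows "subspace (eigenspace_in (W4 B) Lam \<mu>)"
  by (auto simp: subspace_def eigenspace_in_def W4_iff[OF assms] linear_add[OF linear_Ad]
      linear_scale[OF linear_Ad] linear_0[OF linear_Ad] matrix_vector_right_distrib
      matrix_vector_mult_scaleR scaleR_right_distrib mult.commute)

lemma eigenspace_cp4_invariant:
  assumes "canonical_cp4_basis X B" "x \<in> eigenspace_in (W4 B) Lam \<mu>"
  shows "Ad X (conj_adj x) \<in> eigenspace_in (W4 B) Lam \<mu>"
proof -
  have B: "unitary B" using assms by (simp add: canonical_cp4_basis_def)
  show ?thesis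
    using assms(2)
    by (simp add: eigenspace_in_def W4_iff[OF B] Ad_canonical_cp4[OF assms(1) unitary_X] Ad_X_cp4 X_invariant
        linear_scale[OF linear_Ad] linear_scale[OF linear_conj_adj])
qed

text \<open>The block rotations \<open>su2_block\<close> preserve the canonical form of \<open>X\<close>, and they are
  transitive on the unit sphere of \<open>W\<^sub>4\<close>.\<close>

lemma adapted_basis:
  assumes B0: "canonical_cp4_basis X B0" and \<mu>: "\<mu>1 \<noteq> \<mu>2"
    and dims: "dim (eigenspace_in (W4 B0) Lam \<mu>1) = 2" "dim (eigenspace_in (W4 B0) Lam \<mu>2) = 2"
  obtains B where "canonical_cp4_basis X B"
    "Ad B ` eigenspace_in (W4 B0) Lam \<mu>1 = coord_plane 4 6"
    "Ad B ` eigenspace_in (W4 B0) Lam \<mu>2 = coord_plane 5 7"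
proof -
  define E1 E2 where "E1 = eigenspace_in (W4 B0) Lam \<mu>1" and "E2 = eigenspace_in (W4 B0) Lam \<mu>2"
  have uB0: "unitary B0" using B0 by (simp add: canonical_cp4_basis_def)
  note sub1 = subspace_eigenspace[OF uB0, of \<mu>1, folded E1_def]
  note sub2 = subspace_eigenspace[OF uB0, of \<mu>2, folded E2_def]
  have "\<not> E1 \<subseteq> {0}"
  proof
    assume "E1 \<subseteq> {0}"
    then have "dim E1 \<le> dim {0 :: real ^ 8}" by (rule dim_subset)
    then show False using dims by (simp add: E1_def)
  qed
  then obtain x where x: "x \<in> E1" "x \<noteq> 0" by blast
  have inW: "Ad B0 z $ 1 = 0 \<and> Ad B0 z $ 2 = 0 \<and> Ad B0 z $ 3 = 0 \<and> Ad B0 z $ 8 = 0" if "z \<in> E1 \<or> z \<in> E2" for z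
    using that by (auto simp: E1_def E2_def eigenspace_in_def W4_iff[OF uB0])
  have "Ad B0 x \<noteq> 0"
    using x(2) Ad_dagger_Ad[OF uB0, of x] linear_0[OF linear_Ad] by metis
  then obtain \<alpha> \<beta> where ab: "\<alpha> * cnj \<alpha> + \<beta> * cnj \<beta> = 1"
    and rot: "Ad (su2_block \<alpha> \<beta>) (Ad B0 x) = norm (Ad B0 x) *\<^sub>R axis 4 1"
    using rotate_to_axis_4[of "Ad B0 x"] inW x(1) by metis
  let ?G = "su2_block \<alpha> \<beta>"
  note uG = unitary_su2_block[OF ab]
  define B where "B = ?G ** B0"
  have uB: "unitary B" unfolding B_def by (rule unitary_mult[OF uG uB0])
  have AdB: "Ad B z = Ad ?G (Ad B0 z)" for z unfolding B_def by (rule Ad_mult[OF uG uB0])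
  have "B ** X ** transpose B = ?G ** (B0 ** X ** transpose B0) ** transpose ?G"
    unfolding B_def matrix_transpose_mul by (simp only: matrix_mul_assoc)
  then have cB: "canonical_cp4_basis X B"
    using B0 uB su2_block_X_cp4[OF ab] by (simp add: canonical_cp4_basis_def)
  define x0 where "x0 = (1 / norm (Ad B0 x)) *\<^sub>R x"
  have x0: "x0 \<in> E1" "Ad B x0 = axis 4 1"
    using x(1) \<open>Ad B0 x \<noteq> 0\<close> subspace_scale[OF sub1]
    by (simp_all add: x0_def AdB linear_scale[OF linear_Ad] rot)
  \<comment> \<open>CP4 sends axis 4 to minus axis 6, hence the sign.\<close>
  define x1 where "x1 = - Ad X (conj_adj x0)"
  have "Ad X (conj_adj x0) \<in> E1"
    using eigenspace_cp4_invariant[OF B0] x0(1) unfolding E1_def by blast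
  then have x1E: "x1 \<in> E1" unfolding x1_def by (rule subspace_neg[OF sub1])
  have x1: "Ad B x1 = axis 6 1"
    unfolding x1_def linear_neg[OF linear_Ad] Ad_canonical_cp4[OF cB unitary_X] x0(2) Ad_X_cp4
    by (simp add: vec_eq_iff forall_8 axis_def)
  have dimE: "dim (Ad B ` E1) = 2" "dim (Ad B ` E2) = 2"
    using dims dim_image_eq[OF linear_Ad inj_on_subset[OF inj_Ad[OF uB]], of E1]
      dim_image_eq[OF linear_Ad inj_on_subset[OF inj_Ad[OF uB]], of E2]
    by (simp_all add: E1_def E2_def)
  have subI: "subspace (Ad B ` E1)" "subspace (Ad B ` E2)"
    by (rule linear_subspace_image[OF linear_Ad sub1], rule linear_subspace_image[OF linear_Ad sub2])
  have "axis 4 1 \<in> Ad B ` E1" "axis 6 1 \<in> Ad B ` E1"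
    using x0 x1 x1E by (metis imageI)+
  then have "coord_plane 4 6 \<subseteq> Ad B ` E1"
    unfolding coord_plane_eq_span[of 4 6, simplified] by (intro span_minimal subI) auto
  then have 1: "Ad B ` E1 = coord_plane 4 6"
    using subspace_dim_equal[OF subspace_coord_plane subI(1), of 4 6] dimE dim_coord_plane[of 4 6] by simp
  have "Ad B ` E2 \<subseteq> coord_plane 5 7"
  proof clarify
    fix z assume z: "z \<in> E2"
    have orth: "w \<bullet> z = 0" if "w \<in> E1" for w
    proof -
      have "\<mu>1 * (w \<bullet> z) = \<mu>2 * (w \<bullet> z)"
        using Lam_self_adjoint[of w z] that z by (auto simp: E1_def E2_def eigenspace_in_def)
      then show ?thesis using \<mu> by simp
    qed
    have "Ad B z $ 4 = 0" "Ad B z $ 6 = 0"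
      using orth[OF x0(1)] orth[OF x1E] Ad_inner[OF uB, of x0 z] Ad_inner[OF uB, of x1 z]
      by (simp_all add: x0 x1 inner_axis inner_commute)
    moreover have "Ad B z $ 1 = 0" "Ad B z $ 2 = 0" "Ad B z $ 3 = 0" "Ad B z $ 8 = 0"
      unfolding AdB using Ad_su2_block_W4[OF ab] inW z by blast+
    ultimately show "Ad B z \<in> coord_plane 5 7"
      by (simp add: coord_plane_def forall_8)
  qed
  then have 2: "Ad B ` E2 = coord_plane 5 7"
    using subspace_dim_equal[OF subI(2) subspace_coord_plane, of 5 7] dimE dim_coord_plane[of 5 7] by simp
  show ?thesis using that cB 1 2 unfolding E1_def E2_def by blast
qed

end

context cp4_potential
begin

text \<open>Axes 4 to 7 are eigenvectors of a symmetric map, which clears their rows and columns.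
  CP4 fixes axis 8 and reverses the first three axes, so no entry connects these.\<close>

lemma Lam_block_form:
  assumes cB: "canonical_cp4_basis X B"
    and E1: "Ad B ` eigenspace_in (W4 B0) Lam \<mu>1 = coord_plane 4 6"
    and E2: "Ad B ` eigenspace_in (W4 B0) Lam \<mu>2 = coord_plane 5 7"
  obtains A l where "transpose A = A" "\<And>x. Ad B (Lam *v x) = block_form A \<mu>1 \<mu>2 l (Ad B x)"
proof -
  have uB: "unitary B" using cB by (simp add: canonical_cp4_basis_def)
  define K where "K y = Ad B (Lam *v Ad (dagger B) y)" for y
  have sa: "x \<bullet> K y = K x \<bullet> y" for x y
  proof -
    have "x \<bullet> K y = Ad (dagger B) x \<bullet> (Lam *v Ad (dagger B) y)"
      unfolding K_def by (metis Ad_inner_left uB inner_commute)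
    also have "\<dots> = K x \<bullet> y"
      unfolding Lam_self_adjoint K_def by (simp add: Ad_inner_left uB)
    finally show ?thesis .
  qed
  have ev: "K (Ad B x) = \<mu> *\<^sub>R Ad B x" if "x \<in> eigenspace_in (W4 B0) Lam \<mu>" for x \<mu>
    using that by (simp add: K_def Ad_dagger_Ad[OF uB] eigenspace_in_def linear_scale[OF linear_Ad])
  have "axis 4 1 \<in> coord_plane 4 6" "axis 6 1 \<in> coord_plane 4 6" "axis 5 1 \<in> coord_plane 5 7" "axis 7 1 \<in> coord_plane 5 7"
    by (simp_all add: coord_plane_def axis_def)
  then have K4: "K (axis 4 1) = \<mu>1 *\<^sub>R axis 4 1" and K6: "K (axis 6 1) = \<mu>1 *\<^sub>R axis 6 1"
    and K5: "K (axis 5 1) = \<mu>2 *\<^sub>R axis 5 1" and K7: "K (axis 7 1) = \<mu>2 *\<^sub>R axis 7 1"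
    unfolding E1[symmetric] E2[symmetric] using ev by (metis imageE)+
  let ?J = "\<lambda>x. Ad X_cp4 (conj_adj x)"
  have KJ: "K (?J y) = ?J (K y)" for y
  proof -
    have "?J y = Ad B (Ad X (conj_adj (Ad (dagger B) y)))"
      by (simp add: Ad_canonical_cp4[OF cB unitary_X] Ad_Ad_dagger[OF uB])
    then have "K (?J y) = Ad B (Lam *v Ad X (conj_adj (Ad (dagger B) y)))"
      by (simp add: K_def Ad_dagger_Ad[OF uB])
    also have "\<dots> = ?J (K y)"
      unfolding X_invariant(3) Ad_canonical_cp4[OF cB unitary_X] K_def ..
    finally show ?thesis .
  qed
  have nth: "K x $ i = x \<bullet> K (axis i 1)" for x i
    unfolding sa by (simp add: inner_axis)
  have swap: "K (axis j 1) $ i = K (axis i 1) $ j" for i j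
    using sa[of "axis i 1" "axis j 1"] by (simp add: inner_axis inner_axis')
  have "?J (axis 8 1) = axis 8 1"
    unfolding Ad_X_cp4 by (simp add: vec_eq_iff forall_8 axis_def)
  then have "?J (K (axis 8 1)) = K (axis 8 1)"
    using KJ[of "axis 8 1"] by simp
  then have K8: "K (axis 8 1) $ 1 = 0" "K (axis 8 1) $ 2 = 0" "K (axis 8 1) $ 3 = 0"
    unfolding Ad_X_cp4 vec_eq_iff by (auto simp: forall_8)
  define l where "l = K (axis 8 1) $ 8"
  define A :: "real ^ 3 ^ 3" where "A = vector [vector [K (axis 1 1) $ 1, K (axis 1 1) $ 2, K (axis 1 1) $ 3],
    vector [K (axis 2 1) $ 1, K (axis 2 1) $ 2, K (axis 2 1) $ 3],
    vector [K (axis 3 1) $ 1, K (axis 3 1) $ 2, K (axis 3 1) $ 3]]"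
  have "transpose A = A"
    using swap[of 1 2] swap[of 1 3] swap[of 2 3]
    by (simp add: vec_eq_iff forall_3 transpose_def A_def)
  have axis_nth: "axis k (1 :: real) $ i = (if i = k then 1 else 0)" for i k :: 8
    by (simp add: axis_def)
  have off: "K (axis j 1) $ i = 0" if "i \<in> {4, 5, 6, 7}" "i \<noteq> j" for i j
    using that by (auto simp: swap[of j i] K4 K5 K6 K7 axis_nth)
  have "K x = block_form A \<mu>1 \<mu>2 l x" for x
    unfolding vec_eq_iff forall_8 block_form_nth nth[of x]
    using off[of _ 1] off[of _ 2] off[of _ 3] off[of _ 8] K8 swap[of 8 1] swap[of 8 2] swap[of 8 3]
    by (simp add: K4 K5 K6 K7 inner_vec_def sum_8 axis_nth A_def l_def mult.commute)
  then have "Ad B (Lam *v x) = block_form A \<mu>1 \<mu>2 l (Ad B x)" for x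
    unfolding K_def by (metis Ad_dagger_Ad[OF uB])
  with \<open>transpose A = A\<close> show ?thesis using that by blast
qed

text \<open>CP4 reverses x_1, x_2, x_3 and acts on (x_4, x_6) and (x_5, x_7) by quarter turns,
  neither of which fixes a nonzero vector. This concerns \<open>M\<close> and
  \<open>L\<close>.\<close>

lemma cp4_fixed_vector:
  assumes "canonical_cp4_basis X B" "Ad X (conj_adj x) = x"
  shows "Ad B x = (Ad B x $ 8) *\<^sub>R axis 8 1"
proof -
  have "Ad X_cp4 (conj_adj (Ad B x)) = Ad B x"
    using Ad_canonical_cp4[OF assms(1) unitary_X] assms(2) by metis
  then show ?thesis
    unfolding Ad_X_cp4 vec_eq_iff by (auto simp: forall_8 axis_def)
qed

lemma cp2_of_not_generic:
  assumes cB: "canonical_cp4_basis X B" and sym: "transpose A = A"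
    and Lam: "\<And>x. Ad B (Lam *v x) = block_form A \<mu>1 \<mu>2 l (Ad B x)"
    and ngen: "\<not> generic_block A"
  shows "\<exists>X'. cp2_symmetry V X'"
proof -
  have uB: "unitary B" using cB by (simp add: canonical_cp4_basis_def)
  obtain Y where Y: "unitary Y" "Y ** cnj_mat Y = mat 1"
    and YK: "\<And>x. block_form A \<mu>1 \<mu>2 l (Ad Y (conj_adj x)) = Ad Y (conj_adj (block_form A \<mu>1 \<mu>2 l x))"
    and Y8: "Ad Y (conj_adj (axis 8 1)) = axis 8 1"
    using exists_cp2_of_not_generic[OF sym ngen, where ?m1.0 = \<mu>1 and ?m2.0 = \<mu>2 and l = l] by blast
  \<comment> \<open>Inverse of the change of CP matrices under \<open>B\<close>, because the inverse
    of B^T is B^*.\<close>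
  define X' where "X' = dagger B ** Y ** cnj_mat B"
  have uX': "unitary X'"
    unfolding X'_def by (intro unitary_mult unitary_dagger unitary_cnj_mat uB Y)
  have BX': "Ad B (Ad X' (conj_adj x)) = Ad Y (conj_adj (Ad B x))" for x
  proof -
    have "B ** X' = B ** dagger B ** Y ** cnj_mat B"
      unfolding X'_def by (simp only: matrix_mul_assoc)
    then have "B ** X' = Y ** cnj_mat B" using uB by (simp add: unitary_def)
    then show ?thesis
      by (simp add: conj_adj_Ad[OF uB] Ad_mult[symmetric] uB uX' Y unitary_cnj_mat)
  qed
  have fixed: "Ad X' (conj_adj x) = x" if "Ad X (conj_adj x) = x" for x
  proof -
    have "Ad Y (conj_adj (Ad B x)) = Ad B x"
      by (subst (1 2) cp4_fixed_vector[OF cB that])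
        (simp add: linear_scale[OF linear_Ad] linear_scale[OF linear_conj_adj] Y8)
    then show ?thesis
      unfolding BX'[symmetric] by (rule injD[OF inj_Ad[OF uB]])
  qed
  have "Lam *v Ad X' (conj_adj x) = Ad X' (conj_adj (Lam *v x))" for x
    by (rule injD[OF inj_Ad[OF uB]]) (simp add: BX' Lam YK)
  then have "cp_symmetry V X'"
    using cp_symmetry_iff[OF form uX'] fixed X_invariant by blast
  moreover have "X' ** cnj_mat X' = mat 1"
  proof -
    have "X' ** cnj_mat X' = dagger B ** Y ** (cnj_mat B ** cnj_mat (dagger B)) ** cnj_mat Y ** B"
      unfolding X'_def by (simp add: cnj_mat_mult matrix_mul_assoc)
    also have "\<dots> = dagger B ** Y ** cnj_mat Y ** B"
      using uB unfolding cnj_mat_mult[symmetric] by (simp add: unitary_def)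
    also have "\<dots> = dagger B ** (Y ** cnj_mat Y) ** B"
      by (simp only: matrix_mul_assoc)
    finally show ?thesis using uB Y(2) by (simp add: unitary_def)
  qed
  ultimately show ?thesis by (auto simp: cp2_symmetry_def)
qed

text \<open>The classification in adapted coordinates, conjugated back. A scalar matrix is
  unaffected, and the square of the canonical CP4 matrix returns to that of
  \<open>X\<close>.\<close>

lemma family_symmetry_trivial:
  assumes cB: "canonical_cp4_basis X B" and sym: "transpose A = A" and \<mu>: "\<mu>1 \<noteq> \<mu>2"
    and Lam: "\<And>x. Ad B (Lam *v x) = block_form A \<mu>1 \<mu>2 l (Ad B x)"
    and gen: "generic_block A" and S: "family_symmetry V S"
  shows "\<exists>z. cmod z = 1 \<and> (S = cscale z (mat 1) \<or> S = cscale z (X ** cnj_mat X))"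
proof -
  have uB: "unitary B" using cB by (simp add: canonical_cp4_basis_def)
  have uS: "unitary S" using S by (simp add: family_symmetry_def)
  have comm: "Lam *v Ad S x = Ad S (Lam *v x)" for x
    using S family_symmetry_iff[OF form uS] by blast
  define T where "T = B ** S ** dagger B"
  have uT: "unitary T" unfolding T_def by (intro unitary_mult uB uS unitary_dagger)
  have AdT: "Ad T y = Ad B (Ad S (Ad (dagger B) y))" for y
    unfolding T_def by (simp add: Ad_mult unitary_mult uB uS unitary_dagger)
  have "block_form A \<mu>1 \<mu>2 l (Ad T y) = Ad T (block_form A \<mu>1 \<mu>2 l y)" for y
  proof -
    have "Ad (dagger B) (block_form A \<mu>1 \<mu>2 l y) = Lam *v Ad (dagger B) y"
      using Lam[of "Ad (dagger B) y"] by (metis Ad_Ad_dagger Ad_dagger_Ad uB)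
    then show ?thesis unfolding AdT Lam[symmetric] by (simp add: comm)
  qed
  then obtain z where z: "cmod z = 1" "T = cscale z (mat 1) \<or> T = cscale z (X_cp4 ** cnj_mat X_cp4)"
    using commuting_unitary_trivial[OF uT sym gen \<mu>] by blast
  have "dagger B ** T ** B = dagger B ** B ** S ** (dagger B ** B)"
    unfolding T_def by (simp only: matrix_mul_assoc)
  then have ST: "S = dagger B ** T ** B" using uB by (simp add: unitary_def)
  have XX: "X ** cnj_mat X = dagger B ** (X_cp4 ** cnj_mat X_cp4) ** B"
  proof -
    have "X ** cnj_mat X = dagger B ** X_cp4 ** (cnj_mat B ** cnj_mat (dagger B)) ** cnj_mat X_cp4 ** B"
      unfolding canonical_cp4_basis_conj(1)[OF cB] by (simp add: cnj_mat_mult matrix_mul_assoc)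
    then show ?thesis
      using uB unfolding cnj_mat_mult[symmetric] by (simp add: unitary_def matrix_mul_assoc)
  qed
  show ?thesis
    using z uB unfolding ST XX
    by (auto simp: cscale_mult_left cscale_mult_right unitary_def matrix_mul_assoc)
qed

lemma X_order:
  "X ** cnj_mat X \<noteq> mat 1" "X ** cnj_mat X ** (X ** cnj_mat X) = mat 1"
  using cp4 by (simp_all add: cp4_symmetry_def)

text \<open>\<open>X' ** cnj_mat X\<close> is a family symmetry. If it is a phase, then X' is that
  phase times the inverse of \<open>cnj_mat X\<close>, and this inverse is the cube of CP4 because
  its fourth power is the identity.\<close>

lemma cp_symmetry_trivial:
  assumes fam: "\<And>S. family_symmetry V S \<Longrightarrow>
      \<exists>z. cmod z = 1 \<and> (S = cscale z (mat 1) \<or> S = cscale z (X ** cnj_mat X))"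
    and X': "cp_symmetry V X'"
  shows "\<exists>z. cmod z = 1 \<and> (X' = cscale z X \<or> X' = cscale z (X ** cnj_mat X ** X))"
proof -
  have inv: "V (cp_map X \<phi>) = V \<phi>" "V (cp_map X' \<phi>) = V \<phi>" for \<phi>
    using cp4 X' by (simp_all add: cp4_symmetry_def cp_symmetry_def)
  have comp: "family_map (X' ** cnj_mat X) \<phi> = cp_map X' (cp_map X \<phi>)" for \<phi>
    by (simp add: family_map_def cp_map_def cnj_mat_mult matrix_mul_assoc)
  have uX': "unitary X'" using X' by (simp add: cp_symmetry_def)
  have "family_symmetry V (X' ** cnj_mat X)"
    using inv by (simp add: family_symmetry_def comp unitary_mult uX' unitary_cnj_mat unitary_X)
  then obtain z where z: "cmod z = 1"
    and "X' ** cnj_mat X = cscale z (mat 1) \<or> X' ** cnj_mat X = cscale z (X ** cnj_mat X)"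
    using fam by blast
  moreover have cancel: "X' = Y" if "X' ** cnj_mat X = Y ** cnj_mat X" for Y
  proof -
    have "cnj_mat X ** dagger (cnj_mat X) = mat 1"
      using unitary_cnj_mat[OF unitary_X] by (simp add: unitary_def)
    then show ?thesis using that by (metis matrix_mul_assoc matrix_mul_rid)
  qed
  moreover have "cscale z (X ** cnj_mat X ** X) ** cnj_mat X = cscale z (mat 1)"
    using X_order(2) by (simp add: cscale_mult_left matrix_mul_assoc)
  moreover have "cscale z X ** cnj_mat X = cscale z (X ** cnj_mat X)"
    by (simp add: cscale_mult_left)
  ultimately show ?thesis by metis
qed

text \<open>A phase cancels in \<open>X' ** cnj_mat X'\<close>, and CP4 and its cube have the same
  square, which is not the identity.\<close>

lemma no_cp2:
  assumes cp: "\<And>X'. cp_symmetry V X' \<Longrightarrow>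
      \<exists>z. cmod z = 1 \<and> (X' = cscale z X \<or> X' = cscale z (X ** cnj_mat X ** X))"
  shows "\<not> cp2_symmetry V X'"
proof
  assume X': "cp2_symmetry V X'"
  then obtain z where z: "cmod z = 1" "X' = cscale z X \<or> X' = cscale z (X ** cnj_mat X ** X)"
    using cp by (auto simp: cp2_symmetry_def)
  have cnj_cscale: "cnj_mat (cscale z A) = cscale (cnj z) (cnj_mat A)" for A :: "complex ^ 3 ^ 3"
    by (simp add: cnj_mat_def cscale_def vec_eq_iff)
  have "X ** cnj_mat X ** X ** cnj_mat (X ** cnj_mat X ** X)
      = X ** cnj_mat X ** (X ** cnj_mat X) ** (X ** cnj_mat X)"
    by (simp add: cnj_mat_mult matrix_mul_assoc)
  also have "\<dots> = X ** cnj_mat X" by (simp only: X_order(2) matrix_mul_lid)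
  finally have "X' ** cnj_mat X' = X ** cnj_mat X"
    using z by (auto simp: cnj_cscale cscale_mult_left cscale_mult_right cscale_cscale cmod_1_mult_cnj)
  then show False using X' X_order(1) by (simp add: cp2_symmetry_def)
qed

text \<open>Solving phi' = X phi^* for phi gives X^T phi'^*, again a CP map.\<close>

lemma cp_map_in_Bij: "cp_map X \<in> Bij UNIV"
proof -
  have inv: "cp_map (transpose X) (cp_map X \<phi>) = \<phi>" "cp_map X (cp_map (transpose X) \<phi>) = \<phi>" for \<phi>
  proof -
    have "cnj_mat (transpose X) = dagger X" by (simp add: transpose_conv)
    then show "cp_map (transpose X) (cp_map X \<phi>) = \<phi>" "cp_map X (cp_map (transpose X) \<phi>) = \<phi>"
      using transpose_eq_inverse_cnj[OF unitary_X] unitary_X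
      by (simp_all add: cp_map_def cnj_mat_mult matrix_mul_assoc unitary_def)
  qed
  then have "bij (cp_map X)" by (metis bijI' )
  then show ?thesis by (simp add: Bij_def)
qed

text \<open>The powers 0 to 3 of CP4: the even ones realize the family symmetries found above, the
  odd ones the CP symmetries.\<close>

lemma cp_group_members:
  "(\<lambda>\<phi>. \<phi>) \<in> cp_group X" "cp_map X \<in> cp_group X" "cp_map X \<circ> cp_map X \<in> cp_group X"
  "cp_map X \<circ> (cp_map X \<circ> cp_map X) \<in> cp_group X"
proof -
  let ?G = "BijGroup (UNIV :: doublets set)"
  have "\<one>\<^bsub>?G\<^esub> \<in> generate ?G {cp_map X}" by (rule generate.one)
  then show "(\<lambda>\<phi>. \<phi>) \<in> cp_group X"
    by (simp add: cp_group_def BijGroup_def restrict_def)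
  have J: "cp_map X \<in> generate ?G {cp_map X}" by (rule generate.incl) simp
  then show "cp_map X \<in> cp_group X" by (simp add: cp_group_def)
  have mult: "g \<otimes>\<^bsub>?G\<^esub> h = g \<circ> h" if "g \<in> Bij UNIV" "h \<in> Bij UNIV" for g h
    using that by (simp add: BijGroup_def compose_def fun_eq_iff)
  have JJ: "cp_map X \<circ> cp_map X \<in> generate ?G {cp_map X}"
    using generate.eng[OF J J] by (simp add: mult cp_map_in_Bij)
  then show "cp_map X \<circ> cp_map X \<in> cp_group X" by (simp add: cp_group_def)
  have "cp_map X \<circ> cp_map X \<in> Bij UNIV"
    using cp_map_in_Bij by (simp add: Bij_def bij_comp)
  then show "cp_map X \<circ> (cp_map X \<circ> cp_map X) \<in> cp_group X"
    using generate.eng[OF J JJ] by (simp add: mult cp_map_in_Bij cp_group_def)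
qed

lemma pure_cp4:
  assumes fam: "\<And>S. family_symmetry V S \<Longrightarrow>
      \<exists>z. cmod z = 1 \<and> (S = cscale z (mat 1) \<or> S = cscale z (X ** cnj_mat X))"
  shows "pure_cp4_model V X"
  unfolding pure_cp4_model_def
proof (intro conjI allI impI)
  fix S assume "family_symmetry V S"
  then obtain z where z: "cmod z = 1" "S = cscale z (mat 1) \<or> S = cscale z (X ** cnj_mat X)"
    using fam by blast
  have "(cp_map X \<circ> cp_map X) \<phi> = (X ** cnj_mat X) ** \<phi>" for \<phi>
    by (simp add: cp_map_def cnj_mat_mult matrix_mul_assoc)
  with z show "in_up_to_phase (family_map S) (cp_group X)"
    unfolding in_up_to_phase_def family_map_def
    using cp_group_members(1,3) by (metis cscale_mult_left matrix_mul_lid)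
next
  fix X' assume "cp_symmetry V X'"
  then obtain z where z: "cmod z = 1" "X' = cscale z X \<or> X' = cscale z (X ** cnj_mat X ** X)"
    using cp_symmetry_trivial[OF fam] by blast
  have "(cp_map X \<circ> (cp_map X \<circ> cp_map X)) \<phi> = (X ** cnj_mat X ** X) ** cnj_mat \<phi>" for \<phi>
    by (simp add: cp_map_def cnj_mat_mult matrix_mul_assoc)
  with z show "in_up_to_phase (cp_map X') (cp_group X)"
    unfolding in_up_to_phase_def
    using cp_group_members(2,4) by (metis cscale_mult_left cp_map_def)
qed

text \<open>Being an eigenvector is insensitive to scaling, so an eigenvector of \<open>A\<close> on
  the second axis can be normalized to the axis vector tested by \<open>u\<close>, and one with
  vanishing second coordinate to a point of the unit circle that represents
  \<open>U\<close>.\<close>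

lemma eigenvector_iff_not_generic:
  assumes uB: "unitary B" and Lam: "\<And>x. Ad B (Lam *v x) = block_form A \<mu>1 \<mu>2 l (Ad B x)"
    and u: "Ad B u = (1 / 2) *\<^sub>R axis 2 1"
    and U: "Ad B ` U = {a *\<^sub>R axis 1 1 + b *\<^sub>R axis 3 1 | a b. a\<^sup>2 + b\<^sup>2 = 1}"
  shows "is_eigenvector Lam u \<or> (\<exists>w \<in> U. is_eigenvector Lam w) \<longleftrightarrow> \<not> generic_block A"
proof -
  have ev: "is_eigenvector Lam x \<longleftrightarrow> v \<noteq> 0 \<and> (\<exists>c. A *v v = c *\<^sub>R v)" if "Ad B x = embed_block v" for x v
  proof -
    have inj: "embed_block v = embed_block w \<longleftrightarrow> v = w" for v w
      by (auto simp: vec_eq_iff forall_8 forall_3)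
    have sc: "c *\<^sub>R embed_block v = embed_block (c *\<^sub>R v)" "embed_block 0 = 0" for c v
      by (simp_all add: vec_eq_iff forall_8)
    have "Lam *v x = c *\<^sub>R x \<longleftrightarrow> A *v v = c *\<^sub>R v" for c
      using Lam[of x] inj_eq[OF inj_Ad[OF uB], of "Lam *v x" "c *\<^sub>R x"]
      by (simp add: that block_form_embed linear_scale[OF linear_Ad] sc inj)
    moreover have "x = 0 \<longleftrightarrow> v = 0"
      using inj_eq[OF inj_Ad[OF uB], of x 0] inj[of v 0] by (simp add: that linear_0[OF linear_Ad] sc)
    ultimately show ?thesis by (simp add: is_eigenvector_def)
  qed
  have emb: "(1 / 2) *\<^sub>R axis 2 1 = embed_block ((1 / 2) *\<^sub>R axis 2 1)"
    "a *\<^sub>R axis 1 1 + b *\<^sub>R axis 3 1 = embed_block (vector [a, 0, b])" for a b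
    by (simp_all add: vec_eq_iff forall_8 axis_def)
  have half: "(1 / 2) *\<^sub>R x = c *\<^sub>R ((1 / 2) *\<^sub>R y) \<longleftrightarrow> x = c *\<^sub>R y" for c and x y :: "real ^ 3"
    unfolding scaleR_left_commute[of c] scaleR_cancel_left by simp
  have u_ev: "is_eigenvector Lam u \<longleftrightarrow> (\<exists>c. A *v axis 2 1 = c *\<^sub>R axis 2 1)"
    unfolding ev[OF u[unfolded emb]] matrix_vector_mult_scaleR half by (simp add: axis_eq_0_iff)
  have U_ev: "(\<exists>w \<in> U. is_eigenvector Lam w) \<longleftrightarrow>
      (\<exists>a b c. a\<^sup>2 + b\<^sup>2 = 1 \<and> A *v vector [a, 0, b] = c *\<^sub>R vector [a, 0, b])"
  proof
    assume "\<exists>w \<in> U. is_eigenvector Lam w"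
    then obtain w where w: "w \<in> U" "is_eigenvector Lam w" by blast
    then have "Ad B w \<in> Ad B ` U" by blast
    then obtain a b where "a\<^sup>2 + b\<^sup>2 = 1" "Ad B w = embed_block (vector [a, 0, b])"
      unfolding U emb by blast
    then show "\<exists>a b c. a\<^sup>2 + b\<^sup>2 = 1 \<and> A *v vector [a, 0, b] = c *\<^sub>R vector [a, 0, b]"
      using ev w(2) by blast
  next
    assume "\<exists>a b c. a\<^sup>2 + b\<^sup>2 = 1 \<and> A *v vector [a, 0, b] = c *\<^sub>R vector [a, 0, b]"
    then obtain a b c where ab: "a\<^sup>2 + b\<^sup>2 = 1" "A *v vector [a, 0, b] = c *\<^sub>R vector [a, 0, b]" by blast
    then have "embed_block (vector [a, 0, b]) \<in> Ad B ` U"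
      unfolding U emb by blast
    then obtain w where "w \<in> U" "Ad B w = embed_block (vector [a, 0, b])" by auto
    moreover have "vector [a, 0, b] \<noteq> (0 :: real ^ 3)"
      using ab(1) by (auto simp: vec_eq_iff forall_3)
    ultimately show "\<exists>w \<in> U. is_eigenvector Lam w" using ev ab(2) by blast
  qed
  show ?thesis
  proof
    assume "is_eigenvector Lam u \<or> (\<exists>w \<in> U. is_eigenvector Lam w)"
    then show "\<not> generic_block A"
    proof
      assume "is_eigenvector Lam u"
      then obtain c where "A *v axis 2 1 = c *\<^sub>R axis 2 1" using u_ev by blast
      moreover have "axis 2 1 \<noteq> (0 :: real ^ 3)" by (simp add: axis_eq_0_iff)
      moreover have "(axis 2 1 :: real ^ 3) $ 1 = 0" "(axis 2 1 :: real ^ 3) $ 3 = 0" by (simp_all add: axis_def)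
      ultimately show ?thesis unfolding generic_block_def by blast
    next
      assume "\<exists>w \<in> U. is_eigenvector Lam w"
      then obtain a b c where ab: "a\<^sup>2 + b\<^sup>2 = 1" "A *v vector [a, 0, b] = c *\<^sub>R vector [a, 0, b]"
        using U_ev by blast
      moreover have "vector [a, 0, b] \<noteq> (0 :: real ^ 3)" "(vector [a, 0, b] :: real ^ 3) $ 2 = 0"
        using ab(1) by (auto simp: vec_eq_iff forall_3)
      ultimately show ?thesis unfolding generic_block_def by blast
    qed
  next
    assume "\<not> generic_block A"
    then obtain y c where y: "y \<noteq> 0" "A *v y = c *\<^sub>R y" and cases: "y $ 2 = 0 \<or> y $ 1 = 0 \<and> y $ 3 = 0"
      unfolding generic_block_def by blast
    show "is_eigenvector Lam u \<or> (\<exists>w \<in> U. is_eigenvector Lam w)"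
    proof (cases "y $ 2 = 0")
      case False
      define t where "t = 1 / y $ 2"
      have "t *\<^sub>R y = axis 2 1"
        using False cases by (auto simp: t_def vec_eq_iff forall_3 axis_def)
      moreover have "A *v (t *\<^sub>R y) = c *\<^sub>R (t *\<^sub>R y)"
        by (simp add: matrix_vector_mult_scaleR y(2))
      ultimately have "A *v axis 2 1 = c *\<^sub>R axis 2 1" by simp
      then show ?thesis using u_ev by blast
    next
      case True
      have "norm y \<noteq> 0" using y(1) by simp
      define t where "t = 1 / norm y"
      have v: "t *\<^sub>R y = vector [t * y $ 1, 0, t * y $ 3]"
        using True by (simp add: vec_eq_iff forall_3)
      have "norm (t *\<^sub>R y) = 1" using y(1) by (simp add: t_def)
      then have "(t * y $ 1)\<^sup>2 + (t * y $ 3)\<^sup>2 = 1"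
        unfolding v norm_eq_1 by (simp add: inner_vec_def sum_3 power2_eq_square)
      moreover have "A *v (t *\<^sub>R y) = c *\<^sub>R (t *\<^sub>R y)"
        by (simp add: matrix_vector_mult_scaleR y(2))
      ultimately show ?thesis using U_ev unfolding v by blast
    qed
  qed
qed

end

theorem mainTheorem3:
  fixes V :: "doublets \<Rightarrow> real"
    and M0 Lam0 :: real and M L :: "real ^ 8" and Lam :: "real ^ 8 ^ 8"
    and X B :: "complex ^ 3 ^ 3"
    and \<mu>1 \<mu>2 :: real and E1 E2 :: "(real ^ 8) set"
  assumes "is_potential V"
    and "is_bilinear_form V M0 M Lam0 L Lam"
    and "cp4_symmetry V X"
    and "canonical_cp4_basis X B"
    and "\<mu>1 \<noteq> \<mu>2"
    and "E1 = eigenspace_in (W4 B) Lam \<mu>1" and "dim E1 = 2"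
    and "E2 = eigenspace_in (W4 B) Lam \<mu>2" and "dim E2 = 2"
  shows "\<exists>u. u_vectors E1 E2 = {u, - u} \<and>
    ((is_eigenvector Lam u \<or> (\<exists>w \<in> U_vectors E1 E2. is_eigenvector Lam w)) \<longrightarrow>
       (\<exists>X'. cp2_symmetry V X')) \<and>
    (\<not> is_eigenvector Lam u \<and> (\<forall>w \<in> U_vectors E1 E2. \<not> is_eigenvector Lam w) \<longrightarrow>
       (\<nexists>X'. cp2_symmetry V X') \<and> pure_cp4_model V X)"
proof -
  interpret cp4_potential V M0 Lam0 M L Lam X
    using assms by unfold_locales
  \<comment> \<open>The eigenspaces are still those defined through \<open>B\<close>; the basis
    \<open>C\<close> only moves them into coordinate planes.\<close>
  obtain C where cC: "canonical_cp4_basis X C"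
    and E1: "Ad C ` E1 = coord_plane 4 6" and E2: "Ad C ` E2 = coord_plane 5 7"
    using adapted_basis[OF assms(4,5)] assms(6-9) by metis
  have uC: "unitary C" using cC by (simp add: canonical_cp4_basis_def)
  obtain A l where sym: "transpose A = A"
    and Lam: "\<And>x. Ad C (Lam *v x) = block_form A \<mu>1 \<mu>2 l (Ad C x)"
    using Lam_block_form[OF cC] E1 E2 assms(6,8) by metis
  define u where "u = Ad (dagger C) ((1 / 2) *\<^sub>R axis 2 1)"
  have Cu: "Ad C u = (1 / 2) *\<^sub>R axis 2 1" by (simp add: u_def Ad_Ad_dagger[OF uC])
  have "Ad C ` u_vectors E1 E2 = Ad C ` {u, - u}"
    using u_vectors_coord_planes unfolding E1[symmetric] E2[symmetric] u_vectors_Ad[OF uC]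
    by (simp add: Cu linear_neg[OF linear_Ad])
  then have uv: "u_vectors E1 E2 = {u, - u}" by (simp only: inj_image_eq_iff[OF inj_Ad[OF uC]])
  have "Ad C ` U_vectors E1 E2 = {a *\<^sub>R axis 1 1 + b *\<^sub>R axis 3 1 | a b. a\<^sup>2 + b\<^sup>2 = 1}"
    using U_vectors_coord_planes unfolding E1[symmetric] E2[symmetric] U_vectors_Ad[OF uC] .
  note gen = eigenvector_iff_not_generic[OF uC Lam Cu this]
  have "\<exists>X'. cp2_symmetry V X'" if "\<not> generic_block A"
    by (rule cp2_of_not_generic[OF cC sym Lam that])
  moreover have "(\<nexists>X'. cp2_symmetry V X') \<and> pure_cp4_model V X" if "generic_block A"
  proof -
    note fam = family_symmetry_trivial[OF cC sym assms(5) Lam that]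
    show ?thesis using no_cp2[OF cp_symmetry_trivial[OF fam]] pure_cp4[OF fam] by blast
  qed
  ultimately show ?thesis using uv gen by blast
qed

end
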